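(* Let $\epsilon\in\mathbb R$ and $x\in\mathcal X_0$. Assume the following. (1) The support $\mathcal X$ of $X$ is a compact subset of $\mathbb R^d$ and $\mathcal X_0$ is an inner closed subset of $\mathcal X$ (a closed set lying in the interior of $\mathcal X$) with nonempty interior. (2) The p.d.f. $g$ of $X$ is strictly positive over $\mathcal X_0$ and has continuous second order partial derivatives over $\mathcal X$. (3) $m$ has continuous second order partial derivatives over $\mathcal X$. (4) The i.i.d. errors $\varepsilon,\varepsilon_i$ are centered, have finite 6th moments, and are independent of the covariates $X,X_i$. (5) The p.d.f. $f$ of $\varepsilon$ has bounded continuous second order derivatives over $\mathbb R$ and, for $h_p(e)=e^pf(e)$, $\sup_{e\in\mathbb R}|h_p^{(k)}(e)|<\infty$ for integers $p,k\in[0,2]$. (6) The p.d.f. $\varphi$ of $(X,Y)$ has bounded continuous second order partial derivatives over $\mathbb R^d\times\mathbb R$. (7) $K_0$ is symmetric, continuous over $\mathbb R^d$ with support contained in $[-1/2,1/2]^d$, and $\int K_0(z)\,dz=1$. (8) $K_1$ has compact support, is three times continuously differentiable over $\mathbb R$, $\int K_1(v)\,dv=1$ and $\int vK_1(v)\,dv=0$. (9) $b_0$ decreases to $0$ and, for $d^*=\sup\{d+2,2d\}$, $nb_0^{d^*}/\ln n\to\infty$ and $\ln(1/b_0)/\ln(\ln n)\to\infty$. (10) A further bandwidth $b_1$ decreases to $0$ with $n^{d+8}b_1^{7(d+4)}\to\infty$. (11) $h_0$ and $h_1$ decrease to $0$, with $nh_0^{2d}/\ln n\to\infty$, $\ln(1/h_0)/\ln(\ln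 n)\to\infty$, $nh_0^dh_1\to\infty$ and $$\left(\frac{nh_0^d}{h_1}\right)\left(b_0^4+\frac{\ln n}{nb_0^d}\right)=o(1).$$ Then, as $n\to\infty$, $$\sqrt{nh_0^dh_1}\left(\widetilde f_n(\epsilon|x)-\overline{\widetilde f}_n(\epsilon|x)\right)\xrightarrow{d}\mathcal N\left(0,\ \frac{f(\epsilon|x)}{g(x)}\int\!\!\int K_0^2(z)K_1^2(v)\,dz\,dv\right),$$ where $$\overline{\widetilde f}_n(\epsilon|x)=f(\epsilon|x)+\frac{h_0^2\mu_1(x,\epsilon)}{2g(x)}+\frac{h_1^2\mu_2(x,\epsilon)}{2g(x)}+o(h_0^2+h_1^2).$$
   Context: $(X,Y),(X_1,Y_1),\dots,(X_n,Y_n)$ are i.i.d. with $Y$ real and $X$ in $\mathbb R^d$; $m(x)=\mathbb E[Y|X=x]$, $Y_i=m(X_i)+\varepsilon_i$. $f(\cdot|x)$ is the p.d.f. of $\varepsilon$ given $X=x$ (equal to $f$ by independence). Bandwidths $b_0,h_0,h_1$ depend on $n$. The Nadaraya–Watson estimator is $$\widehat m_n(x)=\frac{\sum_{j=1}^nY_jK_0\left(\frac{X_j-x}{b_0}\right)}{\sum_{j=1}^nK_0\left(\frac{X_j-x}{b_0}\right)},$$ and $$\widetilde f_n(\epsilon|x)=\frac{\frac1{nh_0^dh_1}\sum_{i=1}^nK_0\left(\frac{X_i-x}{h_0}\right)K_1\left(\frac{Y_i-\widehat m_n(x)-\epsilon}{h_1}\right)}{\frac1{nh_0^d}\sum_{i=1}^nK_0\left(\frac{X_i-x}{h_0}\right)}.$$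 With $z$ a row vector and $\frac{\partial^2\varphi}{\partial^2x}$ the Hessian of $\varphi$ in its first argument, $$\mu_1(x,\epsilon)=\int z\,\frac{\partial^2\varphi(x,m(x)+\epsilon)}{\partial^2x}\,z^\top K_0(z)\,dz,\qquad \mu_2(x,\epsilon)=\frac{\partial^2\varphi(x,m(x)+\epsilon)}{\partial^2y}\int v^2K_1(v)\,dv.$$ *)

theory Defs
  imports "HOL-Probability.Probability" "HOL-Library.Landau_Symbols"
begin

section \<open>Probabilistic notions\<close>

definition iid :: "'w measure \<Rightarrow> 'a measure \<Rightarrow> (nat \<Rightarrow> 'w \<Rightarrow> 'a) \<Rightarrow> bool" where
  "iid M N Z \<longleftrightarrow>
     prob_space.indep_vars M (\<lambda>_. N) Z UNIV \<and> (\<forall>i. distr M N (Z i) = distr M N (Z 0))"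

text \<open>Independence of two random variables with possibly different value types: the generated
  sigma-algebras are independent. (The library's \<open>indep_var\<close> needs equal types.)\<close>

definition indep_rvs ::
    "'w measure \<Rightarrow> 'a measure \<Rightarrow> ('w \<Rightarrow> 'a) \<Rightarrow> 'b measure \<Rightarrow> ('w \<Rightarrow> 'b) \<Rightarrow> bool" where
  "indep_rvs M A U B V \<longleftrightarrow> U \<in> measurable M A \<and> V \<in> measurable M B \<and>
     prob_space.indep_set M (sets (vimage_algebra (space M) U A)) (sets (vimage_algebra (space M) V B))"

text \<open>The topological support of the law of a random variable.\<close>

definition rv_support :: "'w measure \<Rightarrow> ('w \<Rightarrow> 'a::topological_space) \<Rightarrow> 'a set" where
  "rv_support M X = {x. \<forall>U. open U \<longrightarrow> x \<in> U \<longrightarrow> measure M (X -` U \<inter> space M) > 0}"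

text \<open>The library predicate \<^const>\<open>distributed\<close> takes \<^typ>\<open>ennreal\<close>-valued densities, and
  \<^const>\<open>ennreal\<close> truncates negative numbers to 0; hence the explicit nonnegativity.\<close>

definition has_pdf :: "'w measure \<Rightarrow> ('w \<Rightarrow> 'a::euclidean_space) \<Rightarrow> ('a \<Rightarrow> real) \<Rightarrow> bool" where
  "has_pdf M X p \<longleftrightarrow> (\<forall>x. 0 \<le> p x) \<and> distributed M lborel X (\<lambda>x. ennreal (p x))"

text \<open>\<open>m x = E[Y | X = x]\<close>, that is, \<open>m\<close> is a measurable function for which \<open>m(X)\<close> is a version of
  the conditional expectation of \<open>Y\<close> given the sigma-algebra generated by \<open>X\<close>.\<close>

definition regression_fun ::
    "'w measure \<Rightarrow> ('w \<Rightarrow> 'a::topological_space) \<Rightarrow> ('w \<Rightarrow> real) \<Rightarrow> ('a \<Rightarrow> real) \<Rightarrow> bool" where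
  "regression_fun M X Y m \<longleftrightarrow>
     integrable M Y \<and> m \<in> borel_measurable borel \<and>
     (AE w in M. real_cond_exp M (vimage_algebra (space M) X borel) Y w = m (X w))"

text \<open>The normal law with mean \<open>a\<close> and variance \<open>v \<ge> 0\<close>; it is the point mass at \<open>a\<close> if \<open>v = 0\<close>.\<close>

definition normal_law :: "real \<Rightarrow> real \<Rightarrow> real measure" where
  "normal_law a v =
     (if v = 0 then return borel a else density lborel (\<lambda>t. ennreal (normal_density a (sqrt v) t)))"

section \<open>Differentiability\<close>

definition Ck :: "nat \<Rightarrow> (real \<Rightarrow> real) \<Rightarrow> bool" where
  "Ck k F \<longleftrightarrow> (\<forall>j<k. \<forall>x. (deriv ^^ j) F field_differentiable at x) \<and>
     continuous_on UNIV ((deriv ^^ k) F)"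

text \<open>\<open>P b\<close> and \<open>Q b c\<close> are the continuous first and second order partial derivatives of \<open>F\<close> over
  \<open>S\<close>, for \<open>b\<close>, \<open>c\<close> ranging over the canonical basis. The set \<open>S\<close> need not be open: difference
  quotients are taken along the part of the coordinate line that lies in \<open>S\<close>, so that the partial
  derivatives are one-sided where necessary and are the usual ones in the interior of \<open>S\<close>.\<close>

definition has_C2_partials ::
    "'a::euclidean_space set \<Rightarrow> ('a \<Rightarrow> real) \<Rightarrow> ('a \<Rightarrow> 'a \<Rightarrow> real) \<Rightarrow> ('a \<Rightarrow> 'a \<Rightarrow> 'a \<Rightarrow> real) \<Rightarrow> bool"
  where
  "has_C2_partials S F P Q \<longleftrightarrow>
     continuous_on S F \<and>
     (\<forall>b\<in>Basis. continuous_on S (P b) \<and>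
        (\<forall>x\<in>S. ((\<lambda>t. F (x + t *\<^sub>R b)) has_real_derivative P b x)
                  (at 0 within {t. x + t *\<^sub>R b \<in> S}))) \<and>
     (\<forall>b\<in>Basis. \<forall>c\<in>Basis. continuous_on S (Q b c) \<and>
        (\<forall>x\<in>S. ((\<lambda>t. P b (x + t *\<^sub>R c)) has_real_derivative Q b c x)
                  (at 0 within {t. x + t *\<^sub>R c \<in> S})))"

definition C2_on :: "'a::euclidean_space set \<Rightarrow> ('a \<Rightarrow> real) \<Rightarrow> bool" where
  "C2_on S F \<longleftrightarrow> (\<exists>P Q. has_C2_partials S F P Q)"

definition C2_on_bounded :: "'a::euclidean_space set \<Rightarrow> ('a \<Rightarrow> real) \<Rightarrow> bool" where
  "C2_on_bounded S F \<longleftrightarrow>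
     (\<exists>P Q. has_C2_partials S F P Q \<and> (\<forall>b\<in>Basis. \<forall>c\<in>Basis. bounded (Q b c ` S)))"

definition partial_deriv :: "'d::finite \<Rightarrow> (real^'d \<Rightarrow> real) \<Rightarrow> real^'d \<Rightarrow> real" where
  "partial_deriv i F x = deriv (\<lambda>t. F (x + t *\<^sub>R axis i 1)) 0"

definition hessian :: "(real^'d::finite \<Rightarrow> real) \<Rightarrow> real^'d \<Rightarrow> real^'d^'d" where
  "hessian F x = (\<chi> i j. partial_deriv i (partial_deriv j F) x)"

section \<open>Kernel estimators\<close>

definition bandwidth :: "(nat \<Rightarrow> real) \<Rightarrow> bool" where
  "bandwidth b \<longleftrightarrow> (\<forall>n. b n > 0) \<and> decseq b \<and> b \<longlonglongrightarrow> 0"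

definition nw_estimator ::
    "(real^'d::finite \<Rightarrow> real) \<Rightarrow> real \<Rightarrow> (nat \<Rightarrow> 'w \<Rightarrow> real^'d) \<Rightarrow> (nat \<Rightarrow> 'w \<Rightarrow> real) \<Rightarrow>
     nat \<Rightarrow> real^'d \<Rightarrow> 'w \<Rightarrow> real" where
  "nw_estimator K b X Y n x w =
     (\<Sum>j=1..n. Y j w * K ((X j w - x) /\<^sub>R b)) / (\<Sum>j=1..n. K ((X j w - x) /\<^sub>R b))"

definition cond_pdf_estimator ::
    "(real^'d::finite \<Rightarrow> real) \<Rightarrow> (real \<Rightarrow> real) \<Rightarrow> real \<Rightarrow> real \<Rightarrow> real \<Rightarrow>
     (nat \<Rightarrow> 'w \<Rightarrow> real^'d) \<Rightarrow> (nat \<Rightarrow> 'w \<Rightarrow> real) \<Rightarrow> nat \<Rightarrow> real \<Rightarrow> real^'d \<Rightarrow> 'w \<Rightarrow> real" where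
  "cond_pdf_estimator K0 K1 b0 h0 h1 X Y n \<epsilon> x w =
     (1 / (real n * h0 ^ CARD('d) * h1) *
        (\<Sum>i=1..n. K0 ((X i w - x) /\<^sub>R h0) *
                  K1 ((Y i w - nw_estimator K0 b0 X Y n x w - \<epsilon>) / h1))) /
     (1 / (real n * h0 ^ CARD('d)) * (\<Sum>i=1..n. K0 ((X i w - x) /\<^sub>R h0)))"

definition bias1 ::
    "(real^'d::finite \<Rightarrow> real) \<Rightarrow> ((real^'d) \<times> real \<Rightarrow> real) \<Rightarrow> (real^'d \<Rightarrow> real) \<Rightarrow>
     real^'d \<Rightarrow> real \<Rightarrow> real" where
  "bias1 K0 \<phi> m x \<epsilon> =
     (\<integral>z. (z \<bullet> (hessian (\<lambda>u. \<phi> (u, m x + \<epsilon>)) x *v z)) * K0 z \<partial>lborel)"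

definition bias2 ::
    "(real \<Rightarrow> real) \<Rightarrow> ((real^'d::finite) \<times> real \<Rightarrow> real) \<Rightarrow> (real^'d \<Rightarrow> real) \<Rightarrow>
     real^'d \<Rightarrow> real \<Rightarrow> real" where
  "bias2 K1 \<phi> m x \<epsilon> =
     (deriv ^^ 2) (\<lambda>y. \<phi> (x, y)) (m x + \<epsilon>) * (\<integral>v. v\<^sup>2 * K1 v \<partial>lborel)"

end

theory Submission
  imports Defs
begin

text \<open>
  Write \<open>a\<^sub>n\<^sup>2 = n h\<^sub>0\<^sup>d h\<^sub>1\<close>, let \<open>D\<^sub>n\<close> be the kernel density estimator of \<open>g(x)\<close> and \<open>N\<^sub>n(t)\<close> the numerator of
  the estimator in which the Nadaraya--Watson value is replaced by \<open>t\<close>, so that the estimator is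
  \<open>N\<^sub>n(t)/D\<^sub>n\<close> with \<open>t\<close> the Nadaraya--Watson estimate of \<open>m(x)\<close>. The proof rests on the decomposition,
  for a deterministic centring \<open>\<theta>\<^sub>n\<close>,

    \<open>N\<^sub>n(t)/D\<^sub>n - \<theta>\<^sub>n = ((N\<^sub>n(t) - N\<^sub>n(m(x))) + (N\<^sub>n(m(x)) - \<theta>\<^sub>n D\<^sub>n)) / D\<^sub>n\<close>.

  The second bracket is an average of i.i.d. terms, and \<open>D\<^sub>n \<rightarrow> g(x)\<close> in probability. The
  summands, multiplied by \<open>a\<^sub>n/n\<close>, are bounded by a constant over \<open>a\<^sub>n\<close>, so Lindeberg's condition is
  trivial and a comparison of characteristic functions gives the normal limit
  (\<open>char_row_sum_tendsto_normal\<close>). As \<open>h\<^sub>1 \<rightarrow> 0\<close>, only the square of the product of the two kernels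
  survives in the variance (\<open>summand_second_moment_tendsto\<close>), and division by \<open>g(x)\<^sup>2\<close> gives the stated
  variance. If \<open>f(\<epsilon>) = 0\<close> the limit is degenerate; characteristic functions cover this case as well.

  The first bracket is the price of estimating \<open>m(x)\<close>. As \<open>K\<^sub>1\<close> is Lipschitz and compactly supported, it is
  at most \<open>L |t - m(x)| / h\<^sub>1\<close> times an average that stays bounded in \<open>L\<^sup>1\<close>, and
  the last bandwidth condition ensures that \<open>(a\<^sub>n/h\<^sub>1)\<^sup>2\<close> times the squared bias \<open>b\<^sub>0\<^sup>4\<close> plus the
  variance \<open>1/(n b\<^sub>0\<^sup>d)\<close> of the Nadaraya--Watson estimator tends to zero
  (\<open>nw_estimator_rate\<close>, \<open>plug_in_negligible\<close>). Replacing \<open>t\<close> by \<open>m(x)\<close> in this crude way is legitimate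
  although the same observations enter \<open>t\<close> and \<open>N\<^sub>n\<close>.

  It remains to choose \<open>\<theta>\<^sub>n\<close>. The same bandwidth condition forces \<open>h\<^sub>0 \<le> b\<^sub>0\<close> eventually, hence
  \<open>a\<^sub>n h\<^sub>0\<^sup>2 \<rightarrow> 0\<close>: every bias term of order \<open>h\<^sub>0\<^sup>2\<close>, whatever its coefficient, disappears in the limit. In
  particular the \<open>h\<^sub>0\<^sup>2\<close> bias of the denominator, which is absent from the expansion of the centring, does no
  harm. The \<open>h\<^sub>1\<^sup>2\<close> bias must be exact; it is \<open>f''(\<epsilon>)/2\<close> times the second moment of \<open>K\<^sub>1\<close>
  (\<open>second_order_bias\<close>), and its remainder of order \<open>o(h\<^sub>1\<^sup>2)\<close> is absorbed into \<open>\<theta>\<^sub>n\<close>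
  (\<open>centering_exists\<close>). Comparison with the expansion written in terms of \<open>\<phi>\<close> uses
  \<open>\<phi>(x, y) = g(x) f(y - m(x))\<close>, which holds almost everywhere by independence
  (\<open>joint_density_eq\<close>) and then at \<open>x\<close> by continuity.
\<close>

section \<open>Convergence in probability\<close>

text \<open>\<open>P n\<close> holds with probability tending to one. The exceptional events are only required to be
  contained in small measurable sets, so that \<open>P n\<close> itself need not be measurable.\<close>

definition whp :: "'w measure \<Rightarrow> (nat \<Rightarrow> 'w \<Rightarrow> bool) \<Rightarrow> bool" where
  "whp M P \<longleftrightarrow> (\<forall>\<delta>>0. \<forall>\<^sub>F n in sequentially. \<exists>A\<in>sets M. measure M A \<le> \<delta> \<and> (\<forall>w\<in>space M - A. P n w))"

definition vanishes_in_prob :: "'w measure \<Rightarrow> (nat \<Rightarrow> 'w \<Rightarrow> real) \<Rightarrow> bool" where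
  "vanishes_in_prob M Z \<longleftrightarrow> (\<forall>e>0. whp M (\<lambda>n w. \<bar>Z n w\<bar> \<le> e))"

lemma whp_mono:
  assumes "whp M P" "\<forall>\<^sub>F n in sequentially. \<forall>w\<in>space M. P n w \<longrightarrow> Q n w"
  shows "whp M Q"
  unfolding whp_def
proof (intro allI impI)
  fix \<delta> :: real assume "\<delta> > 0"
  then have "\<forall>\<^sub>F n in sequentially. \<exists>A\<in>sets M. measure M A \<le> \<delta> \<and> (\<forall>w\<in>space M - A. P n w)"
    using assms(1) unfolding whp_def by blast
  then show "\<forall>\<^sub>F n in sequentially. \<exists>A\<in>sets M. measure M A \<le> \<delta> \<and> (\<forall>w\<in>space M - A. Q n w)"
    using assms(2) by eventually_elim blast
qed

lemma whp_always: "\<forall>\<^sub>F n in sequentially. \<forall>w\<in>space M. P n w \<Longrightarrow> whp M P"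
  unfolding whp_def by (auto elim!: eventually_mono intro!: bexI[of _ "{}"])

lemma whp_conj:
  assumes "whp M P" "whp M Q"
  shows "whp M (\<lambda>n w. P n w \<and> Q n w)"
  unfolding whp_def
proof (intro allI impI)
  fix \<delta> :: real assume "\<delta> > 0"
  then have "\<forall>\<^sub>F n in sequentially. \<exists>A\<in>sets M. measure M A \<le> \<delta>/2 \<and> (\<forall>w\<in>space M - A. P n w)"
    "\<forall>\<^sub>F n in sequentially. \<exists>A\<in>sets M. measure M A \<le> \<delta>/2 \<and> (\<forall>w\<in>space M - A. Q n w)"
    using assms half_gt_zero[of \<delta>] unfolding whp_def by blast+
  then show "\<forall>\<^sub>F n in sequentially. \<exists>A\<in>sets M. measure M A \<le> \<delta> \<and> (\<forall>w\<in>space M - A. P n w \<and> Q n w)"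
  proof eventually_elim
    case (elim n)
    obtain A B where AB: "A \<in> sets M" "measure M A \<le> \<delta>/2" "\<forall>w\<in>space M - A. P n w"
      "B \<in> sets M" "measure M B \<le> \<delta>/2" "\<forall>w\<in>space M - B. Q n w" using elim by blast
    have "measure M (A \<union> B) \<le> \<delta>"
      using measure_Un_le[of A M B] AB by auto
    then show ?case using AB by (intro bexI[of _ "A \<union> B"]) auto
  qed
qed

lemma vanishes_mono:
  assumes "vanishes_in_prob M U" "whp M (\<lambda>n w. \<bar>Z n w\<bar> \<le> \<bar>U n w\<bar>)"
  shows "vanishes_in_prob M Z"
  unfolding vanishes_in_prob_def
proof (intro allI impI)
  fix e :: real assume "e > 0"
  then have "whp M (\<lambda>n w. \<bar>U n w\<bar> \<le> e \<and> \<bar>Z n w\<bar> \<le> \<bar>U n w\<bar>)"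
    using assms unfolding vanishes_in_prob_def by (intro whp_conj) auto
  then show "whp M (\<lambda>n w. \<bar>Z n w\<bar> \<le> e)" by (rule whp_mono) auto
qed

lemma vanishes_add:
  assumes "vanishes_in_prob M U" "vanishes_in_prob M Z"
  shows "vanishes_in_prob M (\<lambda>n w. U n w + Z n w)"
  unfolding vanishes_in_prob_def
proof (intro allI impI)
  fix e :: real assume "e > 0"
  then have "whp M (\<lambda>n w. \<bar>U n w\<bar> \<le> e/2 \<and> \<bar>Z n w\<bar> \<le> e/2)"
    using assms half_gt_zero[of e] unfolding vanishes_in_prob_def by (intro whp_conj) blast+
  then show "whp M (\<lambda>n w. \<bar>U n w + Z n w\<bar> \<le> e)"
    by (rule whp_mono) (auto intro!: always_eventually)
qed

lemma vanishes_mult_bounded: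
  assumes "vanishes_in_prob M U" "whp M (\<lambda>n w. \<bar>W n w\<bar> \<le> C)"
  shows "vanishes_in_prob M (\<lambda>n w. U n w * W n w)"
  unfolding vanishes_in_prob_def
proof (intro allI impI)
  fix e :: real assume "e > 0"
  then have "e / (\<bar>C\<bar> + 1) > 0" by auto
  then have "whp M (\<lambda>n w. \<bar>U n w\<bar> \<le> e / (\<bar>C\<bar> + 1) \<and> \<bar>W n w\<bar> \<le> C)"
    using assms unfolding vanishes_in_prob_def by (intro whp_conj) auto
  then show "whp M (\<lambda>n w. \<bar>U n w * W n w\<bar> \<le> e)"
  proof (rule whp_mono, intro always_eventually allI ballI impI)
    fix n w assume *: "\<bar>U n w\<bar> \<le> e / (\<bar>C\<bar> + 1) \<and> \<bar>W n w\<bar> \<le> C"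
    have "\<bar>U n w * W n w\<bar> \<le> e / (\<bar>C\<bar> + 1) * (\<bar>C\<bar> + 1)"
      unfolding abs_mult using * \<open>e > 0\<close> by (intro mult_mono) auto
    then show "\<bar>U n w * W n w\<bar> \<le> e" by (simp add: add_nonneg_eq_0_iff split: if_splits)
  qed
qed

lemma vanishes_deterministic:
  assumes "c \<longlonglongrightarrow> (0::real)"
  shows "vanishes_in_prob M (\<lambda>n w. c n)"
  unfolding vanishes_in_prob_def
proof (intro allI impI whp_always)
  fix e :: real assume "e > 0"
  then have "\<forall>\<^sub>F n in sequentially. \<bar>c n\<bar> < e" using assms by (simp add: tendsto_iff)
  then show "\<forall>\<^sub>F n in sequentially. \<forall>w\<in>space M. \<bar>c n\<bar> \<le> e"
    by eventually_elim auto
qed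

lemma (in prob_space) vanishes_of_L2:
  assumes [measurable]: "\<And>n. Z n \<in> borel_measurable M"
    and int: "\<forall>\<^sub>F n in sequentially. integrable M (\<lambda>w. (Z n w)\<^sup>2)"
    and lim: "(\<lambda>n. expectation (\<lambda>w. (Z n w)\<^sup>2)) \<longlonglongrightarrow> 0"
  shows "vanishes_in_prob M Z"
  unfolding vanishes_in_prob_def whp_def
proof (intro allI impI)
  fix e \<delta> :: real assume "e > 0" "\<delta> > 0"
  then have "\<forall>\<^sub>F n in sequentially. expectation (\<lambda>w. (Z n w)\<^sup>2) < \<delta> * e\<^sup>2"
    using lim by (intro order_tendstoD) auto
  with int show "\<forall>\<^sub>F n in sequentially. \<exists>A\<in>events. prob A \<le> \<delta> \<and> (\<forall>w\<in>space M - A. \<bar>Z n w\<bar> \<le> e)"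
  proof eventually_elim
    case (elim n)
    have "prob {w\<in>space M. \<bar>Z n w\<bar> \<ge> e} \<le> expectation (\<lambda>w. (Z n w)\<^sup>2) / e\<^sup>2"
      using elim \<open>e > 0\<close> by (intro second_moment_method) auto
    also have "\<dots> \<le> \<delta>" using elim \<open>e > 0\<close> by (simp add: field_simps)
    finally show ?case by (intro bexI[of _ "{w\<in>space M. \<bar>Z n w\<bar> \<ge> e}"]) auto
  qed
qed

text \<open>Markov's inequality makes an \<open>L\<^sup>1\<close>-bounded factor bounded outside an event of probability \<open>\<delta>/2\<close>;
  this is the rule that a vanishing factor times a tight one vanishes.\<close>

lemma (in prob_space) vanishes_mult_L1:
  assumes U: "vanishes_in_prob M U"
    and W: "\<And>n. integrable M (W n)" "\<forall>\<^sub>F n in sequentially. expectation (\<lambda>w. \<bar>W n w\<bar>) \<le> C"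
  shows "vanishes_in_prob M (\<lambda>n w. U n w * W n w)"
  unfolding vanishes_in_prob_def whp_def
proof (intro allI impI)
  fix e \<delta> :: real assume e: "e > 0" and \<delta>: "\<delta> > 0"
  have [measurable]: "W n \<in> borel_measurable M" for n using W(1) by auto
  \<comment> \<open>The Markov level at which the second factor exceeds \<open>K\<close> with probability at most \<open>\<delta>/2\<close>.\<close>
  define K where "K = 2 * (\<bar>C\<bar> + 1) / \<delta>"
  have K: "K > 0" using \<delta> by (simp add: K_def)
  have "\<forall>\<^sub>F n in sequentially. \<exists>A\<in>sets M. measure M A \<le> \<delta>/2 \<and> (\<forall>w\<in>space M - A. \<bar>U n w\<bar> \<le> e / K)"
    using U divide_pos_pos[OF e K] half_gt_zero[OF \<delta>] unfolding vanishes_in_prob_def whp_def by blast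
  with W(2) show "\<forall>\<^sub>F n in sequentially. \<exists>A\<in>events. prob A \<le> \<delta> \<and> (\<forall>w\<in>space M - A. \<bar>U n w * W n w\<bar> \<le> e)"
  proof eventually_elim
    case (elim n)
    obtain A where A: "A \<in> sets M" "measure M A \<le> \<delta>/2" "\<forall>w\<in>space M - A. \<bar>U n w\<bar> \<le> e / K"
      using elim by blast
    let ?B = "{w\<in>space M. \<bar>W n w\<bar> \<ge> K}"
    have B: "?B \<in> events" by measurable
    have "prob ?B \<le> expectation (\<lambda>w. \<bar>W n w\<bar>) / K"
      using K W(1) by (intro integral_Markov_inequality_measure[where A = "{}"]) auto
    also have "\<dots> \<le> (\<bar>C\<bar> + 1) / K" using elim K by (intro divide_right_mono) auto
    also have "\<dots> = \<delta> / 2" 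
    proof -
      have "\<bar>C\<bar> + 1 \<noteq> 0" by linarith
      then show ?thesis unfolding K_def using \<delta> by (metis divide_divide_eq_right mult.commute nonzero_mult_divide_mult_cancel_right)
    qed
    finally have "prob (A \<union> ?B) \<le> \<delta>"
      using measure_Un_le[of A M ?B] A B by auto
    moreover have "\<bar>U n w * W n w\<bar> \<le> e" if "w \<in> space M - (A \<union> ?B)" for w
    proof -
      have "\<bar>U n w * W n w\<bar> \<le> e / K * K"
        unfolding abs_mult using that A e K by (intro mult_mono) auto
      then show ?thesis using K by simp
    qed
    ultimately show ?case using A B by (intro bexI[of _ "A \<union> ?B"]) auto
  qed
qed

lemma vanishes_cong_whp:
  assumes "vanishes_in_prob M U" "whp M (\<lambda>n w. Z n w = U n w)"
  shows "vanishes_in_prob M Z"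
  using assms(1) by (rule vanishes_mono) (rule whp_mono[OF assms(2)], simp)

section \<open>Characteristic functions of row sums\<close>

text \<open>Slutsky's lemma on the level of characteristic functions: \<open>s \<mapsto> exp(its)\<close> is bounded and
  \<open>|t|\<close>-Lipschitz, so a perturbation that vanishes in probability changes the characteristic function
  by a null sequence.\<close>

lemma (in prob_space) char_tendsto_perturb:
  assumes [measurable]: "\<And>n. U n \<in> borel_measurable M" "\<And>n. V n \<in> borel_measurable M"
    and close: "vanishes_in_prob M (\<lambda>n w. U n w - V n w)"
    and lim: "(\<lambda>n. char (distr M borel (V n)) t) \<longlonglongrightarrow> L"
  shows "(\<lambda>n. char (distr M borel (U n)) t) \<longlonglongrightarrow> L"
proof -
  have bound: "cmod (char (distr M borel (U n)) t - char (distr M borel (V n)) t) \<le> e + 2 * prob A"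
    if A: "A \<in> events" "\<forall>w\<in>space M - A. \<bar>t * (U n w - V n w)\<bar> \<le> e" and e: "e \<ge> 0" for n A e
  proof -
    have "cmod (iexp (t * U n w) - iexp (t * V n w)) \<le> \<bar>t * (U n w - V n w)\<bar>" for w
    proof -
      have "iexp (t * U n w) - iexp (t * V n w) = iexp (t * V n w) * (iexp (t * (U n w - V n w)) - 1)"
        by (simp add: algebra_simps flip: exp_add)
      also have "cmod \<dots> = cmod (iexp (t * (U n w - V n w)) - 1)"
        by (simp add: norm_mult)
      also have "\<dots> \<le> \<bar>t * (U n w - V n w)\<bar>"
        using iexp_approx1[of "t * (U n w - V n w)" 0] by simp
      finally show ?thesis .
    qed
    moreover have "cmod (iexp (t * U n w) - iexp (t * V n w)) \<le> 2" for w
      using norm_triangle_ineq4[of "iexp (t * U n w)" "iexp (t * V n w)"] by simp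
    ultimately have pw: "cmod (iexp (t * U n w) - iexp (t * V n w)) \<le> e + 2 * indicator A w"
      if "w \<in> space M" for w
    proof (cases "w \<in> A")
      case True
      then have "2 \<le> e + 2 * indicator A w" using e by simp
      with \<open>cmod (iexp (t * U n w) - iexp (t * V n w)) \<le> 2\<close> show ?thesis by linarith
    next
      case False
      then have "\<bar>t * (U n w - V n w)\<bar> \<le> e + 2 * indicator A w" using A that by simp
      with \<open>cmod (iexp (t * U n w) - iexp (t * V n w)) \<le> \<bar>t * (U n w - V n w)\<bar>\<close> show ?thesis by linarith
    qed
    have I: "integrable M (\<lambda>w. iexp (t * U n w))" "integrable M (\<lambda>w. iexp (t * V n w))"
      by (intro integrable_const_bound[where B = 1]; simp)+
    have "char (distr M borel (U n)) t - char (distr M borel (V n)) t =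
        (\<integral>w. iexp (t * U n w) - iexp (t * V n w) \<partial>M)"
      unfolding char_def by (subst (1 2) integral_distr) (use I in auto)
    also have "cmod \<dots> \<le> (\<integral>w. cmod (iexp (t * U n w) - iexp (t * V n w)) \<partial>M)"
      by (rule integral_norm_bound)
    also have "\<dots> \<le> (\<integral>w. e + 2 * indicator A w \<partial>M)"
      using I A by (intro integral_mono_AE AE_I2 pw) (auto intro!: integrable_add integrable_mult_right integrable_real_indicator simp: less_top[symmetric])
    also have "\<dots> = e + 2 * prob A"
      using A by (subst Bochner_Integration.integral_add) (auto simp: prob_space less_top[symmetric])
    finally show ?thesis .
  qed
  have "(\<lambda>n. char (distr M borel (U n)) t - char (distr M borel (V n)) t) \<longlonglongrightarrow> 0"
  proof (rule tendstoI)
    fix \<eta> :: real assume \<eta>: "\<eta> > 0"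
    then have "\<eta> / (4 * (\<bar>t\<bar> + 1)) > 0" "\<eta> / 8 > 0" by auto
    then have "\<forall>\<^sub>F n in sequentially. \<exists>A\<in>sets M. measure M A \<le> \<eta> / 8 \<and>
        (\<forall>w\<in>space M - A. \<bar>U n w - V n w\<bar> \<le> \<eta> / (4 * (\<bar>t\<bar> + 1)))"
      using close unfolding vanishes_in_prob_def whp_def by blast
    then show "\<forall>\<^sub>F n in sequentially. dist (char (distr M borel (U n)) t - char (distr M borel (V n)) t) 0 < \<eta>"
    proof eventually_elim
      case (elim n)
      obtain A where A: "A \<in> events" "prob A \<le> \<eta> / 8"
        "\<forall>w\<in>space M - A. \<bar>U n w - V n w\<bar> \<le> \<eta> / (4 * (\<bar>t\<bar> + 1))" using elim by blast
      have "\<bar>t * (U n w - V n w)\<bar> \<le> \<eta> / 4" if "w \<in> space M - A" for w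
      proof -
        have "\<bar>t * (U n w - V n w)\<bar> \<le> (\<bar>t\<bar> + 1) * (\<eta> / (4 * (\<bar>t\<bar> + 1)))"
          unfolding abs_mult using A that \<eta> by (intro mult_mono) auto
        also have "\<dots> = \<eta> / 4" using abs_ge_zero[of t] by (simp add: field_simps)
        finally show ?thesis .
      qed
      then show ?case using bound[of A n "\<eta>/4"] A \<eta> by auto
    qed
  qed
  from tendsto_add[OF this lim] show ?thesis by simp
qed

text \<open>A central limit theorem for triangular arrays with i.i.d. rows. The uniform bound \<open>B n\<close> on the
  summands dominates their third absolute moment by \<open>B n\<close> times the second, so each factor of the
  characteristic function is \<open>1 - t\<^sup>2 v/(2n)\<close> up to \<open>o(1/n)\<close>, and its \<open>n\<close>-th power tends to
  \<open>exp(-t\<^sup>2 v/2)\<close>.\<close>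

lemma (in prob_space) char_row_sum_tendsto_normal:
  fixes \<xi> :: "nat \<Rightarrow> nat \<Rightarrow> 'a \<Rightarrow> real"
  assumes indep: "\<And>n. indep_vars (\<lambda>_. borel) (\<xi> n) {1..n}"
    and ident: "\<And>n i. i \<in> {1..n} \<Longrightarrow> distr M borel (\<xi> n i) = distr M borel (\<xi> n 1)"
    and bound: "\<And>n w. w \<in> space M \<Longrightarrow> \<bar>\<xi> n 1 w\<bar> \<le> B n"
    and mean: "\<And>n. expectation (\<xi> n 1) = 0"
    and B: "B \<longlonglongrightarrow> 0"
    and var: "(\<lambda>n. real n * expectation (\<lambda>w. (\<xi> n 1 w)\<^sup>2)) \<longlonglongrightarrow> v" and v: "v \<ge> 0"
  shows "(\<lambda>n. char (distr M borel (\<lambda>w. \<Sum>i=1..n. \<xi> n i w)) t) \<longlonglongrightarrow> complex_of_real (exp (- (t\<^sup>2 * v / 2)))"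
proof -
  \<comment> \<open>The factors are compared with \<open>1 - c/n\<close>, whose powers tend to \<open>exp(-c)\<close>.\<close>
  define c where "c = t\<^sup>2 * v / 2"
  define s where "s n = expectation (\<lambda>w. (\<xi> n 1 w)\<^sup>2)" for n
  define \<phi> where "\<phi> n = char (distr M borel (\<lambda>w. \<Sum>i=1..n. \<xi> n i w)) t" for n
  define \<psi> where "\<psi> n = char (distr M borel (\<xi> n 1)) t" for n
  have c0: "c \<ge> 0" using v by (simp add: c_def)
  have main: "\<forall>\<^sub>F n in sequentially. cmod (\<phi> n - complex_of_real ((1 + (- c) / real n) ^ n))
      \<le> \<bar>t\<bar> ^ 3 / 6 * (B n * (real n * s n)) + \<bar>t\<^sup>2 / 2 * (real n * s n) - c\<bar>"
  proof (rule eventually_sequentiallyI)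
    fix n :: nat assume n: "n \<ge> nat \<lceil>c\<rceil> + 1"
    then have n1: "n \<ge> 1" "real n \<ge> c" by linarith+
    have rv[measurable]: "\<xi> n 1 \<in> borel_measurable M"
      using indep[of n] n1 unfolding indep_vars_def2 by auto
    have i1: "integrable M (\<xi> n 1)"
    proof (rule integrable_const_bound)
      show "AE w in M. norm (\<xi> n 1 w) \<le> B n" using bound[of _ n] by (intro AE_I2) (unfold real_norm_def)
    qed (rule rv)
    have B0: "B n \<ge> 0" using bound[of _ n] not_empty by (meson abs_ge_zero all_not_in_conv order_trans)
    have i2: "integrable M (\<lambda>w. (\<xi> n 1 w)\<^sup>2)"
    proof (rule integrable_const_bound)
      show "AE w in M. norm ((\<xi> n 1 w)\<^sup>2) \<le> (B n)\<^sup>2"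
      proof (rule AE_I2)
        fix w assume "w \<in> space M"
        from power_mono[OF bound[OF this, of n], of 2] show "norm ((\<xi> n 1 w)\<^sup>2) \<le> (B n)\<^sup>2" by simp
      qed
    qed (use rv in measurable)
    have "\<phi> n = (\<Prod>i=1..n. char (distr M borel (\<xi> n i)) t)"
      unfolding \<phi>_def by (rule char_distr_sum[OF indep])
    also have "\<dots> = (\<Prod>i=1..n. \<psi> n)"
      unfolding \<psi>_def by (intro prod.cong refl) (subst ident, auto)
    finally have \<phi>: "\<phi> n = \<psi> n ^ n" by simp
    have "cmod (\<psi> n - (1 - t\<^sup>2 * s n / 2)) \<le> t\<^sup>2 / 6 * expectation (\<lambda>w. min (6 * (\<xi> n 1 w)\<^sup>2) (\<bar>t\<bar> * \<bar>\<xi> n 1 w\<bar> ^ 3))"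
      using i1 i2 mean rv unfolding \<psi>_def by (intro char_approx3') (auto simp: s_def)
    also have "\<dots> \<le> t\<^sup>2 / 6 * expectation (\<lambda>w. \<bar>t\<bar> * B n * (\<xi> n 1 w)\<^sup>2)"
    proof (intro mult_left_mono integral_mono_AE AE_I2)
      have le: "\<bar>t\<bar> * \<bar>\<xi> n 1 w\<bar> ^ 3 \<le> \<bar>t\<bar> * B n * (\<xi> n 1 w)\<^sup>2" if "w \<in> space M" for w
      proof -
        have "\<bar>\<xi> n 1 w\<bar> ^ 3 = \<bar>\<xi> n 1 w\<bar> * (\<xi> n 1 w)\<^sup>2" by (simp add: power3_eq_cube power2_eq_square)
        also have "\<dots> \<le> B n * (\<xi> n 1 w)\<^sup>2" using bound[OF that] by (intro mult_right_mono) auto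
        finally show ?thesis by (simp add: mult_left_mono mult.assoc)
      qed
      show "integrable M (\<lambda>w. min (6 * (\<xi> n 1 w)\<^sup>2) (\<bar>t\<bar> * \<bar>\<xi> n 1 w\<bar> ^ 3))"
      proof (rule Bochner_Integration.integrable_bound[OF integrable_mult_right[OF i2, of 6]])
        show "(\<lambda>w. min (6 * (\<xi> n 1 w)\<^sup>2) (\<bar>t\<bar> * \<bar>\<xi> n 1 w\<bar> ^ 3)) \<in> borel_measurable M"
          using rv by measurable
      qed auto
      show "min (6 * (\<xi> n 1 w)\<^sup>2) (\<bar>t\<bar> * \<bar>\<xi> n 1 w\<bar> ^ 3) \<le> \<bar>t\<bar> * B n * (\<xi> n 1 w)\<^sup>2" if "w \<in> space M" for w
        using le[OF that] by simp
    qed (use i2 in auto)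
    also have "\<dots> = \<bar>t\<bar> ^ 3 / 6 * (B n * s n)"
      by (simp add: s_def power3_eq_cube power2_eq_square)
    finally have 1: "cmod (\<psi> n - (1 - t\<^sup>2 * s n / 2)) \<le> \<bar>t\<bar> ^ 3 / 6 * (B n * s n)" .
    have 2: "cmod (complex_of_real (1 + (- c) / real n)) \<le> 1"
    proof -
      have "0 \<le> c / real n" "c / real n \<le> 1" using n1 c0 by auto
      then have "\<bar>1 + (- c) / real n\<bar> \<le> 1" by simp
      then show ?thesis unfolding norm_of_real .
    qed
    have 3: "cmod (\<psi> n) \<le> 1"
      unfolding \<psi>_def by (intro real_distribution.cmod_char_le_1 real_distribution_distr rv)
    have "cmod (\<phi> n - (complex_of_real (1 + (- c) / real n)) ^ n)
        \<le> real n * cmod (\<psi> n - complex_of_real (1 + (- c) / real n))"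
      unfolding \<phi> by (rule norm_power_diff[OF 3 2])
    also have "cmod (\<psi> n - complex_of_real (1 + (- c) / real n)) \<le>
        cmod (\<psi> n - (1 - t\<^sup>2 * s n / 2)) + cmod (complex_of_real ((1 - t\<^sup>2 * s n / 2) - (1 + (- c) / real n)))"
      using norm_triangle_ineq[of "\<psi> n - (1 - t\<^sup>2 * s n / 2)" "complex_of_real ((1 - t\<^sup>2 * s n / 2) - (1 + (- c) / real n))"]
      by (simp add: algebra_simps)
    also have "cmod (complex_of_real ((1 - t\<^sup>2 * s n / 2) - (1 + (- c) / real n))) = \<bar>t\<^sup>2 / 2 * (real n * s n) - c\<bar> / real n"
    proof -
      have "(1 - t\<^sup>2 * s n / 2) - (1 + (- c) / real n) = - (t\<^sup>2 / 2 * (real n * s n) - c) / real n"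
        using n1 by (simp add: field_simps)
      then show ?thesis by (simp only: norm_of_real abs_divide abs_minus_cancel abs_of_nat)
    qed
    also have "real n * (cmod (\<psi> n - (1 - t\<^sup>2 * s n / 2)) + \<bar>t\<^sup>2 / 2 * (real n * s n) - c\<bar> / real n)
       \<le> real n * (\<bar>t\<bar> ^ 3 / 6 * (B n * s n) + \<bar>t\<^sup>2 / 2 * (real n * s n) - c\<bar> / real n)"
      by (intro mult_left_mono add_right_mono 1) auto
    finally have "cmod (\<phi> n - (complex_of_real (1 + (- c) / real n)) ^ n)
       \<le> real n * (\<bar>t\<bar> ^ 3 / 6 * (B n * s n) + \<bar>t\<^sup>2 / 2 * (real n * s n) - c\<bar> / real n)"
      by (simp add: mult_left_mono)
    then show "cmod (\<phi> n - complex_of_real ((1 + (- c) / real n) ^ n))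
      \<le> \<bar>t\<bar> ^ 3 / 6 * (B n * (real n * s n)) + \<bar>t\<^sup>2 / 2 * (real n * s n) - c\<bar>"
      using n1 by (simp add: algebra_simps)
  qed
  have "(\<lambda>n. \<bar>t\<bar> ^ 3 / 6 * (B n * (real n * s n)) + \<bar>t\<^sup>2 / 2 * (real n * s n) - c\<bar>) \<longlonglongrightarrow>
      \<bar>t\<bar> ^ 3 / 6 * (0 * v) + \<bar>t\<^sup>2 / 2 * v - c\<bar>"
    using var unfolding s_def[symmetric] by (intro tendsto_intros B)
  then have "(\<lambda>n. \<bar>t\<bar> ^ 3 / 6 * (B n * (real n * s n)) + \<bar>t\<^sup>2 / 2 * (real n * s n) - c\<bar>) \<longlonglongrightarrow> 0"
    by (simp add: c_def)
  note null = Lim_null_comparison[OF main this]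
  have "(\<lambda>n. complex_of_real ((1 + (- c) / real n) ^ n)) \<longlonglongrightarrow> complex_of_real (exp (- c))"
    by (rule isCont_tendsto_compose [OF _ tendsto_exp_limit_sequentially]) auto
  then have "\<phi> \<longlonglongrightarrow> complex_of_real (exp (- c))"
    by (rule Lim_transform) (rule null)
  then show ?thesis by (simp add: \<phi>_def[abs_def] c_def)
qed

lemma real_distribution_normal_law:
  assumes "v \<ge> 0" shows "real_distribution (normal_law 0 v)"
  using assms by (auto simp: normal_law_def real_distribution_def real_distribution_axioms_def
     intro!: prob_space_return prob_space_normal_density)

lemma char_normal_law:
  assumes "v \<ge> 0"
  shows "char (normal_law 0 v) t = complex_of_real (exp (- (t\<^sup>2 * v / 2)))"
proof (cases "v = 0")
  case True
  then show ?thesis by (simp add: normal_law_def char_def integral_return)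
next
  case False
  then have s: "sqrt v > 0" using assms by simp
  interpret S: prob_space std_normal_distribution by (rule prob_space_normal_density) simp
  have "distributed std_normal_distribution lborel (\<lambda>x. x) std_normal_density"
    by (auto simp: distributed_def distr_id2)
  from S.normal_density_affine[OF this, of "sqrt v" 0]
  have "distributed std_normal_distribution lborel (\<lambda>x. sqrt v * x) (normal_density 0 (sqrt v))"
    using s by simp
  then have "normal_law 0 v = distr std_normal_distribution lborel (\<lambda>x. sqrt v * x)"
    using False by (simp add: normal_law_def distributed_distr_eq_density)
  also have "\<dots> = distr std_normal_distribution borel (\<lambda>x. sqrt v * x)"
    by (rule distr_cong) auto
  finally have "char (normal_law 0 v) t = char std_normal_distribution (t * sqrt v)"
    by (simp add: char_def integral_distr mult.assoc)
  then show ?thesis using assms by (simp add: char_std_normal_distribution power_mult_distrib)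
qed

section \<open>Second moments of averages\<close>

lemma (in prob_space) second_moment_indep_sum:
  fixes \<zeta> :: "'i \<Rightarrow> 'a \<Rightarrow> real"
  assumes "finite I" "indep_vars (\<lambda>_. borel) \<zeta> I"
    and "\<And>i. i \<in> I \<Longrightarrow> integrable M (\<lambda>w. (\<zeta> i w)\<^sup>2)"
    and "\<And>i. i \<in> I \<Longrightarrow> expectation (\<zeta> i) = 0"
  shows "integrable M (\<lambda>w. (\<Sum>i\<in>I. \<zeta> i w)\<^sup>2) \<and>
    expectation (\<lambda>w. (\<Sum>i\<in>I. \<zeta> i w)\<^sup>2) = (\<Sum>i\<in>I. expectation (\<lambda>w. (\<zeta> i w)\<^sup>2))"
  using assms
proof (induction I rule: finite_induct)
  case empty
  then show ?case by simp
next
  case (insert j I)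
  have rv[measurable]: "\<zeta> i \<in> borel_measurable M" if "i \<in> insert j I" for i
    using insert.prems(1) that unfolding indep_vars_def2 by auto
  have i1: "integrable M (\<zeta> i)" if "i \<in> insert j I" for i
    using rv[OF that] insert.prems(2)[OF that] by (rule square_integrable_imp_integrable)
  have ind: "indep_var borel (\<zeta> j) borel (\<lambda>w. \<Sum>i\<in>I. \<zeta> i w)"
    using insert by (intro indep_vars_sum) auto
  have iS: "integrable M (\<lambda>w. \<Sum>i\<in>I. \<zeta> i w)"
    by (rule Bochner_Integration.integrable_sum) (use i1 in auto)
  have "indep_vars (\<lambda>_. borel) \<zeta> I"
    using insert.prems(1) by (rule indep_vars_subset) auto
  then have IH: "integrable M (\<lambda>w. (\<Sum>i\<in>I. \<zeta> i w)\<^sup>2)"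
    "expectation (\<lambda>w. (\<Sum>i\<in>I. \<zeta> i w)\<^sup>2) = (\<Sum>i\<in>I. expectation (\<lambda>w. (\<zeta> i w)\<^sup>2))"
    using insert by auto
  have ip: "integrable M (\<lambda>w. \<zeta> j w * (\<Sum>i\<in>I. \<zeta> i w))"
    using indep_var_integrable[OF ind] i1 iS by auto
  have ep: "expectation (\<lambda>w. \<zeta> j w * (\<Sum>i\<in>I. \<zeta> i w)) = 0"
    using indep_var_lebesgue_integral[OF ind] i1 iS insert.prems(3) by auto
  have eq: "(\<Sum>i\<in>insert j I. \<zeta> i w)\<^sup>2 = (\<zeta> j w)\<^sup>2 + ((\<Sum>i\<in>I. \<zeta> i w)\<^sup>2 + 2 * (\<zeta> j w * (\<Sum>i\<in>I. \<zeta> i w)))" for w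
    using insert.hyps by (simp add: power2_sum)
  show ?case
    unfolding eq using IH ip ep insert.prems insert.hyps by auto
qed

lemma (in prob_space) iid_transfer:
  assumes iid: "iid M N Z" and h[measurable]: "h \<in> borel_measurable N"
  shows "expectation (\<lambda>w. h (Z i w)) = expectation (\<lambda>w. h (Z 0 w) :: real)"
    and "integrable M (\<lambda>w. h (Z i w)) \<longleftrightarrow> integrable M (\<lambda>w. h (Z 0 w))"
    and "distr M borel (\<lambda>w. h (Z i w)) = distr M borel (\<lambda>w. h (Z 0 w))"
proof -
  have [measurable]: "Z i \<in> measurable M N" for i
    using iid unfolding iid_def indep_vars_def2 by auto
  have d: "distr M N (Z i) = distr M N (Z 0)" using iid unfolding iid_def by blast
  have "expectation (\<lambda>w. h (Z j w)) = (\<integral>z. h z \<partial>distr M N (Z j))" for j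
    by (subst integral_distr) auto
  with d show "expectation (\<lambda>w. h (Z i w)) = expectation (\<lambda>w. h (Z 0 w))" by simp
  have "integrable M (\<lambda>w. h (Z j w)) \<longleftrightarrow> integrable (distr M N (Z j)) h" for j
    by (subst integrable_distr_eq) auto
  with d show "integrable M (\<lambda>w. h (Z i w)) \<longleftrightarrow> integrable M (\<lambda>w. h (Z 0 w))" by simp
  have "distr M borel (\<lambda>w. h (Z j w)) = distr (distr M N (Z j)) borel h" for j
    by (subst distr_distr) (auto simp: comp_def)
  with d show "distr M borel (\<lambda>w. h (Z i w)) = distr M borel (\<lambda>w. h (Z 0 w))" by simp
qed

lemma (in prob_space) iid_indep_compose:
  assumes iid: "iid M N Z" and h: "h \<in> borel_measurable N"
  shows "indep_vars (\<lambda>_. borel) (\<lambda>i w. h (Z i w) :: real) I"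
proof -
  have "indep_vars (\<lambda>_. N) Z UNIV" using iid unfolding iid_def by blast
  then have "indep_vars (\<lambda>_. N) Z I" by (rule indep_vars_subset) simp
  then show ?thesis by (rule indep_vars_compose2) (use h in simp)
qed

text \<open>The variance of an average of \<open>n\<close> i.i.d. terms, estimated by their second moment; all laws of
  large numbers below are instances.\<close>

lemma (in prob_space) iid_average_L2:
  fixes h :: "'z \<Rightarrow> real"
  assumes iid: "iid M N Z" and h[measurable]: "h \<in> borel_measurable N"
    and sq: "integrable M (\<lambda>w. (h (Z 0 w))\<^sup>2)"
  shows "integrable M (\<lambda>w. ((\<Sum>i=1..n. h (Z i w)) / n - expectation (\<lambda>w. h (Z 0 w)))\<^sup>2)"
    and "n \<ge> 1 \<Longrightarrow> expectation (\<lambda>w. ((\<Sum>i=1..n. h (Z i w)) / n - expectation (\<lambda>w. h (Z 0 w)))\<^sup>2)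
      \<le> expectation (\<lambda>w. (h (Z 0 w))\<^sup>2) / n"
proof -
  define e where "e = expectation (\<lambda>w. h (Z 0 w))"
  have [measurable]: "Z i \<in> measurable M N" for i
    using iid unfolding iid_def indep_vars_def2 by auto
  have i1: "integrable M (\<lambda>w. h (Z 0 w))"
    by (rule square_integrable_imp_integrable[OF _ sq]) simp
  have isq: "integrable M (\<lambda>w. (h (Z 0 w) - e)\<^sup>2)"
    unfolding power2_diff using i1 sq by auto
  have ind: "indep_vars (\<lambda>_. borel) (\<lambda>i w. h (Z i w) - e) {1..n}"
    by (rule iid_indep_compose[OF iid, where h = "\<lambda>z. h z - e"]) simp
  have isq': "integrable M (\<lambda>w. (h (Z i w) - e)\<^sup>2)" for i
    using isq iid_transfer(2)[OF iid, where h = "\<lambda>z. (h z - e)\<^sup>2" and i = i] by simp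
  have e0: "expectation (\<lambda>w. h (Z i w) - e) = 0" for i
    using iid_transfer(1)[OF iid, where h = "\<lambda>z. h z - e" and i = i] i1 by (simp add: e_def prob_space)
  have esq: "expectation (\<lambda>w. (h (Z i w) - e)\<^sup>2) = expectation (\<lambda>w. (h (Z 0 w) - e)\<^sup>2)" for i
    by (rule iid_transfer(1)[OF iid, where h = "\<lambda>z. (h z - e)\<^sup>2" and i = i]) simp
  have S: "integrable M (\<lambda>w. (\<Sum>i=1..n. h (Z i w) - e)\<^sup>2)"
    "expectation (\<lambda>w. (\<Sum>i=1..n. h (Z i w) - e)\<^sup>2) = real n * expectation (\<lambda>w. (h (Z 0 w) - e)\<^sup>2)"
    proof -
    have "(\<Sum>i=1..n. expectation (\<lambda>w. (h (Z i w) - e)\<^sup>2)) = (\<Sum>i=1..n. expectation (\<lambda>w. (h (Z 0 w) - e)\<^sup>2))"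
      by (intro sum.cong refl esq)
    then show "integrable M (\<lambda>w. (\<Sum>i=1..n. h (Z i w) - e)\<^sup>2)"
      "expectation (\<lambda>w. (\<Sum>i=1..n. h (Z i w) - e)\<^sup>2) = real n * expectation (\<lambda>w. (h (Z 0 w) - e)\<^sup>2)"
      using second_moment_indep_sum[OF _ ind] isq' e0 by auto
  qed
  have le: "expectation (\<lambda>w. (h (Z 0 w) - e)\<^sup>2) \<le> expectation (\<lambda>w. (h (Z 0 w))\<^sup>2)"
    using variance_eq[OF i1 sq] by (simp add: e_def)
  have eq: "((\<Sum>i=1..n. h (Z i w)) / n - e)\<^sup>2 = (\<Sum>i=1..n. h (Z i w) - e)\<^sup>2 / (real n)\<^sup>2" if "n \<ge> 1" for w
  proof -
    have "(\<Sum>i=1..n. h (Z i w)) / n - e = (\<Sum>i=1..n. h (Z i w) - e) / real n"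
      using that by (simp add: sum_subtractf field_simps)
    then show ?thesis by (simp add: power_divide)
  qed
  show "integrable M (\<lambda>w. ((\<Sum>i=1..n. h (Z i w)) / n - expectation (\<lambda>w. h (Z 0 w)))\<^sup>2)"
    unfolding e_def[symmetric]
  proof (cases "n \<ge> 1")
    case True
    show "integrable M (\<lambda>w. ((\<Sum>i=1..n. h (Z i w)) / n - e)\<^sup>2)"
      unfolding eq[OF True] using S by simp
  qed (simp add: not_le)
  assume n: "n \<ge> 1"
  show "expectation (\<lambda>w. ((\<Sum>i=1..n. h (Z i w)) / n - expectation (\<lambda>w. h (Z 0 w)))\<^sup>2)
      \<le> expectation (\<lambda>w. (h (Z 0 w))\<^sup>2) / n"
    unfolding e_def[symmetric] eq[OF n] using n S le by (simp add: power2_eq_square divide_right_mono)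
qed

section \<open>Increments of twice differentiable functions\<close>

text \<open>Moving from \<open>x\<close> to \<open>x + h\<close> one coordinate at a time and applying the mean value theorem on every
  leg. With \<open>c = 0\<close> this is a Lipschitz bound, with \<open>c\<close> the gradient at \<open>x\<close> it is a first-order Taylor
  formula. The argument takes partial derivatives as they are, without passing to a total derivative.\<close>

lemma partial_increments_bound:
  fixes F :: "'a::euclidean_space \<Rightarrow> real"
  assumes der: "\<And>b y. b \<in> Basis \<Longrightarrow> y \<in> ball x r \<Longrightarrow>
      ((\<lambda>t. F (y + t *\<^sub>R b)) has_real_derivative P b y) (at 0)"
    and close: "\<And>b y. b \<in> Basis \<Longrightarrow> norm (y - x) \<le> norm h \<Longrightarrow> \<bar>P b y - c b\<bar> \<le> \<kappa>"
    and h: "norm h < r"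
  shows "\<bar>F (x + h) - F x - (\<Sum>b\<in>Basis. (h \<bullet> b) * c b)\<bar> \<le> \<kappa> * (\<Sum>b\<in>Basis. \<bar>h \<bullet> b\<bar>)"
proof -
  define p where "p B = (\<Sum>b\<in>B. (h \<bullet> b) *\<^sub>R b)" for B
  have pb: "norm (p B + t *\<^sub>R b) \<le> norm h"
    if "B \<subseteq> Basis" "b \<in> Basis" "b \<notin> B" "\<bar>t\<bar> \<le> \<bar>h \<bullet> b\<bar>" for B b t
  proof (rule norm_le_componentwise)
    fix i :: 'a assume i: "i \<in> Basis"
    have fB: "finite B" using that finite_subset finite_Basis by blast
    have "p B \<bullet> i = (\<Sum>b\<in>B. (h \<bullet> b) * (if b = i then 1 else 0))"
      unfolding p_def inner_sum_left using that i by (intro sum.cong) (auto simp: inner_Basis subset_iff)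
    also have "\<dots> = (if i \<in> B then h \<bullet> i else 0)"
      using fB by (simp add: sum.delta' if_distrib[of "\<lambda>x. _ * x"] cong: if_cong)
    finally show "\<bar>(p B + t *\<^sub>R b) \<bullet> i\<bar> \<le> \<bar>h \<bullet> i\<bar>"
      using that i by (auto simp: inner_add_left inner_Basis)
  qed
  have "\<bar>F (x + p B) - F x - (\<Sum>b\<in>B. (h \<bullet> b) * c b)\<bar> \<le> \<kappa> * (\<Sum>b\<in>B. \<bar>h \<bullet> b\<bar>)" if "B \<subseteq> Basis" for B
    using finite_subset[OF that finite_Basis] that
  proof (induction B rule: finite_induct)
    case empty
    then show ?case by (simp add: p_def)
  next
    case (insert b B)
    then have B: "B \<subseteq> Basis" "b \<in> Basis" "b \<notin> B" by auto
    let ?y = "\<lambda>t. x + p B + t *\<^sub>R b"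
    have inball: "?y t \<in> ball x r" "norm (?y t - x) \<le> norm h" if "\<bar>t\<bar> \<le> \<bar>h \<bullet> b\<bar>" for t
    proof -
      have "?y t - x = p B + t *\<^sub>R b" by simp
      then show "norm (?y t - x) \<le> norm h" using pb[OF B that] by simp
      then have "norm (x - ?y t) < r" using h by (subst norm_minus_commute) linarith
      then show "?y t \<in> ball x r" by (simp add: dist_norm)
    qed
    have d: "((\<lambda>t. F (?y t) - t * c b) has_real_derivative P b (?y t) - c b) (at t)" if "\<bar>t\<bar> \<le> \<bar>h \<bullet> b\<bar>" for t
    proof -
      have "((\<lambda>s. F (?y t + s *\<^sub>R b)) has_real_derivative P b (?y t)) (at 0)"
        using der[OF B(2) inball(1)[OF that]] .
      then have "((\<lambda>s. F (?y s)) has_real_derivative P b (?y t)) (at t)"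
        using DERIV_at_within_shift[of "\<lambda>s. F (?y s)" "P b (?y t)" t 0 UNIV]
        by (simp add: algebra_simps)
      then show ?thesis by (auto intro!: derivative_eq_intros)
    qed
    have "\<bar>(F (?y (h \<bullet> b)) - (h \<bullet> b) * c b) - (F (?y 0) - 0 * c b)\<bar> \<le> \<kappa> * \<bar>h \<bullet> b - 0\<bar>"
      unfolding real_norm_def[symmetric]
    proof (rule field_differentiable_bound[where S = "{-\<bar>h \<bullet> b\<bar>..\<bar>h \<bullet> b\<bar>}"])
      fix z assume z: "z \<in> {-\<bar>h \<bullet> b\<bar>..\<bar>h \<bullet> b\<bar>}"
      then have z': "\<bar>z\<bar> \<le> \<bar>h \<bullet> b\<bar>" by auto
      show "((\<lambda>t. F (?y t) - t * c b) has_field_derivative P b (?y z) - c b) (at z within {-\<bar>h \<bullet> b\<bar>..\<bar>h \<bullet> b\<bar>})"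
        using d[OF z'] by (rule has_field_derivative_at_within)
      show "norm (P b (?y z) - c b) \<le> \<kappa>"
        using close[OF B(2) inball(2)[OF z']] by simp
    qed auto
    moreover have "p (insert b B) = (h \<bullet> b) *\<^sub>R b + p B" using insert by (simp add: p_def)
    ultimately show ?case using insert by (simp add: algebra_simps)
  qed
  from this[of Basis] show ?thesis by (simp add: p_def euclidean_representation)
qed

text \<open>Symmetric kernels only see the symmetric second difference of a smooth function, so these two
  bounds replace a full Taylor expansion. The second one follows from a first-order Taylor formula whose
  error is quadratic because the gradient is itself Lipschitz at \<open>x\<close>.\<close>

lemma C2_on_interior_bounds:
  fixes F :: "'a::euclidean_space \<Rightarrow> real"
  assumes "C2_on S F" "x \<in> interior S"
  obtains r C where "r > 0" "C > 0" "ball x r \<subseteq> S"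
    "\<And>h. norm h < r \<Longrightarrow> \<bar>F (x + h) - F x\<bar> \<le> C * norm h"
    "\<And>h. norm h < r \<Longrightarrow> \<bar>F (x + h) + F (x - h) - 2 * F x\<bar> \<le> C * (norm h)\<^sup>2"
proof -
  obtain P Q where PQ: "has_C2_partials S F P Q" using assms(1) unfolding C2_on_def by blast
  obtain r0 where r0: "r0 > 0" "cball x r0 \<subseteq> S"
    using assms(2) mem_interior_cball by blast
  have at0: "(G has_real_derivative D) (at 0)"
    if "(G has_real_derivative D) (at 0 within {t. y + t *\<^sub>R b \<in> S})" "y \<in> ball x r0"
    for G :: "real \<Rightarrow> real" and D y b
  proof -
    have "open ((\<lambda>t::real. y + t *\<^sub>R b) -` ball x r0)"
      by (intro open_vimage continuous_intros) auto
    moreover have "0 \<in> (\<lambda>t::real. y + t *\<^sub>R b) -` ball x r0" using that by simp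
    moreover have "(\<lambda>t::real. y + t *\<^sub>R b) -` ball x r0 \<subseteq> {t. y + t *\<^sub>R b \<in> S}"
      using r0(2) ball_subset_cball[of x r0] by blast
    ultimately have "0 \<in> interior {t. y + t *\<^sub>R b \<in> S}"
      by (meson interior_maximal subsetD)
    then have "at 0 within {t. y + t *\<^sub>R b \<in> S} = at 0" by (rule at_within_interior)
    with that(1) show ?thesis by metis
  qed
  have sub: "ball x r0 \<subseteq> S" using r0 by auto
  have FS: "((\<lambda>t. F (y + t *\<^sub>R b)) has_real_derivative P b y) (at 0 within {t. y + t *\<^sub>R b \<in> S})"
    if "b \<in> Basis" "y \<in> S" for b y using PQ that unfolding has_C2_partials_def by blast
  have PS: "((\<lambda>t. P b (y + t *\<^sub>R c)) has_real_derivative Q b c y) (at 0 within {t. y + t *\<^sub>R c \<in> S})"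
    if "b \<in> Basis" "c \<in> Basis" "y \<in> S" for b c y using PQ that unfolding has_C2_partials_def by blast
  have dF: "((\<lambda>t. F (y + t *\<^sub>R b)) has_real_derivative P b y) (at 0)" if "b \<in> Basis" "y \<in> ball x r0" for b y
    using at0[OF FS, of b y] that sub by blast
  have dP: "((\<lambda>t. P b (y + t *\<^sub>R c)) has_real_derivative Q b c y) (at 0)"
    if "b \<in> Basis" "c \<in> Basis" "y \<in> ball x r0" for b c y
    using at0[OF PS, of b c y] that sub by blast
  have bdd: "\<exists>K. \<forall>y\<in>cball x r0. \<bar>G y\<bar> \<le> K" if "continuous_on S G" for G :: "'a \<Rightarrow> real"
  proof -
    have "compact (G ` cball x r0)"
      using r0 that by (intro compact_continuous_image continuous_on_subset[OF that]) auto
    then have "bounded (G ` cball x r0)" by (rule compact_imp_bounded)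
    then show ?thesis unfolding bounded_iff by auto
  qed
  have "\<forall>b\<in>Basis. \<exists>K. \<forall>y\<in>cball x r0. \<bar>P b y\<bar> \<le> K"
    using PQ unfolding has_C2_partials_def by (auto intro!: bdd)
  then obtain KP where KP: "\<And>b y. b \<in> Basis \<Longrightarrow> y \<in> cball x r0 \<Longrightarrow> \<bar>P b y\<bar> \<le> KP b" by metis
  have "\<forall>b\<in>Basis. \<forall>c\<in>Basis. \<exists>K. \<forall>y\<in>cball x r0. \<bar>Q b c y\<bar> \<le> K"
    using PQ unfolding has_C2_partials_def by (auto intro!: bdd)
  then obtain KQ where KQ: "\<And>b c y. b \<in> Basis \<Longrightarrow> c \<in> Basis \<Longrightarrow> y \<in> cball x r0 \<Longrightarrow> \<bar>Q b c y\<bar> \<le> KQ b c" by metis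
  define K1 where "K1 = (\<Sum>b\<in>Basis. \<bar>KP b\<bar>)"
  define K2 where "K2 = (\<Sum>b\<in>Basis. \<Sum>c\<in>Basis. \<bar>KQ b c\<bar>)"
  have K0: "K1 \<ge> 0" "K2 \<ge> 0" by (auto simp: K1_def K2_def intro!: sum_nonneg)
  have K1: "\<bar>P b y\<bar> \<le> K1" if "b \<in> Basis" "y \<in> cball x r0" for b y
  proof -
    have "\<bar>KP b\<bar> \<le> K1" unfolding K1_def using that by (intro member_le_sum) auto
    with KP[OF that] show ?thesis by linarith
  qed
  have K2: "\<bar>Q b c y\<bar> \<le> K2" if "b \<in> Basis" "c \<in> Basis" "y \<in> cball x r0" for b c y
  proof -
    have "\<bar>KQ b c\<bar> \<le> (\<Sum>c\<in>Basis. \<bar>KQ b c\<bar>)" using that by (intro member_le_sum) auto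
    also have "\<dots> \<le> K2" unfolding K2_def using that
      by (intro member_le_sum[where f = "\<lambda>b. \<Sum>c\<in>Basis. \<bar>KQ b c\<bar>"]) (auto intro!: sum_nonneg)
    finally show ?thesis using KQ[OF that] by linarith
  qed
  define D where "D = real DIM('a)"
  have l1: "(\<Sum>b\<in>Basis. \<bar>h \<bullet> b\<bar>) \<le> D * norm h" for h :: 'a
    using sum_bounded_above[of Basis "\<lambda>b. \<bar>h \<bullet> b\<bar>" "norm h"] Basis_le_norm by (auto simp: D_def)
  have D0: "D \<ge> 0" by (simp add: D_def)
  have lip: "\<bar>F (x + h) - F x\<bar> \<le> K1 * (D * norm h)" if "norm h < r0" for h
  proof -
    have "\<bar>F (x + h) - F x - (\<Sum>b\<in>Basis. (h \<bullet> b) * 0)\<bar> \<le> K1 * (\<Sum>b\<in>Basis. \<bar>h \<bullet> b\<bar>)"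
      using dF K1 that by (intro partial_increments_bound[where P = P and r = r0])
        (auto simp: dist_norm norm_minus_commute)
    also have "\<dots> \<le> K1 * (D * norm h)" using K0 l1 by (intro mult_left_mono) auto
    finally show ?thesis by simp
  qed
  have lipP: "\<bar>P b (x + h) - P b x\<bar> \<le> K2 * (D * norm h)" if "norm h < r0" "b \<in> Basis" for h b
  proof -
    have "\<bar>P b (x + h) - P b x - (\<Sum>c\<in>Basis. (h \<bullet> c) * 0)\<bar> \<le> K2 * (\<Sum>b\<in>Basis. \<bar>h \<bullet> b\<bar>)"
      using dP K2 that by (intro partial_increments_bound[where P = "Q b" and r = r0])
        (auto simp: dist_norm norm_minus_commute)
    also have "\<dots> \<le> K2 * (D * norm h)" using K0 l1 by (intro mult_left_mono) auto
    finally show ?thesis by simp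
  qed
  have quad: "\<bar>F (x + h) - F x - (\<Sum>b\<in>Basis. (h \<bullet> b) * P b x)\<bar> \<le> K2 * D\<^sup>2 * (norm h)\<^sup>2" if h: "norm h < r0" for h
  proof -
    have "\<bar>F (x + h) - F x - (\<Sum>b\<in>Basis. (h \<bullet> b) * P b x)\<bar> \<le> (K2 * (D * norm h)) * (\<Sum>b\<in>Basis. \<bar>h \<bullet> b\<bar>)"
    proof (rule partial_increments_bound[where P = P and r = r0])
      fix b y :: 'a assume b: "b \<in> Basis" "norm (y - x) \<le> norm h"
      then have "\<bar>P b (x + (y - x)) - P b x\<bar> \<le> K2 * (D * norm (y - x))"
        using h by (intro lipP) auto
      also have "\<dots> \<le> K2 * (D * norm h)" using K0 D0 b by (intro mult_left_mono) auto
      finally show "\<bar>P b y - P b x\<bar> \<le> K2 * (D * norm h)" by simp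
    qed (use dF h in auto)
    also have "\<dots> \<le> (K2 * (D * norm h)) * (D * norm h)" using K0 D0 l1 by (intro mult_left_mono) auto
    finally show ?thesis by (simp add: power2_eq_square algebra_simps)
  qed
  define C where "C = K1 * D + 2 * (K2 * D\<^sup>2) + 1"
  show ?thesis
  proof (rule that[of r0 C])
    show "r0 > 0" by fact
    show "C > 0" using K0 D0 by (simp add: C_def add_nonneg_pos)
    show "ball x r0 \<subseteq> S" by fact
    fix h :: 'a assume h: "norm h < r0"
    have "K1 * (D * norm h) \<le> C * norm h"
      using K0 D0 by (simp add: C_def algebra_simps)
    with lip[OF h] show "\<bar>F (x + h) - F x\<bar> \<le> C * norm h" by linarith
    have "2 * (K2 * D\<^sup>2 * (norm h)\<^sup>2) \<le> C * (norm h)\<^sup>2"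
      using K0 D0 by (simp add: C_def algebra_simps)
    moreover have "\<bar>F (x - h) - F x + (\<Sum>b\<in>Basis. (h \<bullet> b) * P b x)\<bar> \<le> K2 * D\<^sup>2 * (norm h)\<^sup>2"
      using quad[of "-h"] h by (simp add: sum_negf)
    ultimately show "\<bar>F (x + h) + F (x - h) - 2 * F x\<bar> \<le> C * (norm h)\<^sup>2"
      using quad[OF h] by linarith
  qed
qed

text \<open>Measuring \<open>f''\<close> against an arbitrary constant \<open>c\<close> serves two purposes: \<open>c = 0\<close> gives a quadratic
  bound, and \<open>c\<close> equal to the second derivative at a nearby fixed point gives an error \<open>o(s\<^sup>2)\<close>
  that is uniform in the base point \<open>e\<close>.\<close>

lemma taylor2_bound:
  fixes f :: "real \<Rightarrow> real"
  assumes f: "Ck 2 f" and \<eta>: "\<And>u. \<bar>u - e\<bar> \<le> \<bar>s\<bar> \<Longrightarrow> \<bar>(deriv ^^ 2) f u - c\<bar> \<le> \<eta>"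
  shows "\<bar>f (e + s) - f e - s * deriv f e - s\<^sup>2 / 2 * c\<bar> \<le> \<eta> * s\<^sup>2"
proof -
  have f1: "(f has_real_derivative deriv f u) (at u)" for u
    using f unfolding Ck_def by (auto simp: DERIV_deriv_iff_field_differentiable dest: spec[of _ 0])
  have f2: "(deriv f has_real_derivative (deriv ^^ 2) f u) (at u)" for u
    using f unfolding Ck_def by (auto simp: DERIV_deriv_iff_field_differentiable numeral_2_eq_2 dest: spec[of _ 1])
  have \<eta>0: "\<eta> \<ge> 0" using \<eta>[of e] by simp
  have b1: "\<bar>deriv f (e + t) - deriv f e - t * c\<bar> \<le> \<eta> * \<bar>t\<bar>" if t: "\<bar>t\<bar> \<le> \<bar>s\<bar>" for t
  proof -
    have "\<bar>(deriv f (e + t) - t * c) - (deriv f (e + 0) - 0 * c)\<bar> \<le> \<eta> * \<bar>t - 0\<bar>"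
      unfolding real_norm_def[symmetric]
    proof (rule field_differentiable_bound[where S = "{-\<bar>t\<bar>..\<bar>t\<bar>}"])
      fix z assume z: "z \<in> {-\<bar>t\<bar>..\<bar>t\<bar>}"
      have "((\<lambda>t. deriv f (e + t)) has_real_derivative (deriv ^^ 2) f (e + z)) (at z)"
        using f2[of "z + e"] DERIV_shift[of "deriv f" _ z e] by (simp add: add.commute)
      then show "((\<lambda>t. deriv f (e + t) - t * c) has_field_derivative (deriv ^^ 2) f (e + z) - c) (at z within {-\<bar>t\<bar>..\<bar>t\<bar>})"
        by - (rule has_field_derivative_at_within, auto intro!: derivative_eq_intros)
      show "norm ((deriv ^^ 2) f (e + z) - c) \<le> \<eta>" using \<eta>[of "e + z"] z t by auto
    qed auto
    then show ?thesis by (simp add: algebra_simps)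
  qed
  have "\<bar>(f (e + s) - s * deriv f e - s\<^sup>2 / 2 * c) - (f (e + 0) - 0 * deriv f e - 0\<^sup>2 / 2 * c)\<bar> \<le> (\<eta> * \<bar>s\<bar>) * \<bar>s - 0\<bar>"
    unfolding real_norm_def[symmetric]
  proof (rule field_differentiable_bound[where S = "{-\<bar>s\<bar>..\<bar>s\<bar>}"])
    fix z assume z: "z \<in> {-\<bar>s\<bar>..\<bar>s\<bar>}"
    then have z': "\<bar>z\<bar> \<le> \<bar>s\<bar>" by auto
    have "((\<lambda>t. f (e + t)) has_real_derivative deriv f (e + z)) (at z)"
      using f1[of "z + e"] DERIV_shift[of f _ z e] by (simp add: add.commute)
    then show "((\<lambda>t. f (e + t) - t * deriv f e - t\<^sup>2 / 2 * c) has_field_derivative deriv f (e + z) - deriv f e - z * c) (at z within {-\<bar>s\<bar>..\<bar>s\<bar>})"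
      by - (rule has_field_derivative_at_within, auto intro!: derivative_eq_intros)
    have "\<eta> * \<bar>z\<bar> \<le> \<eta> * \<bar>s\<bar>" using z' \<eta>0 by (intro mult_left_mono) auto
    then show "norm (deriv f (e + z) - deriv f e - z * c) \<le> \<eta> * norm s" using b1[OF z'] by simp
  qed auto
  also have "(\<eta> * \<bar>s\<bar>) * \<bar>s - 0\<bar> = \<eta> * s\<^sup>2" by (simp add: power2_eq_square flip: abs_mult)
  finally show ?thesis by (simp add: algebra_simps)
qed

section \<open>Integrals against shrinking kernels\<close>

text \<open>The functions against which densities are integrated: kernels, their absolute values, squares and
  moments all belong to this class.\<close>

definition ball_kernel :: "real \<Rightarrow> ('a::euclidean_space \<Rightarrow> real) \<Rightarrow> bool" where
  "ball_kernel R K \<longleftrightarrow> K \<in> borel_measurable borel \<and> bounded (range K) \<and> (\<forall>z. norm z > R \<longrightarrow> K z = 0)"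

lemma ball_kernel_integrable:
  assumes "ball_kernel R K" shows "integrable lborel K"
proof -
  have [measurable]: "K \<in> borel_measurable borel" using assms by (simp add: ball_kernel_def)
  obtain B where B: "\<And>z. \<bar>K z\<bar> \<le> B" using assms by (auto simp: ball_kernel_def bounded_iff)
  have "integrable lborel (\<lambda>z. B * indicator (cball 0 R :: 'a set) z)"
    by (intro integrable_mult_right integrable_real_indicator) (use emeasure_lborel_cball_finite[of "0 :: 'a" R] in auto)
  then show ?thesis
    by (rule Bochner_Integration.integrable_bound)
      (use assms B in \<open>auto simp: ball_kernel_def indicator_def intro: order_trans[OF B abs_ge_self]\<close>)
qed

lemma ball_kernel_mult:
  assumes "ball_kernel R K" "ball_kernel R L" shows "ball_kernel R (\<lambda>z. K z * L z)"
proof -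
  obtain B where B: "\<And>z. \<bar>K z\<bar> \<le> B" using assms by (auto simp: ball_kernel_def bounded_iff)
  obtain C where C: "\<And>z. \<bar>L z\<bar> \<le> C" using assms by (auto simp: ball_kernel_def bounded_iff)
  have "\<bar>K z * L z\<bar> \<le> B * C" for z
    unfolding abs_mult using B[of z] C[of z] by (intro mult_mono) auto
  then show ?thesis using assms by (auto simp: ball_kernel_def bounded_iff)
qed

lemma ball_kernel_abs: "ball_kernel R K \<Longrightarrow> ball_kernel R (\<lambda>z. \<bar>K z\<bar>)"
  by (auto simp: ball_kernel_def bounded_iff)

lemma ball_kernel_power2: "ball_kernel R K \<Longrightarrow> ball_kernel R (\<lambda>z. (K z)\<^sup>2)"
  unfolding power2_eq_square by (rule ball_kernel_mult)

lemma ball_kernel_integral_near_const: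
  assumes K: "ball_kernel R K" and [measurable]: "q \<in> borel_measurable borel"
    and q: "\<And>z. norm z \<le> R \<Longrightarrow> \<bar>q z - c\<bar> \<le> e"
  shows "integrable lborel (\<lambda>z. K z * q z)"
    and "\<bar>(\<integral>z. K z * q z \<partial>lborel) - c * (\<integral>z. K z \<partial>lborel)\<bar> \<le> e * (\<integral>z. \<bar>K z\<bar> \<partial>lborel)"
proof -
  note [simp] = ball_kernel_integrable[OF K]
  have [measurable]: "K \<in> borel_measurable borel" using K by (simp add: ball_kernel_def)
  have le: "\<bar>K z * (q z - c)\<bar> \<le> e * \<bar>K z\<bar>" for z
  proof (cases "norm z \<le> R")
    case True
    then show ?thesis unfolding abs_mult using q by (subst mult.commute) (intro mult_right_mono; simp)
  next
    case False
    then show ?thesis using K by (simp add: ball_kernel_def)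
  qed
  have i: "integrable lborel (\<lambda>z. K z * (q z - c))"
  proof (rule Bochner_Integration.integrable_bound)
    show "integrable lborel (\<lambda>z. e * \<bar>K z\<bar>)" by simp
    show "AE z in lborel. norm (K z * (q z - c)) \<le> norm (e * \<bar>K z\<bar>)"
      using le by (auto intro: order_trans[OF le abs_ge_self])
  qed simp
  have eq: "K z * q z = K z * (q z - c) + c * K z" for z by (simp add: algebra_simps)
  show "integrable lborel (\<lambda>z. K z * q z)" unfolding eq using i by simp
  have "(\<integral>z. K z * q z \<partial>lborel) - c * (\<integral>z. K z \<partial>lborel) = (\<integral>z. K z * (q z - c) \<partial>lborel)"
    unfolding eq using i by simp
  also have "\<bar>\<dots>\<bar> \<le> (\<integral>z. \<bar>K z * (q z - c)\<bar> \<partial>lborel)" by (rule integral_abs_bound)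
  also have "\<dots> \<le> (\<integral>z. e * \<bar>K z\<bar> \<partial>lborel)" using i le by (intro integral_mono) auto
  finally show "\<bar>(\<integral>z. K z * q z \<partial>lborel) - c * (\<integral>z. K z \<partial>lborel)\<bar> \<le> e * (\<integral>z. \<bar>K z\<bar> \<partial>lborel)"
    by simp
qed

lemma ball_kernel_integral_tendsto:
  assumes K: "ball_kernel R K" and q: "\<And>n. q n \<in> borel_measurable borel"
    and lim: "uniform_limit (cball 0 R) q (\<lambda>_. c) sequentially"
  shows "(\<lambda>n. \<integral>z. K z * q n z \<partial>lborel) \<longlonglongrightarrow> c * (\<integral>z. K z \<partial>lborel)"
proof (rule tendstoI)
  fix e :: real assume e: "e > 0"
  define I where "I = (\<integral>z. \<bar>K z\<bar> \<partial>lborel)"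
  have I: "I \<ge> 0" by (simp add: I_def)
  have "e / (2 * (I + 1)) > 0" using e I by simp
  then have "\<forall>\<^sub>F n in sequentially. \<forall>z\<in>cball 0 R. dist (q n z) c < e / (2 * (I + 1))"
    using lim unfolding uniform_limit_iff by blast
  then show "\<forall>\<^sub>F n in sequentially. dist (\<integral>z. K z * q n z \<partial>lborel) (c * (\<integral>z. K z \<partial>lborel)) < e"
  proof eventually_elim
    case (elim n)
    have "\<bar>(\<integral>z. K z * q n z \<partial>lborel) - c * (\<integral>z. K z \<partial>lborel)\<bar> \<le> e / (2 * (I + 1)) * I"
      unfolding I_def[symmetric] using elim
      by (intro ball_kernel_integral_near_const(2)[OF K q, folded I_def]) (auto simp: dist_real_def intro: less_imp_le)
    also have "\<dots> \<le> e / (2 * (I + 1)) * (I + 1)" using e I by (intro mult_left_mono) auto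
    also have "\<dots> = e / 2" using I by (simp add: field_simps)
    finally show ?case using e by (simp add: dist_real_def)
  qed
qed

lemma uniform_limit_shrinking_argument:
  fixes g :: "'a::real_normed_vector \<Rightarrow> real"
  assumes g: "isCont g x" and h: "h \<longlonglongrightarrow> 0"
  shows "uniform_limit (cball 0 R) (\<lambda>n z. g (x + h n *\<^sub>R z)) (\<lambda>_. g x) sequentially"
  unfolding uniform_limit_iff
proof (intro allI impI)
  fix e :: real assume "e > 0"
  then obtain \<delta> where \<delta>: "\<delta> > 0" "\<And>u. dist u x < \<delta> \<Longrightarrow> dist (g u) (g x) < e"
    using g unfolding continuous_at_eps_delta by blast
  have "\<forall>\<^sub>F n in sequentially. \<bar>h n\<bar> < \<delta> / (\<bar>R\<bar> + 1)"
    using h \<delta> by (auto simp: tendsto_iff dist_real_def)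
  then show "\<forall>\<^sub>F n in sequentially. \<forall>z\<in>cball 0 R. dist (g (x + h n *\<^sub>R z)) (g x) < e"
  proof eventually_elim
    case (elim n)
    have "dist (x + h n *\<^sub>R z) x < \<delta>" if "z \<in> cball 0 R" for z
    proof -
      have "norm (h n *\<^sub>R z) \<le> \<bar>h n\<bar> * (\<bar>R\<bar> + 1)"
        using that by (auto intro!: mult_left_mono)
      also have "\<dots> < \<delta>" using elim by (simp add: field_simps)
      finally show ?thesis by (simp add: dist_norm)
    qed
    then show ?case using \<delta>(2) by blast
  qed
qed

lemma integral_lborel_affine:
  fixes F :: "'a::euclidean_space \<Rightarrow> real"
  assumes [measurable]: "F \<in> borel_measurable borel" and "c > 0"
  shows "(\<integral>u. F u \<partial>lborel) = c ^ DIM('a) * (\<integral>z. F (x + c *\<^sub>R z) \<partial>lborel)"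
proof -
  have "(\<integral>u. F u \<partial>lborel) = (\<integral>u. F u \<partial>density (distr lborel borel (\<lambda>z. x + c *\<^sub>R z)) (\<lambda>_. \<bar>c\<bar>^DIM('a)))"
    using lborel_affine[of c x] assms by simp
  also have "\<dots> = (\<integral>u. c ^ DIM('a) * F u \<partial>distr lborel borel (\<lambda>z. x + c *\<^sub>R z))"
    using assms by (subst integral_density) (auto)
  also have "\<dots> = (\<integral>z. c ^ DIM('a) * F (x + c *\<^sub>R z) \<partial>lborel)"
    by (subst integral_distr) auto
  finally show ?thesis by simp
qed

text \<open>Reflecting \<open>z\<close> averages \<open>H\<close> over \<open>x + h z\<close> and \<open>x - h z\<close>, which cancels the first-order term.\<close>

lemma symmetric_kernel_integral_bound:
  fixes K :: "'a::euclidean_space \<Rightarrow> real"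
  assumes K: "ball_kernel R K" "\<And>z. K (- z) = K z" and [measurable]: "H \<in> borel_measurable borel"
    and C: "C \<ge> 0" "\<And>w. norm w < r \<Longrightarrow> \<bar>H (x + w)\<bar> \<le> C"
       "\<And>w. norm w < r \<Longrightarrow> \<bar>H (x + w) + H (x - w)\<bar> \<le> C * (norm w)\<^sup>2"
    and h: "h > 0" "h * R < r"
  shows "\<bar>\<integral>z. K z * H (x + h *\<^sub>R z) \<partial>lborel\<bar> \<le> C * R\<^sup>2 * (\<integral>z. \<bar>K z\<bar> \<partial>lborel) * h\<^sup>2"
proof -
  have [measurable]: "K \<in> borel_measurable borel" using K by (simp add: ball_kernel_def)
  have hz: "norm (h *\<^sub>R z) < r" "norm (h *\<^sub>R z) \<le> h * R" if "norm z \<le> R" for z :: 'a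
    using h mult_left_mono[OF that, of h] by (simp_all, linarith)
  have i1: "integrable lborel (\<lambda>z. K z * H (x + h *\<^sub>R z))"
    using C hz by (intro ball_kernel_integral_near_const(1)[OF K(1), where c = 0 and e = C]) auto
  have i2: "integrable lborel (\<lambda>z. K z * H (x - h *\<^sub>R z))"
    using C(2)[of "- (h *\<^sub>R z)" for z] hz
    by (intro ball_kernel_integral_near_const(1)[OF K(1), where c = 0 and e = C]) auto
  have refl: "(\<integral>z. K z * H (x - h *\<^sub>R z) \<partial>lborel) = (\<integral>z. K z * H (x + h *\<^sub>R z) \<partial>lborel)"
  proof -
    have "(lborel :: 'a measure) = density (distr lborel borel (\<lambda>z. 0 + (-1) *\<^sub>R z)) (\<lambda>_. 1)"
      using lborel_affine[of "-1" "0 :: 'a"] by simp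
    then have d: "distr lborel borel uminus = (lborel :: 'a measure)" by (simp add: density_1 uminus_add_conv_diff)
    have "(\<integral>z. K z * H (x + h *\<^sub>R z) \<partial>lborel) = (\<integral>z. K z * H (x + h *\<^sub>R z) \<partial>distr lborel borel uminus)"
      unfolding d ..
    also have "\<dots> = (\<integral>z. K z * H (x - h *\<^sub>R z) \<partial>lborel)"
      by (subst integral_distr) (auto simp: K(2))
    finally show ?thesis ..
  qed
  have "2 * (\<integral>z. K z * H (x + h *\<^sub>R z) \<partial>lborel) = (\<integral>z. K z * (H (x + h *\<^sub>R z) + H (x - h *\<^sub>R z)) \<partial>lborel)"
    unfolding distrib_left using i1 i2 refl by simp
  also have "\<bar>\<dots>\<bar> \<le> (\<integral>z. \<bar>K z * (H (x + h *\<^sub>R z) + H (x - h *\<^sub>R z))\<bar> \<partial>lborel)"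
    by (rule integral_abs_bound)
  also have "\<dots> \<le> (\<integral>z. C * R\<^sup>2 * h\<^sup>2 * \<bar>K z\<bar> \<partial>lborel)"
  proof (rule integral_mono)
    show "integrable lborel (\<lambda>z. \<bar>K z * (H (x + h *\<^sub>R z) + H (x - h *\<^sub>R z))\<bar>)"
      unfolding distrib_left using i1 i2 by simp
    show "integrable lborel (\<lambda>z. C * R\<^sup>2 * h\<^sup>2 * \<bar>K z\<bar>)"
      using ball_kernel_integrable[OF K(1)] by simp
    fix z show "\<bar>K z * (H (x + h *\<^sub>R z) + H (x - h *\<^sub>R z))\<bar> \<le> C * R\<^sup>2 * h\<^sup>2 * \<bar>K z\<bar>"
    proof (cases "norm z \<le> R")
      case True
      have "\<bar>H (x + h *\<^sub>R z) + H (x - h *\<^sub>R z)\<bar> \<le> C * (norm (h *\<^sub>R z))\<^sup>2" using C(3) hz True by blast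
      also have "\<dots> \<le> C * (h * R)\<^sup>2" using C hz(2)[OF True] by (intro mult_left_mono power_mono) auto
      finally have "\<bar>K z\<bar> * \<bar>H (x + h *\<^sub>R z) + H (x - h *\<^sub>R z)\<bar> \<le> \<bar>K z\<bar> * (C * (h * R)\<^sup>2)"
        by (intro mult_left_mono) auto
      then show ?thesis by (simp add: abs_mult power_mult_distrib ac_simps)
    next
      case False
      then show ?thesis using K by (simp add: ball_kernel_def)
    qed
  qed
  finally have "2 * \<bar>\<integral>z. K z * H (x + h *\<^sub>R z) \<partial>lborel\<bar> \<le> C * R\<^sup>2 * h\<^sup>2 * (\<integral>z. \<bar>K z\<bar> \<partial>lborel)"
    by (simp add: abs_mult)
  moreover have "0 \<le> C * R\<^sup>2 * h\<^sup>2 * (\<integral>z. \<bar>K z\<bar> \<partial>lborel)" using C by simp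
  ultimately show ?thesis by (simp add: ac_simps)
qed

text \<open>If \<open>H\<close> vanishes at \<open>x\<close>, the linear parts of \<open>g\<close> and \<open>H\<close> only meet in a product of second order,
  so a Lipschitz weight \<open>g\<close> does not destroy the cancellation.\<close>

lemma symmetric_increment_mult:
  fixes g H :: "'a::real_normed_vector \<Rightarrow> real"
  assumes g: "\<And>w. norm w < r \<Longrightarrow> \<bar>g (x + w) - g x\<bar> \<le> C * norm w"
    and H: "\<And>w. norm w < r \<Longrightarrow> \<bar>H (x + w)\<bar> \<le> C * norm w"
       "\<And>w. norm w < r \<Longrightarrow> \<bar>H (x + w) + H (x - w)\<bar> \<le> C * (norm w)\<^sup>2"
    and C: "C \<ge> 0" and w: "norm w < r"
  shows "\<bar>g (x + w) * H (x + w) + g (x - w) * H (x - w)\<bar> \<le> (\<bar>g x\<bar> * C + 2 * C\<^sup>2) * (norm w)\<^sup>2"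
proof -
  have "\<bar>(g (x + v) - g x) * H (x + v)\<bar> \<le> (C * norm w) * (C * norm w)" if "norm v = norm w" for v
    unfolding abs_mult using g[of v] H(1)[of v] w that C by (intro mult_mono) auto
  from this[of w] this[of "-w"]
  have 1: "\<bar>(g (x + w) - g x) * H (x + w)\<bar> \<le> C\<^sup>2 * (norm w)\<^sup>2" "\<bar>(g (x - w) - g x) * H (x - w)\<bar> \<le> C\<^sup>2 * (norm w)\<^sup>2"
    by (simp_all add: power2_eq_square ac_simps)
  have 2: "\<bar>g x * (H (x + w) + H (x - w))\<bar> \<le> \<bar>g x\<bar> * (C * (norm w)\<^sup>2)"
    unfolding abs_mult using H(2)[OF w] by (intro mult_left_mono) auto
  have "g (x + w) * H (x + w) + g (x - w) * H (x - w) =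
      g x * (H (x + w) + H (x - w)) + (g (x + w) - g x) * H (x + w) + (g (x - w) - g x) * H (x - w)"
    by (simp add: algebra_simps)
  then have "\<bar>g (x + w) * H (x + w) + g (x - w) * H (x - w)\<bar> \<le> \<bar>g x\<bar> * (C * (norm w)\<^sup>2) + C\<^sup>2 * (norm w)\<^sup>2 + C\<^sup>2 * (norm w)\<^sup>2"
    using 1 2 by linarith
  then show ?thesis by (simp add: algebra_simps)
qed

lemma uniform_limit_constI:
  fixes q :: "nat \<Rightarrow> 'a \<Rightarrow> real"
  assumes "\<beta> \<longlonglongrightarrow> 0" "\<forall>\<^sub>F n in sequentially. \<forall>z\<in>S. \<bar>q n z - c\<bar> \<le> \<beta> n"
  shows "uniform_limit S q (\<lambda>_. c) sequentially"
  unfolding uniform_limit_iff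
proof (intro allI impI)
  fix e :: real assume "e > 0"
  with assms(1) have "\<forall>\<^sub>F n in sequentially. \<beta> n < e" by (rule order_tendstoD)
  with assms(2) show "\<forall>\<^sub>F n in sequentially. \<forall>z\<in>S. dist (q n z) c < e"
    by eventually_elim (force simp: dist_real_def)
qed

section \<open>The regression model at a point\<close>

text \<open>The local regression model at a point \<open>x\<close>: what the smoothness hypotheses on \<open>m\<close> and \<open>g\<close>
  amount to on a ball of radius \<open>r\<close>, with one constant \<open>C\<close> for all three bounds. Both kernels
  are supported in the ball of radius \<open>R\<close>; \<open>K1\<close> leaves a margin of one, so that it also vanishes
  at points within distance one of any point outside that ball.\<close>

locale regression_at = prob_space M for M :: "'w measure" +
  fixes X :: "nat \<Rightarrow> 'w \<Rightarrow> real^'d::finite" and Y err :: "nat \<Rightarrow> 'w \<Rightarrow> real"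
    and m g :: "real^'d \<Rightarrow> real" and f :: "real \<Rightarrow> real"
    and x :: "real^'d" and \<epsilon> :: real
    and K0 :: "real^'d \<Rightarrow> real" and K1 :: "real \<Rightarrow> real"
    and R r C Bf B2 L :: real
  assumes iid: "iid M borel (\<lambda>i w. (X i w, Y i w))"
    and m_meas [measurable]: "m \<in> borel_measurable borel"
    and model: "\<And>i w. Y i w = m (X i w) + err i w"
    and indep: "distr M borel (X 0) \<Otimes>\<^sub>M distr M borel (err 0) = distr M (borel \<Otimes>\<^sub>M borel) (\<lambda>w. (X 0 w, err 0 w))"
    and X_pdf: "has_pdf M (X 0) g"
    and err_pdf: "has_pdf M (err 0) f"
    and err_mean: "expectation (err 0) = 0"
    and err_sq: "integrable M (\<lambda>w. (err 0 w)\<^sup>2)"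
    and gx: "g x > 0"
    and f_C2: "Ck 2 f"
    and Bf: "\<And>u. \<bar>deriv f u\<bar> \<le> Bf"
    and B2: "\<And>u. \<bar>(deriv ^^ 2) f u\<bar> \<le> B2"
    and r: "r > 0" and C: "C > 0"
    and m_lip: "\<And>w. norm w < r \<Longrightarrow> \<bar>m (x + w) - m x\<bar> \<le> C * norm w"
    and m_sym: "\<And>w. norm w < r \<Longrightarrow> \<bar>m (x + w) + m (x - w) - 2 * m x\<bar> \<le> C * (norm w)\<^sup>2"
    and g_lip: "\<And>w. norm w < r \<Longrightarrow> \<bar>g (x + w) - g x\<bar> \<le> C * norm w"
    and R: "R > 0"
    and K0: "ball_kernel R K0" "\<And>z. K0 (- z) = K0 z" "(\<integral>z. K0 z \<partial>lborel) = 1"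
    and K1: "ball_kernel R K1" "(\<integral>v. K1 v \<partial>lborel) = 1" "(\<integral>v. v * K1 v \<partial>lborel) = 0"
    and K1_margin: "\<And>v. \<bar>v\<bar> > R - 1 \<Longrightarrow> K1 v = 0"
    and L: "L \<ge> 0" "\<And>u v. \<bar>K1 u - K1 v\<bar> \<le> L * \<bar>u - v\<bar>"
begin


text \<open>Centring \<open>m\<close> at \<open>x\<close> turns \<open>Y - m x\<close> into \<open>\<Delta> X + err\<close>, which separates the smoothing bias
  from the noise.\<close>

definition \<Delta> :: "real^'d \<Rightarrow> real" where "\<Delta> u = m u - m x"

lemma \<Delta>_measurable [measurable]: "\<Delta> \<in> borel_measurable borel"
  unfolding \<Delta>_def by measurable

lemma XY_measurable [measurable]: "X i \<in> borel_measurable M" "Y i \<in> borel_measurable M"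
proof -
  have "(\<lambda>w. (X i w, Y i w)) \<in> borel_measurable M"
    using iid unfolding iid_def indep_vars_def2 by auto
  then have "(\<lambda>w. fst (X i w, Y i w)) \<in> borel_measurable M" "(\<lambda>w. snd (X i w, Y i w)) \<in> borel_measurable M"
    unfolding borel_prod[symmetric] by measurable
  then show "X i \<in> borel_measurable M" "Y i \<in> borel_measurable M" by simp_all
qed

lemma err_measurable [measurable]: "err i \<in> borel_measurable M"
proof -
  have "err i = (\<lambda>w. Y i w - m (X i w))" using model by auto
  then show ?thesis by simp
qed

lemma g_nonneg: "g u \<ge> 0" and f_nonneg: "f e \<ge> 0"
  using X_pdf err_pdf by (auto simp: has_pdf_def)

lemma g_measurable [measurable]: "g \<in> borel_measurable borel"
  using X_pdf g_nonneg unfolding has_pdf_def by (auto dest!: distributed_real_measurable[rotated])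

lemma f_deriv: "(f has_real_derivative deriv f u) (at u)"
  using f_C2 unfolding Ck_def by (auto simp: DERIV_deriv_iff_field_differentiable dest: spec[of _ 0])

lemma f_cont: "continuous_on UNIV f"
  using f_deriv by (intro continuous_at_imp_continuous_on ballI DERIV_isCont) auto

lemma f_measurable [measurable]: "f \<in> borel_measurable borel"
  using f_cont by (rule borel_measurable_continuous_onI)

lemma kernels_measurable [measurable]: "K0 \<in> borel_measurable borel" "K1 \<in> borel_measurable borel"
  using K0 K1 by (auto simp: ball_kernel_def)

lemma f_lip: "\<bar>f u - f v\<bar> \<le> Bf * \<bar>u - v\<bar>"
  using field_differentiable_bound[of UNIV f "deriv f" Bf u v] f_deriv Bf by auto

lemma Bf_nonneg: "Bf \<ge> 0" and B2_nonneg: "B2 \<ge> 0"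
  using Bf[of 0] B2[of 0] by linarith+

text \<open>The factor \<open>h ^ d\<close> is the Jacobian of \<open>z \<mapsto> x + h z\<close>; applied to functions of \<open>(X - x)/h\<close> it
  produces integrals over a fixed kernel.\<close>

lemma expectation_X:
  assumes [measurable]: "F \<in> borel_measurable borel" and "h > 0"
  shows "expectation (\<lambda>w. F (X 0 w)) = h ^ CARD('d) * (\<integral>z. F (x + h *\<^sub>R z) * g (x + h *\<^sub>R z) \<partial>lborel)"
proof -
  have "expectation (\<lambda>w. F (X 0 w)) = (\<integral>u. g u * F u \<partial>lborel)"
    using X_pdf unfolding has_pdf_def by (subst distributed_integral) auto
  also have "\<dots> = h ^ CARD('d) * (\<integral>z. g (x + h *\<^sub>R z) * F (x + h *\<^sub>R z) \<partial>lborel)"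
    by (subst integral_lborel_affine[OF _ \<open>h > 0\<close>, of _ x]) auto
  finally show ?thesis by (simp add: mult.commute)
qed

lemma expectation_err:
  assumes [measurable]: "F \<in> borel_measurable borel" and "h > 0"
  shows "expectation (\<lambda>w. F (err 0 w)) = h * (\<integral>v. F (t + h * v) * f (t + h * v) \<partial>lborel)"
proof -
  have "expectation (\<lambda>w. F (err 0 w)) = (\<integral>u. f u * F u \<partial>lborel)"
    using err_pdf unfolding has_pdf_def by (subst distributed_integral) auto
  also have "\<dots> = h * (\<integral>z. f (t + h * z) * F (t + h * z) \<partial>lborel)"
    by (subst lborel_integral_real_affine[of h _ t]) (use \<open>h > 0\<close> in auto)
  finally show ?thesis by (simp add: mult.commute)
qed

lemma expectation_X_err:
  fixes W :: "real^'d \<Rightarrow> real \<Rightarrow> real"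
  assumes W[measurable]: "(\<lambda>(u, e). W u e) \<in> borel_measurable (borel \<Otimes>\<^sub>M borel)"
    and int: "integrable M (\<lambda>w. W (X 0 w) (err 0 w))"
  shows "expectation (\<lambda>w. W (X 0 w) (err 0 w)) = expectation (\<lambda>w. \<integral>w'. W (X 0 w) (err 0 w') \<partial>M)"
proof -
  let ?P = "distr M borel (X 0)" and ?Q = "distr M borel (err 0)"
  interpret P: prob_space ?P by (rule prob_space_distr) simp
  interpret Q: prob_space ?Q by (rule prob_space_distr) simp
  interpret PQ: pair_sigma_finite ?P ?Q ..
  have [measurable_cong]: "sets ?P = sets borel" "sets ?Q = sets borel" by auto
  have i: "integrable (?P \<Otimes>\<^sub>M ?Q) (\<lambda>(u, e). W u e)"
    unfolding indep by (subst integrable_distr_eq) (use int in auto)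
  have "expectation (\<lambda>w. W (X 0 w) (err 0 w)) = (\<integral>z. (case z of (u, e) \<Rightarrow> W u e) \<partial>(?P \<Otimes>\<^sub>M ?Q))"
    unfolding indep by (subst integral_distr) auto
  also have "\<dots> = (\<integral>u. (\<integral>e. W u e \<partial>?Q) \<partial>?P)"
    using PQ.integral_fst[OF i] by simp
  also have "\<dots> = expectation (\<lambda>w. \<integral>e. W (X 0 w) e \<partial>?Q)"
    by (subst integral_distr) auto
  also have "\<dots> = expectation (\<lambda>w. \<integral>w'. W (X 0 w) (err 0 w') \<partial>M)"
    by (intro Bochner_Integration.integral_cong refl, subst integral_distr) auto
  finally show ?thesis .
qed

text \<open>\<open>J k h s\<close> is \<open>1/h\<close> times the expectation of \<open>k ((s + err - \<epsilon>) / h)\<close>, the kernel smoothing of the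
  error density when the regression function is off by \<open>s\<close>.\<close>

definition J :: "(real \<Rightarrow> real) \<Rightarrow> real \<Rightarrow> real \<Rightarrow> real" where
  "J k h s = (\<integral>v. k v * f (\<epsilon> - s + h * v) \<partial>lborel)"

lemma J_measurable [measurable]:
  assumes [measurable]: "k \<in> borel_measurable borel" shows "J k h \<in> borel_measurable borel"
  unfolding J_def by measurable

lemma J_bound:
  assumes k: "ball_kernel R k" and h: "h \<ge> 0"
  shows "\<bar>J k h s - f \<epsilon> * (\<integral>v. k v \<partial>lborel)\<bar> \<le> Bf * (\<bar>s\<bar> + h * R) * (\<integral>v. \<bar>k v\<bar> \<partial>lborel)"
  unfolding J_def
proof (rule ball_kernel_integral_near_const(2)[OF k])
  fix v :: real assume "norm v \<le> R"
  then have "\<bar>h * v\<bar> \<le> h * R" using h by (simp add: abs_mult mult_left_mono)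
  have "\<bar>f (\<epsilon> - s + h * v) - f \<epsilon>\<bar> \<le> Bf * \<bar>(\<epsilon> - s + h * v) - \<epsilon>\<bar>" by (rule f_lip)
  also have "\<dots> \<le> Bf * (\<bar>s\<bar> + h * R)"
    using \<open>\<bar>h * v\<bar> \<le> h * R\<close> Bf_nonneg by (intro mult_left_mono) linarith+
  finally show "\<bar>f (\<epsilon> - s + h * v) - f \<epsilon>\<bar> \<le> Bf * (\<bar>s\<bar> + h * R)" .
qed simp

text \<open>Independence allows integrating over the error first, for fixed \<open>X\<close>; the two substitutions
  then give the Jacobians \<open>h ^ d\<close> and \<open>h'\<close>.\<close>

lemma expectation_product_kernel:
  assumes p: "ball_kernel R p" and k: "ball_kernel R k" and h: "h > 0" "h' > 0"
  shows "expectation (\<lambda>w. p ((X 0 w - x) /\<^sub>R h) * k ((Y 0 w - m x - \<epsilon>) / h')) =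
    h ^ CARD('d) * h' * (\<integral>z. p z * (g (x + h *\<^sub>R z) * J k h' (\<Delta> (x + h *\<^sub>R z))) \<partial>lborel)"
proof -
  have [measurable]: "p \<in> borel_measurable borel" "k \<in> borel_measurable borel"
    using p k by (auto simp: ball_kernel_def)
  obtain B B' where B: "\<And>z. \<bar>p z\<bar> \<le> B" "\<And>z. \<bar>k z\<bar> \<le> B'"
    using p k by (auto simp: ball_kernel_def bounded_iff)
  define W where "W u e = p ((u - x) /\<^sub>R h) * k ((\<Delta> u + e - \<epsilon>) / h')" for u e
  have W: "(\<lambda>(u, e). W u e) \<in> borel_measurable (borel \<Otimes>\<^sub>M borel)"
    unfolding W_def by measurable
  have "\<bar>W u e\<bar> \<le> B * B'" for u e
    unfolding W_def abs_mult using B(1)[of "(u - x) /\<^sub>R h"] B(2)[of "(\<Delta> u + e - \<epsilon>) / h'"] by (intro mult_mono) auto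
  moreover have "(\<lambda>w. W (X 0 w) (err 0 w)) \<in> borel_measurable M"
    unfolding W_def by measurable
  ultimately have int: "integrable M (\<lambda>w. W (X 0 w) (err 0 w))"
    by (intro integrable_const_bound[where B = "B * B'"]) auto
  have "(\<integral>w'. W u (err 0 w') \<partial>M) = p ((u - x) /\<^sub>R h) * (h' * J k h' (\<Delta> u))" for u
  proof -
    have "expectation (\<lambda>w. k ((\<Delta> u + err 0 w - \<epsilon>) / h')) =
       h' * (\<integral>v. k ((\<Delta> u + (\<epsilon> - \<Delta> u + h' * v) - \<epsilon>) / h') * f (\<epsilon> - \<Delta> u + h' * v) \<partial>lborel)"
      by (rule expectation_err[where F = "\<lambda>e. k ((\<Delta> u + e - \<epsilon>) / h')"]) (use h in auto)
    also have "\<dots> = h' * J k h' (\<Delta> u)" using h by (simp add: J_def)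
    finally show ?thesis by (simp add: W_def)
  qed
  then have "expectation (\<lambda>w. W (X 0 w) (err 0 w)) = expectation (\<lambda>w. p ((X 0 w - x) /\<^sub>R h) * (h' * J k h' (\<Delta> (X 0 w))))"
    using expectation_X_err[OF W int] by simp
  also have "\<dots> = h ^ CARD('d) * (\<integral>z. p ((x + h *\<^sub>R z - x) /\<^sub>R h) * (h' * J k h' (\<Delta> (x + h *\<^sub>R z))) * g (x + h *\<^sub>R z) \<partial>lborel)"
    by (rule expectation_X[where F = "\<lambda>u. p ((u - x) /\<^sub>R h) * (h' * J k h' (\<Delta> u))"]) (use h in auto)
  also have "\<dots> = h ^ CARD('d) * (\<integral>z. h' * (p z * (g (x + h *\<^sub>R z) * J k h' (\<Delta> (x + h *\<^sub>R z)))) \<partial>lborel)"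
    using h by (simp add: ac_simps)
  also have "\<dots> = h ^ CARD('d) * h' * (\<integral>z. p z * (g (x + h *\<^sub>R z) * J k h' (\<Delta> (x + h *\<^sub>R z))) \<partial>lborel)"
    by simp
  finally show ?thesis by (simp add: W_def \<Delta>_def model algebra_simps)
qed

lemma g_isCont: "isCont g x"
  unfolding continuous_at_eps_delta
proof (intro allI impI)
  fix e :: real assume e: "e > 0"
  show "\<exists>\<delta>>0. \<forall>u. dist u x < \<delta> \<longrightarrow> dist (g u) (g x) < e"
  proof (intro exI[of _ "min r (e / C)"] conjI allI impI)
    show "min r (e / C) > 0" using r C e by simp
    fix u assume "dist u x < min r (e / C)"
    then have "norm (u - x) < r" "C * norm (u - x) < e" using C by (auto simp: dist_norm field_simps)
    then show "dist (g u) (g x) < e" using g_lip[of "u - x"] by (simp add: dist_real_def)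
  qed
qed

lemma \<Delta>_lip: "norm w < r \<Longrightarrow> \<bar>\<Delta> (x + w)\<bar> \<le> C * norm w"
  using m_lip by (simp add: \<Delta>_def)

lemma \<Delta>_sym: "norm w < r \<Longrightarrow> \<bar>\<Delta> (x + w) + \<Delta> (x - w)\<bar> \<le> C * (norm w)\<^sup>2"
  using m_sym[of w] by (simp add: \<Delta>_def algebra_simps)

lemma scaled_in_ball:
  assumes "norm z \<le> R" "h \<ge> 0" "h * R < r"
  shows "norm (h *\<^sub>R z) < r" "norm (h *\<^sub>R z) \<le> h * R"
  using mult_left_mono[OF assms(1,2)] assms by auto

lemma eventually_small:
  assumes "h \<longlonglongrightarrow> (0::real)" shows "\<forall>\<^sub>F n in sequentially. h n * R < r"
  using order_tendstoD(2)[OF tendsto_mult_left_zero[OF assms, of R] r] .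

lemma marginal_limit:
  assumes p: "ball_kernel R p" and h: "\<And>n. h n > 0" "h \<longlonglongrightarrow> 0"
  shows "(\<lambda>n. expectation (\<lambda>w. p ((X 0 w - x) /\<^sub>R h n)) / h n ^ CARD('d)) \<longlonglongrightarrow> g x * (\<integral>z. p z \<partial>lborel)"
    (is "?E \<longlonglongrightarrow> _")
proof -
  have [measurable]: "p \<in> borel_measurable borel" using p by (auto simp: ball_kernel_def)
  have "?E n = (\<integral>z. p z * g (x + h n *\<^sub>R z) \<partial>lborel)" for n
    using expectation_X[where F = "\<lambda>u. p ((u - x) /\<^sub>R h n)" and h = "h n"] h(1)[of n]
    by simp
  then show ?thesis
    using ball_kernel_integral_tendsto[OF p _ uniform_limit_shrinking_argument[OF g_isCont h(2)]] by simp
qed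

lemma J_uniform_limit:
  assumes k: "ball_kernel R k" and h: "\<And>n. h n > 0" "h \<longlonglongrightarrow> 0" and h': "\<And>n. h' n > 0" "h' \<longlonglongrightarrow> 0"
  shows "uniform_limit (cball 0 R) (\<lambda>n z. J k (h' n) (\<Delta> (x + h n *\<^sub>R z))) (\<lambda>_. f \<epsilon> * (\<integral>v. k v \<partial>lborel)) sequentially"
proof (rule uniform_limit_constI)
  let ?I = "\<integral>v. \<bar>k v\<bar> \<partial>lborel"
  show "(\<lambda>n. Bf * (C * (h n * R) + h' n * R) * ?I) \<longlonglongrightarrow> 0"
    by (rule tendsto_eq_intros h h' | simp)+
  show "\<forall>\<^sub>F n in sequentially. \<forall>z\<in>cball 0 R.
     \<bar>J k (h' n) (\<Delta> (x + h n *\<^sub>R z)) - f \<epsilon> * (\<integral>v. k v \<partial>lborel)\<bar> \<le> Bf * (C * (h n * R) + h' n * R) * ?I"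
    using eventually_small[OF h(2)]
  proof eventually_elim
    case (elim n)
    show ?case
    proof
      fix z :: "real^'d" assume "z \<in> cball 0 R"
      then have z: "norm (h n *\<^sub>R z) < r" "norm (h n *\<^sub>R z) \<le> h n * R"
        using scaled_in_ball[of z "h n"] elim h(1)[of n] by auto
      have "\<bar>\<Delta> (x + h n *\<^sub>R z)\<bar> \<le> C * norm (h n *\<^sub>R z)" by (rule \<Delta>_lip[OF z(1)])
      also have "\<dots> \<le> C * (h n * R)" using z(2) C by (intro mult_left_mono) auto
      finally have "Bf * (\<bar>\<Delta> (x + h n *\<^sub>R z)\<bar> + h' n * R) * ?I \<le> Bf * (C * (h n * R) + h' n * R) * ?I"
        using Bf_nonneg by (intro mult_right_mono mult_left_mono) auto
      with J_bound[OF k less_imp_le[OF h'(1)[of n]], of "\<Delta> (x + h n *\<^sub>R z)"]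
      show "\<bar>J k (h' n) (\<Delta> (x + h n *\<^sub>R z)) - f \<epsilon> * (\<integral>v. k v \<partial>lborel)\<bar> \<le> Bf * (C * (h n * R) + h' n * R) * ?I"
        by linarith
    qed
  qed
qed

text \<open>All first-order asymptotics of the numerator are instances of this limit: the means and second
  moments of the summands, and the mass of the window that controls the plug-in error.\<close>

lemma joint_limit:
  assumes p: "ball_kernel R p" and k: "ball_kernel R k"
    and h: "\<And>n. h n > 0" "h \<longlonglongrightarrow> 0" and h': "\<And>n. h' n > 0" "h' \<longlonglongrightarrow> 0"
  shows "(\<lambda>n. expectation (\<lambda>w. p ((X 0 w - x) /\<^sub>R h n) * k ((Y 0 w - m x - \<epsilon>) / h' n)) / (h n ^ CARD('d) * h' n))
     \<longlonglongrightarrow> g x * f \<epsilon> * (\<integral>z. p z \<partial>lborel) * (\<integral>v. k v \<partial>lborel)"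
    (is "?E \<longlonglongrightarrow> _")
proof -
  have [measurable]: "k \<in> borel_measurable borel" using k by (auto simp: ball_kernel_def)
  have E: "?E n = (\<integral>z. p z * (g (x + h n *\<^sub>R z) * J k (h' n) (\<Delta> (x + h n *\<^sub>R z))) \<partial>lborel)" for n
    using expectation_product_kernel[OF p k h(1)[of n] h'(1)[of n]] h(1)[of n] h'(1)[of n] by simp
  have "(\<lambda>n. \<integral>z. p z * (g (x + h n *\<^sub>R z) * J k (h' n) (\<Delta> (x + h n *\<^sub>R z))) \<partial>lborel)
      \<longlonglongrightarrow> (g x * (f \<epsilon> * (\<integral>v. k v \<partial>lborel))) * (\<integral>z. p z \<partial>lborel)"
    by (intro ball_kernel_integral_tendsto[OF p] uniform_lim_mult J_uniform_limit
        uniform_limit_shrinking_argument g_isCont k h h') (auto simp: bounded_iff)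
  then show ?thesis unfolding E by (simp add: ac_simps)
qed

end

section \<open>Bias\<close>

context regression_at begin

definition dens_mean :: "real \<Rightarrow> real" where
  "dens_mean h = (\<integral>z. K0 z * g (x + h *\<^sub>R z) \<partial>lborel)"

definition num_mean :: "real \<Rightarrow> real \<Rightarrow> real" where
  "num_mean h h' = (\<integral>z. K0 z * (g (x + h *\<^sub>R z) * J K1 h' (\<Delta> (x + h *\<^sub>R z))) \<partial>lborel)"

text \<open>The coefficient of \<open>h'\<^sup>2\<close> in the bias of a kernel estimator of \<open>f(\<epsilon>)\<close>.\<close>

definition f_bias :: real where
  "f_bias = (deriv ^^ 2) f \<epsilon> * (\<integral>v. v\<^sup>2 * K1 v \<partial>lborel) / 2"

text \<open>The error made in the density by evaluating it with the regression function of a neighbouring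
  point.\<close>

definition H :: "real^'d \<Rightarrow> real" where "H u = f (\<epsilon> - \<Delta> u) - f \<epsilon>"

lemma H_measurable [measurable]: "H \<in> borel_measurable borel"
  unfolding H_def by measurable

lemma ball_kernel_times_id: "ball_kernel R (\<lambda>v. v * K1 v)"
proof -
  obtain B where B: "\<And>v. \<bar>K1 v\<bar> \<le> B" using K1 by (auto simp: ball_kernel_def bounded_iff)
  have "\<bar>v * K1 v\<bar> \<le> R * B" for v
  proof (cases "\<bar>v\<bar> \<le> R")
    case True
    then show ?thesis unfolding abs_mult using B[of v] R by (intro mult_mono) auto
  next
    case False
    then show ?thesis using K1 R B[of 0] by (auto simp: ball_kernel_def)
  qed
  then show ?thesis using K1 by (auto simp: ball_kernel_def bounded_iff)
qed

lemma ball_kernel_times_square: "ball_kernel R (\<lambda>v. v\<^sup>2 * K1 v)"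
proof -
  obtain B where B: "\<And>v. \<bar>v * K1 v\<bar> \<le> B"
    using ball_kernel_times_id by (auto simp: ball_kernel_def bounded_iff)
  have "\<bar>v\<^sup>2 * K1 v\<bar> \<le> R * B" for v
  proof (cases "\<bar>v\<bar> \<le> R")
    case True
    have "\<bar>v\<^sup>2 * K1 v\<bar> = \<bar>v\<bar> * \<bar>v * K1 v\<bar>" by (simp add: power2_eq_square abs_mult)
    also have "\<dots> \<le> R * B" using B[of v] R True by (intro mult_mono) auto
    finally show ?thesis .
  next
    case False
    then show ?thesis using K1 R B[of 0] by (auto simp: ball_kernel_def)
  qed
  then show ?thesis using K1 by (auto simp: ball_kernel_def bounded_iff)
qed

text \<open>The first two moment conditions on \<open>K1\<close> remove the terms of order 0 and 1 of the Taylor polynomial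
  at \<open>\<epsilon> - s\<close>. The quadratic coefficient is taken at \<open>\<epsilon>\<close> rather than at \<open>\<epsilon> - s\<close>, so that the
  leading term is independent of \<open>s\<close>; the oscillation \<open>\<eta>\<close> of \<open>f''\<close> pays for this.\<close>

lemma J_second_order:
  assumes h: "h > 0" and \<eta>: "\<And>u. \<bar>u - (\<epsilon> - s)\<bar> \<le> h * R \<Longrightarrow> \<bar>(deriv ^^ 2) f u - (deriv ^^ 2) f \<epsilon>\<bar> \<le> \<eta>"
  shows "\<bar>J K1 h s - f (\<epsilon> - s) - h\<^sup>2 * f_bias\<bar> \<le> \<eta> * (h * R)\<^sup>2 * (\<integral>v. \<bar>K1 v\<bar> \<partial>lborel)"
proof -
  define c where "c = (deriv ^^ 2) f \<epsilon>"
  define a where "a = \<epsilon> - s"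
  define q where "q v = f (a + h * v) - f a - (h * v) * deriv f a - (h * v)\<^sup>2 / 2 * c" for v
  have [measurable]: "q \<in> borel_measurable borel" unfolding q_def by measurable
  have \<eta>0: "\<eta> \<ge> 0" using \<eta>[of a] h R by (simp add: a_def)
  have q: "\<bar>q v - 0\<bar> \<le> \<eta> * (h * R)\<^sup>2" if "norm v \<le> R" for v
  proof -
    have hv: "\<bar>h * v\<bar> \<le> h * R" using that h by (simp add: abs_mult)
    have "\<bar>q v\<bar> \<le> \<eta> * (h * v)\<^sup>2"
      unfolding q_def by (rule taylor2_bound[OF f_C2]) (use \<eta> hv in \<open>auto simp: c_def a_def\<close>)
    also have "\<dots> \<le> \<eta> * (h * R)\<^sup>2"
      using hv \<eta>0 h R by (intro mult_left_mono) (auto simp flip: abs_le_square_iff)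
    finally show ?thesis by simp
  qed
  note q' = ball_kernel_integral_near_const[OF K1(1) _ q]
  have i: "integrable lborel (\<lambda>v. K1 v * q v)" by (rule q'(1)) simp
  note t = ball_kernel_integrable[OF K1(1)] ball_kernel_integrable[OF ball_kernel_times_id]
    ball_kernel_integrable[OF ball_kernel_times_square]
  have eq: "K1 v * f (a + h * v) = K1 v * q v + f a * K1 v + h * deriv f a * (v * K1 v) + h\<^sup>2 * c / 2 * (v\<^sup>2 * K1 v)" for v
    by (simp add: q_def algebra_simps power_mult_distrib)
  have "J K1 h s = (\<integral>v. K1 v * q v + f a * K1 v + h * deriv f a * (v * K1 v) + h\<^sup>2 * c / 2 * (v\<^sup>2 * K1 v) \<partial>lborel)"
    unfolding J_def a_def[symmetric] eq ..
  also have "\<dots> = (\<integral>v. K1 v * q v \<partial>lborel) + f a + h\<^sup>2 * f_bias"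
    using i t K1 by (simp add: f_bias_def c_def)
  finally have "J K1 h s - f a - h\<^sup>2 * f_bias = (\<integral>v. K1 v * q v \<partial>lborel)" by simp
  then show ?thesis using q'(2) by (simp add: a_def)
qed

text \<open>\<open>H\<close> inherits both increment bounds from \<open>\<Delta>\<close> since \<open>f\<close> is linear up to a quadratic error. Requiring
  \<open>A \<ge> C\<close> lets \<open>A\<close> serve as Lipschitz constant of \<open>g\<close> too.\<close>

lemma H_bounds:
  obtains A where "A > 0" "\<And>w. norm w < r \<Longrightarrow> \<bar>H (x + w)\<bar> \<le> A * norm w"
    "\<And>w. norm w < r \<Longrightarrow> \<bar>H (x + w) + H (x - w)\<bar> \<le> A * (norm w)\<^sup>2" "A \<ge> C"
proof -
  define A where "A = Bf * C + 2 * B2 * C\<^sup>2 + C"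
  have t: "\<bar>H u + \<Delta> u * deriv f \<epsilon>\<bar> \<le> B2 * (\<Delta> u)\<^sup>2" for u
    using taylor2_bound[OF f_C2, of "\<epsilon>" "- \<Delta> u" 0 B2] B2 by (simp add: H_def)
  show ?thesis
  proof
    show "A > 0" using C Bf_nonneg B2_nonneg by (simp add: A_def add_nonneg_pos)
    show "A \<ge> C" using C Bf_nonneg B2_nonneg by (simp add: A_def)
    fix w :: "real^'d" assume w: "norm w < r"
    have "\<bar>H (x + w)\<bar> \<le> Bf * \<bar>\<Delta> (x + w)\<bar>" using f_lip[of "\<epsilon> - \<Delta> (x + w)" \<epsilon>] by (simp add: H_def)
    also have "\<dots> \<le> Bf * (C * norm w)" using \<Delta>_lip[OF w] Bf_nonneg by (rule mult_left_mono)
    also have "\<dots> \<le> A * norm w" using C B2_nonneg by (simp add: A_def algebra_simps)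
    finally show "\<bar>H (x + w)\<bar> \<le> A * norm w" .
    have sq: "B2 * (\<Delta> (x + v))\<^sup>2 \<le> B2 * (C\<^sup>2 * (norm w)\<^sup>2)" if "norm v = norm w" for v
    proof -
      have "\<bar>\<Delta> (x + v)\<bar>\<^sup>2 \<le> (C * norm w)\<^sup>2" using \<Delta>_lip[of v] w that by (intro power_mono) auto
      then show ?thesis using B2_nonneg by (intro mult_left_mono) (auto simp: power_mult_distrib)
    qed
    have "\<bar>(\<Delta> (x + w) + \<Delta> (x - w)) * deriv f \<epsilon>\<bar> \<le> (C * (norm w)\<^sup>2) * Bf"
      unfolding abs_mult using \<Delta>_sym[OF w] Bf C by (intro mult_mono) auto
    moreover have "H (x + w) + H (x - w) = (H (x + w) + \<Delta> (x + w) * deriv f \<epsilon>) + (H (x - w) + \<Delta> (x - w) * deriv f \<epsilon>)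
        - (\<Delta> (x + w) + \<Delta> (x - w)) * deriv f \<epsilon>" by (simp add: algebra_simps)
    ultimately have "\<bar>H (x + w) + H (x - w)\<bar> \<le> 2 * (B2 * (C\<^sup>2 * (norm w)\<^sup>2)) + (C * (norm w)\<^sup>2) * Bf"
      using t[of "x + w"] t[of "x - w"] sq[of w] sq[of "-w"] by simp
    also have "\<dots> \<le> A * (norm w)\<^sup>2" using C by (simp add: A_def algebra_simps)
    finally show "\<bar>H (x + w) + H (x - w)\<bar> \<le> A * (norm w)\<^sup>2" .
  qed
qed

lemma g_bound: "norm w < r \<Longrightarrow> \<bar>g (x + w)\<bar> \<le> g x + C * r"
proof -
  assume w: "norm w < r"
  have "C * norm w \<le> C * r" using w C by simp
  with g_lip[OF w] show ?thesis using gx by linarith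
qed

text \<open>Used with \<open>G = \<Delta>\<close> for the bias of the Nadaraya--Watson estimator and with \<open>G = H\<close> for the bias of
  the numerator in the direction of \<open>X\<close>.\<close>

lemma symmetric_smoothing_bound:
  assumes [measurable]: "G \<in> borel_measurable borel" and A: "A \<ge> C"
    and G: "\<And>w. norm w < r \<Longrightarrow> \<bar>G (x + w)\<bar> \<le> A * norm w"
       "\<And>w. norm w < r \<Longrightarrow> \<bar>G (x + w) + G (x - w)\<bar> \<le> A * (norm w)\<^sup>2"
  obtains A' where "A' \<ge> 0" "\<And>h. h > 0 \<Longrightarrow> h * R < r \<Longrightarrow>
      \<bar>\<integral>z. K0 z * (g (x + h *\<^sub>R z) * G (x + h *\<^sub>R z)) \<partial>lborel\<bar> \<le> A' * h\<^sup>2"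
proof -
  have A0: "A \<ge> 0" using A C by simp
  define D where "D = (g x + C * r) * (A * r) + (\<bar>g x\<bar> * A + 2 * A\<^sup>2)"
  have gr: "0 \<le> g x + C * r" using gx C r by simp
  have D0: "D \<ge> 0" unfolding D_def using gr A0 r by simp
  show ?thesis
  proof (rule that[of "D * R\<^sup>2 * (\<integral>z. \<bar>K0 z\<bar> \<partial>lborel)"])
    show "0 \<le> D * R\<^sup>2 * (\<integral>z. \<bar>K0 z\<bar> \<partial>lborel)" using D0 by simp
    fix h assume h: "h > 0" "h * R < r"
    show "\<bar>\<integral>z. K0 z * (g (x + h *\<^sub>R z) * G (x + h *\<^sub>R z)) \<partial>lborel\<bar> \<le> D * R\<^sup>2 * (\<integral>z. \<bar>K0 z\<bar> \<partial>lborel) * h\<^sup>2"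
    proof (rule symmetric_kernel_integral_bound[where H = "\<lambda>u. g u * G u" and r = r])
      fix w :: "real^'d" assume w: "norm w < r"
      have "\<bar>G (x + w)\<bar> \<le> A * r" using G(1)[OF w] mult_left_mono[OF less_imp_le[OF w] A0] by linarith
      then have "\<bar>g (x + w) * G (x + w)\<bar> \<le> (g x + C * r) * (A * r)"
        unfolding abs_mult using g_bound[OF w] gr by (intro mult_mono) auto
      also have "\<dots> \<le> D" using A0 by (simp add: D_def)
      finally show "\<bar>g (x + w) * G (x + w)\<bar> \<le> D" .
      have g': "\<bar>g (x + v) - g x\<bar> \<le> A * norm v" if "norm v < r" for v
        using g_lip[OF that] mult_right_mono[OF A norm_ge_zero[of v]] by linarith
      have "\<bar>g (x + w) * G (x + w) + g (x - w) * G (x - w)\<bar> \<le> (\<bar>g x\<bar> * A + 2 * A\<^sup>2) * (norm w)\<^sup>2"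
        by (rule symmetric_increment_mult[OF g' G A0 w])
      also have "\<dots> \<le> D * (norm w)\<^sup>2" using gr A0 r by (intro mult_right_mono) (auto simp: D_def)
      finally show "\<bar>g (x + w) * G (x + w) + g (x - w) * G (x - w)\<bar> \<le> D * (norm w)\<^sup>2" .
    qed (use K0 D0 h in auto)
  qed
qed

lemma integrable_K0_times:
  assumes [measurable]: "q \<in> borel_measurable borel" and q: "\<And>z. norm z \<le> R \<Longrightarrow> \<bar>q z\<bar> \<le> B"
  shows "integrable lborel (\<lambda>z. K0 z * q z)" "\<bar>\<integral>z. K0 z * q z \<partial>lborel\<bar> \<le> B * (\<integral>z. \<bar>K0 z\<bar> \<partial>lborel)"
  using ball_kernel_integral_near_const[OF K0(1), of q 0 B] q by auto

text \<open>Subtracting \<open>dens_mean\<close> times the limit compares numerator and denominator under the same weight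
  \<open>K0 z * g (x + h z)\<close>. What is left is \<open>H\<close>, which contributes \<open>O(h\<^sup>2)\<close> by symmetry, and the Taylor
  remainder of \<open>f\<close>, which is \<open>o(h'\<^sup>2)\<close> uniformly over the window.\<close>

lemma second_order_bias:
  assumes h: "\<And>n. h n > 0" "h \<longlonglongrightarrow> 0" and h': "\<And>n. h' n > 0" "h' \<longlonglongrightarrow> 0"
  obtains A where "A \<ge> 0" "\<And>e. e > 0 \<Longrightarrow> \<forall>\<^sub>F n in sequentially.
    \<bar>num_mean (h n) (h' n) - dens_mean (h n) * (f \<epsilon> + (h' n)\<^sup>2 * f_bias)\<bar> \<le> A * (h n)\<^sup>2 + e * (h' n)\<^sup>2"
proof -
  obtain A1 where A1: "A1 > 0" "\<And>w. norm w < r \<Longrightarrow> \<bar>H (x + w)\<bar> \<le> A1 * norm w"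
    "\<And>w. norm w < r \<Longrightarrow> \<bar>H (x + w) + H (x - w)\<bar> \<le> A1 * (norm w)\<^sup>2" "A1 \<ge> C" using H_bounds by blast
  obtain A where A: "A \<ge> 0" "\<And>h. h > 0 \<Longrightarrow> h * R < r \<Longrightarrow>
      \<bar>\<integral>z. K0 z * (g (x + h *\<^sub>R z) * H (x + h *\<^sub>R z)) \<partial>lborel\<bar> \<le> A * h\<^sup>2"
    using symmetric_smoothing_bound[OF H_measurable A1(4,2,3)] by blast
  define I0 where "I0 = (\<integral>z. \<bar>K0 z\<bar> \<partial>lborel)"
  define I1 where "I1 = (\<integral>v. \<bar>K1 v\<bar> \<partial>lborel)"
  define Gm where "Gm = g x + C * r"
  have nn: "I0 \<ge> 0" "I1 \<ge> 0" "Gm \<ge> 0" using gx C r by (simp_all add: I0_def I1_def Gm_def)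
  show ?thesis
  proof (rule that[OF A(1)])
    fix e :: real assume e: "e > 0"
    define T where "T = R\<^sup>2 * I1 * Gm * I0"
    have T: "T \<ge> 0" using nn by (simp add: T_def)
    define \<eta> where "\<eta> = e / (T + 1)"
    have \<eta>: "\<eta> > 0" "\<eta> * T \<le> e" using e T by (auto simp: \<eta>_def field_simps)
    have "isCont ((deriv ^^ 2) f) \<epsilon>"
      using f_C2 unfolding Ck_def by (simp add: continuous_on_eq_continuous_at)
    then obtain \<delta> where \<delta>: "\<delta> > 0" "\<And>u. dist u \<epsilon> < \<delta> \<Longrightarrow> dist ((deriv ^^ 2) f u) ((deriv ^^ 2) f \<epsilon>) < \<eta>"
      using \<eta>(1) unfolding continuous_at_eps_delta by blast
    have "(\<lambda>n. C * (h n * R) + h' n * R) \<longlonglongrightarrow> 0"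
      by (rule tendsto_eq_intros h h' | simp)+
    then have "\<forall>\<^sub>F n in sequentially. C * (h n * R) + h' n * R < \<delta>"
      using \<delta>(1) by (rule order_tendstoD)
    with eventually_small[OF h(2)]
    show "\<forall>\<^sub>F n in sequentially.
      \<bar>num_mean (h n) (h' n) - dens_mean (h n) * (f \<epsilon> + (h' n)\<^sup>2 * f_bias)\<bar> \<le> A * (h n)\<^sup>2 + e * (h' n)\<^sup>2"
    proof eventually_elim
      case (elim n)
      define \<rho> where "\<rho> s = J K1 (h' n) s - f (\<epsilon> - s) - (h' n)\<^sup>2 * f_bias" for s
      have [measurable]: "\<rho> \<in> borel_measurable borel" unfolding \<rho>_def by measurable
      have z: "norm (h n *\<^sub>R z) < r" "norm (h n *\<^sub>R z) \<le> h n * R" if "norm z \<le> R" for z :: "real^'d"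
        using scaled_in_ball[OF that _ elim(1)] h(1)[of n] by auto
      have \<rho>: "\<bar>\<rho> (\<Delta> (x + h n *\<^sub>R z))\<bar> \<le> \<eta> * (h' n * R)\<^sup>2 * I1" if nz: "norm z \<le> R" for z
        unfolding \<rho>_def I1_def
      proof (rule J_second_order[OF h'(1)])
        fix u assume u: "\<bar>u - (\<epsilon> - \<Delta> (x + h n *\<^sub>R z))\<bar> \<le> h' n * R"
        have "\<bar>\<Delta> (x + h n *\<^sub>R z)\<bar> \<le> C * norm (h n *\<^sub>R z)" by (rule \<Delta>_lip[OF z(1)[OF nz]])
        also have "\<dots> \<le> C * (h n * R)" using z(2)[OF nz] C by (intro mult_left_mono) auto
        finally have "\<bar>u - \<epsilon>\<bar> < \<delta>" using u elim by linarith
        then show "\<bar>(deriv ^^ 2) f u - (deriv ^^ 2) f \<epsilon>\<bar> \<le> \<eta>" using \<delta>(2)[of u] by (simp add: dist_real_def)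
      qed
      have g: "\<bar>g (x + h n *\<^sub>R z)\<bar> \<le> Gm" if "norm z \<le> R" for z
        unfolding Gm_def by (rule g_bound[OF z(1)[OF that]])
      have \<rho>g: "\<bar>g (x + h n *\<^sub>R z) * \<rho> (\<Delta> (x + h n *\<^sub>R z))\<bar> \<le> Gm * (\<eta> * (h' n * R)\<^sup>2 * I1)" if "norm z \<le> R" for z
        unfolding abs_mult using g[OF that] \<rho>[OF that] nn \<eta> by (intro mult_mono) auto
      have Hg: "\<bar>g (x + h n *\<^sub>R z) * H (x + h n *\<^sub>R z)\<bar> \<le> Gm * (A1 * r)" if "norm z \<le> R" for z
      proof -
        have "\<bar>H (x + h n *\<^sub>R z)\<bar> \<le> A1 * r"
          using A1(2)[OF z(1)[OF that]] mult_left_mono[OF less_imp_le[OF z(1)[OF that]], of A1] A1(1) by linarith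
        then show ?thesis unfolding abs_mult using g[OF that] nn by (intro mult_mono) auto
      qed
      have eq: "K0 z * (g (x + h n *\<^sub>R z) * J K1 (h' n) (\<Delta> (x + h n *\<^sub>R z))) =
          K0 z * (g (x + h n *\<^sub>R z) * \<rho> (\<Delta> (x + h n *\<^sub>R z))) + K0 z * (g (x + h n *\<^sub>R z) * H (x + h n *\<^sub>R z))
          + (f \<epsilon> + (h' n)\<^sup>2 * f_bias) * (K0 z * g (x + h n *\<^sub>R z))" for z
        by (simp add: \<rho>_def H_def algebra_simps)
      note i = integrable_K0_times(1)[OF _ \<rho>g] integrable_K0_times(1)[OF _ Hg] integrable_K0_times(1)[OF _ g]
      have "num_mean (h n) (h' n) = (\<integral>z. K0 z * (g (x + h n *\<^sub>R z) * \<rho> (\<Delta> (x + h n *\<^sub>R z))) \<partial>lborel)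
          + (\<integral>z. K0 z * (g (x + h n *\<^sub>R z) * H (x + h n *\<^sub>R z)) \<partial>lborel) + dens_mean (h n) * (f \<epsilon> + (h' n)\<^sup>2 * f_bias)"
        unfolding num_mean_def dens_mean_def eq using i by (simp add: mult.commute)
      moreover have "\<bar>\<integral>z. K0 z * (g (x + h n *\<^sub>R z) * \<rho> (\<Delta> (x + h n *\<^sub>R z))) \<partial>lborel\<bar> \<le> Gm * (\<eta> * (h' n * R)\<^sup>2 * I1) * I0"
        unfolding I0_def by (rule integrable_K0_times(2)[OF _ \<rho>g]) auto
      moreover have "Gm * (\<eta> * (h' n * R)\<^sup>2 * I1) * I0 = (\<eta> * T) * (h' n)\<^sup>2"
        by (simp add: T_def power_mult_distrib)
      moreover have "(\<eta> * T) * (h' n)\<^sup>2 \<le> e * (h' n)\<^sup>2" using \<eta> by (intro mult_right_mono) auto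
      moreover have "\<bar>\<integral>z. K0 z * (g (x + h n *\<^sub>R z) * H (x + h n *\<^sub>R z)) \<partial>lborel\<bar> \<le> A * (h n)\<^sup>2"
        by (rule A(2)[OF h(1) elim(1)])
      ultimately show ?case by linarith
    qed
  qed
qed

end

section \<open>The kernel density and Nadaraya--Watson estimators\<close>

context regression_at begin

definition dens_est :: "real \<Rightarrow> nat \<Rightarrow> 'w \<Rightarrow> real" where
  "dens_est h n w = (\<Sum>i=1..n. K0 ((X i w - x) /\<^sub>R h) / h ^ CARD('d)) / real n"

lemma dens_est_measurable [measurable]: "dens_est h n \<in> borel_measurable M"
  unfolding dens_est_def by measurable

lemma dens_mean_eq: "h > 0 \<Longrightarrow> expectation (\<lambda>w. K0 ((X 0 w - x) /\<^sub>R h) / h ^ CARD('d)) = dens_mean h"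
  using expectation_X[where F = "\<lambda>u. K0 ((u - x) /\<^sub>R h)" and h = h] by (simp add: dens_mean_def)

lemma dens_mean_tendsto:
  assumes h: "\<And>n. h n > 0" "h \<longlonglongrightarrow> 0"
  shows "(\<lambda>n. dens_mean (h n)) \<longlonglongrightarrow> g x"
  using marginal_limit[OF K0(1) h] dens_mean_eq[OF h(1)] K0(3) by simp

lemma pair_meas: "(\<lambda>z. q (fst z) (snd z)) \<in> borel_measurable borel"
  if "(\<lambda>(u, y). q u y) \<in> borel_measurable (borel \<Otimes>\<^sub>M borel)" for q :: "real^'d \<Rightarrow> real \<Rightarrow> real"
  using that unfolding borel_prod[symmetric] by (simp add: case_prod_beta')

lemma K0_bounded: obtains B where "B \<ge> 0" "\<And>z. \<bar>K0 z\<bar> \<le> B"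
  using K0(1) unfolding ball_kernel_def bounded_iff
  by (metis abs_ge_zero order_trans rangeI real_norm_def)

lemma K1_bounded: obtains B where "B \<ge> 0" "\<And>z. \<bar>K1 z\<bar> \<le> B"
  using K1(1) unfolding ball_kernel_def bounded_iff
  by (metis abs_ge_zero order_trans rangeI real_norm_def)

lemma dens_est_consistent:
  assumes h: "\<And>n. h n > 0" "h \<longlonglongrightarrow> 0" and nh: "filterlim (\<lambda>n. real n * h n ^ CARD('d)) at_top sequentially"
  shows "vanishes_in_prob M (\<lambda>n w. dens_est (h n) n w - g x)"
proof -
  obtain B where B: "B \<ge> 0" "\<And>z. \<bar>K0 z\<bar> \<le> B" using K0_bounded by blast
  define q where "q n z = K0 ((fst z - x) /\<^sub>R h n) / h n ^ CARD('d)" for n and z :: "(real^'d) \<times> real"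
  have q: "q n \<in> borel_measurable borel" for n
    unfolding q_def by (rule pair_meas[where q = "\<lambda>u y. K0 ((u - x) /\<^sub>R h n) / h n ^ CARD('d)"]) simp
  have sq: "integrable M (\<lambda>w. (q n (X 0 w, Y 0 w))\<^sup>2)" for n
  proof (rule integrable_const_bound[where B = "(B / h n ^ CARD('d))\<^sup>2"])
    show "AE w in M. norm ((q n (X 0 w, Y 0 w))\<^sup>2) \<le> (B / h n ^ CARD('d))\<^sup>2"
      using B h(1)[of n] by (auto simp: q_def abs_le_square_iff[symmetric] divide_right_mono)
  qed (simp add: q_def)
  have "vanishes_in_prob M (\<lambda>n w. dens_est (h n) n w - dens_mean (h n))"
  proof (rule vanishes_of_L2)
    have eq: "dens_est (h n) n w - dens_mean (h n) =
       (\<Sum>i=1..n. q n (X i w, Y i w)) / n - expectation (\<lambda>w. q n (X 0 w, Y 0 w))" for n w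
      using dens_mean_eq[OF h(1)[of n]] by (simp add: q_def dens_est_def)
    show "\<forall>\<^sub>F n in sequentially. integrable M (\<lambda>w. (dens_est (h n) n w - dens_mean (h n))\<^sup>2)"
      unfolding eq using iid_average_L2(1)[OF iid q sq] by simp
    show "(\<lambda>n. expectation (\<lambda>w. (dens_est (h n) n w - dens_mean (h n))\<^sup>2)) \<longlonglongrightarrow> 0"
    proof (rule tendsto_sandwich[OF _ _ tendsto_const])
      define e where "e n = expectation (\<lambda>w. (K0 ((X 0 w - x) /\<^sub>R h n))\<^sup>2) / h n ^ CARD('d)" for n
      show "\<forall>\<^sub>F n in sequentially. expectation (\<lambda>w. (dens_est (h n) n w - dens_mean (h n))\<^sup>2)
          \<le> e n * inverse (real n * h n ^ CARD('d))"
        using eventually_ge_at_top[of 1]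
      proof eventually_elim
        case (elim n)
        have "expectation (\<lambda>w. (q n (X 0 w, Y 0 w))\<^sup>2) / n = e n * inverse (real n * h n ^ CARD('d))"
          using elim h(1)[of n] by (simp add: q_def e_def power_divide power2_eq_square field_simps)
        then show ?case
          unfolding eq using iid_average_L2(2)[OF iid q sq elim, of n] by linarith
      qed
      have "e \<longlonglongrightarrow> g x * (\<integral>z. (K0 z)\<^sup>2 \<partial>lborel)"
        unfolding e_def by (rule marginal_limit[OF ball_kernel_power2[OF K0(1)] h])
      from tendsto_mult[OF this tendsto_inverse_0_at_top[OF nh]]
      show "(\<lambda>n. e n * inverse (real n * h n ^ CARD('d))) \<longlonglongrightarrow> 0" by simp
    qed simp
  qed simp
  moreover have "vanishes_in_prob M (\<lambda>n w. dens_mean (h n) - g x)"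
    using dens_mean_tendsto[OF h] by (intro vanishes_deterministic) (simp add: LIM_zero)
  ultimately have "vanishes_in_prob M (\<lambda>n w. (dens_est (h n) n w - dens_mean (h n)) + (dens_mean (h n) - g x))"
    by (rule vanishes_add)
  then show ?thesis by simp
qed

text \<open>The numerator of the Nadaraya--Watson estimation error at \<open>x\<close>, normalised as a density estimator.\<close>

definition nw_num :: "real \<Rightarrow> nat \<Rightarrow> 'w \<Rightarrow> real" where
  "nw_num b n w = (\<Sum>i=1..n. (Y i w - m x) * K0 ((X i w - x) /\<^sub>R b) / b ^ CARD('d)) / real n"

lemma nw_num_measurable [measurable]: "nw_num b n \<in> borel_measurable M"
  unfolding nw_num_def by measurable

lemma expectation_err_K0:
  fixes q :: "real \<Rightarrow> real" and p :: "real^'d \<Rightarrow> real"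
  assumes [measurable]: "q \<in> borel_measurable borel" and p: "ball_kernel R p"
    and i: "integrable M (\<lambda>w. q (err 0 w))"
  shows "integrable M (\<lambda>w. q (err 0 w) * p ((X 0 w - x) /\<^sub>R b))"
    and "expectation (\<lambda>w. q (err 0 w) * p ((X 0 w - x) /\<^sub>R b)) =
      expectation (\<lambda>w. q (err 0 w)) * expectation (\<lambda>w. p ((X 0 w - x) /\<^sub>R b))"
proof -
  have [measurable]: "p \<in> borel_measurable borel" using p by (simp add: ball_kernel_def)
  obtain B where B: "\<And>z. \<bar>p z\<bar> \<le> B" using p by (auto simp: ball_kernel_def bounded_iff)
  show I: "integrable M (\<lambda>w. q (err 0 w) * p ((X 0 w - x) /\<^sub>R b))"
  proof (rule Bochner_Integration.integrable_bound[OF integrable_mult_right[OF integrable_abs[OF i], of B]])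
    show "AE w in M. norm (q (err 0 w) * p ((X 0 w - x) /\<^sub>R b)) \<le> norm (B * \<bar>q (err 0 w)\<bar>)"
    proof (rule AE_I2)
      fix w
      have "\<bar>q (err 0 w)\<bar> * \<bar>p ((X 0 w - x) /\<^sub>R b)\<bar> \<le> \<bar>q (err 0 w)\<bar> * \<bar>B\<bar>"
        by (intro mult_left_mono order_trans[OF B abs_ge_self]) auto
      then show "norm (q (err 0 w) * p ((X 0 w - x) /\<^sub>R b)) \<le> norm (B * \<bar>q (err 0 w)\<bar>)"
        by (simp add: abs_mult mult.commute)
    qed
  qed simp
  have "expectation (\<lambda>w. q (err 0 w) * p ((X 0 w - x) /\<^sub>R b)) =
      expectation (\<lambda>w. \<integral>w'. q (err 0 w') * p ((X 0 w - x) /\<^sub>R b) \<partial>M)"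
    by (rule expectation_X_err[where W = "\<lambda>u e. q e * p ((u - x) /\<^sub>R b)"]) (use I in auto)
  then show "expectation (\<lambda>w. q (err 0 w) * p ((X 0 w - x) /\<^sub>R b)) =
      expectation (\<lambda>w. q (err 0 w)) * expectation (\<lambda>w. p ((X 0 w - x) /\<^sub>R b))"
    by simp
qed

lemma err_integrable: "integrable M (err 0)"
  by (rule square_integrable_imp_integrable[OF _ err_sq]) simp

lemma \<Delta>_times_K0_bound:
  assumes b: "b > 0" "b * R < r"
  shows "\<bar>\<Delta> u * K0 ((u - x) /\<^sub>R b)\<bar> \<le> C * r * \<bar>K0 ((u - x) /\<^sub>R b)\<bar>"
proof (cases "norm ((u - x) /\<^sub>R b) \<le> R")
  case True
  then have "norm (u - x) / b \<le> R" using b unfolding norm_scaleR by (simp add: divide_inverse mult.commute)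
  then have "norm (u - x) \<le> b * R" using b by (simp add: divide_le_eq mult.commute)
  then have u: "norm (u - x) < r" using b by linarith
  have "\<bar>\<Delta> (x + (u - x))\<bar> \<le> C * norm (u - x)" by (rule \<Delta>_lip[OF u])
  also have "\<dots> \<le> C * r" using u C by simp
  finally show ?thesis unfolding abs_mult by (intro mult_right_mono) auto
next
  case False
  then show ?thesis using K0 by (simp add: ball_kernel_def)
qed

text \<open>The mean is \<open>O(b\<^sup>2)\<close> since the errors are centred and independent of \<open>X\<close>, and the variance is
  \<open>O(1/(n b\<^sup>d))\<close>.\<close>

lemma nw_num_vanishes:
  assumes b: "\<And>n. b n > 0" "b \<longlonglongrightarrow> 0"
    and var: "(\<lambda>n. (\<rho> n)\<^sup>2 / (real n * b n ^ CARD('d))) \<longlonglongrightarrow> 0"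
    and bias: "(\<lambda>n. \<rho> n * (b n)\<^sup>2) \<longlonglongrightarrow> 0"
  shows "vanishes_in_prob M (\<lambda>n w. \<rho> n * nw_num (b n) n w)"
proof -
  define q where "q n z = (snd z - m x) * K0 ((fst z - x) /\<^sub>R b n) / b n ^ CARD('d)" for n and z :: "(real^'d) \<times> real"
  have q[measurable]: "q n \<in> borel_measurable borel" for n
    unfolding q_def by (rule pair_meas[where q = "\<lambda>u y. (y - m x) * K0 ((u - x) /\<^sub>R b n) / b n ^ CARD('d)"]) simp
  define e where "e n = expectation (\<lambda>w. q n (X 0 w, Y 0 w))" for n
  obtain A where A: "A \<ge> 0" "\<And>h. h > 0 \<Longrightarrow> h * R < r \<Longrightarrow>
      \<bar>\<integral>z. K0 z * (g (x + h *\<^sub>R z) * \<Delta> (x + h *\<^sub>R z)) \<partial>lborel\<bar> \<le> A * h\<^sup>2"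
    using symmetric_smoothing_bound[OF \<Delta>_measurable order_refl \<Delta>_lip \<Delta>_sym] by blast
  obtain B where B: "B \<ge> 0" "\<And>z. \<bar>K0 z\<bar> \<le> B" using K0_bounded by blast
  define s where "s = 2 * ((C * r)\<^sup>2 + expectation (\<lambda>w. (err 0 w)\<^sup>2))"
  define k where "k n = expectation (\<lambda>w. (K0 ((X 0 w - x) /\<^sub>R b n))\<^sup>2) / b n ^ CARD('d)" for n
  have k: "k \<longlonglongrightarrow> g x * (\<integral>z. (K0 z)\<^sup>2 \<partial>lborel)"
    unfolding k_def by (rule marginal_limit[OF ball_kernel_power2[OF K0(1)] b])
  have qeq: "q n (X 0 w, Y 0 w) = (\<Delta> (X 0 w) * K0 ((X 0 w - x) /\<^sub>R b n) + err 0 w * K0 ((X 0 w - x) /\<^sub>R b n)) / b n ^ CARD('d)" for n w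
    by (simp add: q_def \<Delta>_def model algebra_simps)
  have fin: "\<bar>e n\<bar> \<le> A * (b n)\<^sup>2" "integrable M (\<lambda>w. (q n (X 0 w, Y 0 w))\<^sup>2)"
     "expectation (\<lambda>w. (q n (X 0 w, Y 0 w))\<^sup>2) \<le> s * k n / b n ^ CARD('d)" if small: "b n * R < r" for n
  proof -
    let ?K = "\<lambda>w. K0 ((X 0 w - x) /\<^sub>R b n)"
    note E1 = expectation_err_K0[OF _ K0(1), of "\<lambda>e. e" "b n"]
    note E2 = expectation_err_K0[OF _ ball_kernel_power2[OF K0(1)], of "\<lambda>e. e\<^sup>2" "b n"]
    have iK2: "integrable M (\<lambda>w. (?K w)\<^sup>2)"
      using B by (intro integrable_const_bound[where B = "B\<^sup>2"]) (auto simp: abs_le_square_iff[symmetric])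
    have i\<Delta>: "integrable M (\<lambda>w. \<Delta> (X 0 w) * ?K w)"
    proof (rule integrable_const_bound[where B = "C * r * B"])
      show "AE w in M. norm (\<Delta> (X 0 w) * ?K w) \<le> C * r * B"
      proof (rule AE_I2)
        fix w
        have "\<bar>\<Delta> (X 0 w) * ?K w\<bar> \<le> C * r * \<bar>?K w\<bar>" by (rule \<Delta>_times_K0_bound[OF b(1) small])
        also have "\<dots> \<le> C * r * B" using B C r by (intro mult_left_mono) auto
        finally show "norm (\<Delta> (X 0 w) * ?K w) \<le> C * r * B" by simp
      qed
    qed simp
    have "e n = (expectation (\<lambda>w. \<Delta> (X 0 w) * ?K w) + 0) / b n ^ CARD('d)"
      unfolding e_def qeq using i\<Delta> E1 err_integrable err_mean by simp
    also have "expectation (\<lambda>w. \<Delta> (X 0 w) * ?K w) =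
        b n ^ CARD('d) * (\<integral>z. K0 z * (g (x + b n *\<^sub>R z) * \<Delta> (x + b n *\<^sub>R z)) \<partial>lborel)"
      using expectation_X[where F = "\<lambda>u. \<Delta> u * K0 ((u - x) /\<^sub>R b n)" and h = "b n"] b(1)[of n]
      by (simp add: ac_simps)
    finally have "e n = (\<integral>z. K0 z * (g (x + b n *\<^sub>R z) * \<Delta> (x + b n *\<^sub>R z)) \<partial>lborel)"
      using b(1)[of n] by simp
    then show "\<bar>e n\<bar> \<le> A * (b n)\<^sup>2" using A(2)[OF b(1) small] by simp
    define S where "S w = 2 * (C * r)\<^sup>2 * (?K w)\<^sup>2 + 2 * ((err 0 w)\<^sup>2 * (?K w)\<^sup>2)" for w
    have iS: "integrable M S" unfolding S_def using iK2 E2(1) err_sq by simp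
    have dom: "(q n (X 0 w, Y 0 w))\<^sup>2 \<le> S w / (b n ^ CARD('d))\<^sup>2" for w
    proof -
      have sq: "(\<alpha> + \<beta>)\<^sup>2 \<le> 2 * \<alpha>\<^sup>2 + 2 * \<beta>\<^sup>2" for \<alpha> \<beta> :: real
        using zero_le_power2[of "\<alpha> - \<beta>"] by (simp add: power2_sum power2_diff)
      have "\<bar>\<Delta> (X 0 w) * ?K w\<bar>\<^sup>2 \<le> (C * r * \<bar>?K w\<bar>)\<^sup>2"
        by (intro power_mono \<Delta>_times_K0_bound[OF b(1) small]) auto
      then have "(\<Delta> (X 0 w) * ?K w)\<^sup>2 \<le> (C * r)\<^sup>2 * (?K w)\<^sup>2" by (simp add: power_mult_distrib)
      then have "(\<Delta> (X 0 w) * ?K w + err 0 w * ?K w)\<^sup>2 \<le> S w"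
        using sq[of "\<Delta> (X 0 w) * ?K w" "err 0 w * ?K w"] by (simp add: S_def power_mult_distrib)
      then show ?thesis unfolding qeq power_divide by (intro divide_right_mono) auto
    qed
    show iq: "integrable M (\<lambda>w. (q n (X 0 w, Y 0 w))\<^sup>2)"
    proof (rule Bochner_Integration.integrable_bound)
      show "integrable M (\<lambda>w. S w / (b n ^ CARD('d))\<^sup>2)" using iS by simp
      show "AE w in M. norm ((q n (X 0 w, Y 0 w))\<^sup>2) \<le> norm (S w / (b n ^ CARD('d))\<^sup>2)"
      proof (rule AE_I2)
        fix w show "norm ((q n (X 0 w, Y 0 w))\<^sup>2) \<le> norm (S w / (b n ^ CARD('d))\<^sup>2)"
          using order_trans[OF dom abs_ge_self, of w] unfolding real_norm_def by simp
      qed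
    qed (simp add: q_def)
    have "expectation (\<lambda>w. (q n (X 0 w, Y 0 w))\<^sup>2) \<le> expectation (\<lambda>w. S w / (b n ^ CARD('d))\<^sup>2)"
      using iq iS dom by (intro integral_mono) auto
    also have "\<dots> = s * expectation (\<lambda>w. (?K w)\<^sup>2) / (b n ^ CARD('d))\<^sup>2"
      unfolding S_def s_def using iK2 E2 err_sq by (simp add: algebra_simps)
    also have "\<dots> = s * k n / b n ^ CARD('d)"
      using b(1)[of n] by (simp add: k_def power2_eq_square)
    finally show "expectation (\<lambda>w. (q n (X 0 w, Y 0 w))\<^sup>2) \<le> s * k n / b n ^ CARD('d)" .
  qed
  have num: "nw_num (b n) n w = (\<Sum>i=1..n. q n (X i w, Y i w)) / n" for n w
    by (simp add: nw_num_def q_def)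
  have "vanishes_in_prob M (\<lambda>n w. \<rho> n * (nw_num (b n) n w - e n))"
  proof (rule vanishes_of_L2)
    show "\<forall>\<^sub>F n in sequentially. integrable M (\<lambda>w. (\<rho> n * (nw_num (b n) n w - e n))\<^sup>2)"
      using eventually_small[OF b(2)]
    proof eventually_elim
      case (elim n)
      from iid_average_L2(1)[OF iid q fin(2)[OF elim], of n] show ?case
        by (simp add: power_mult_distrib num e_def)
    qed
    show "(\<lambda>n. expectation (\<lambda>w. (\<rho> n * (nw_num (b n) n w - e n))\<^sup>2)) \<longlonglongrightarrow> 0"
    proof (rule tendsto_sandwich[OF _ _ tendsto_const])
      show "\<forall>\<^sub>F n in sequentially. expectation (\<lambda>w. (\<rho> n * (nw_num (b n) n w - e n))\<^sup>2)
          \<le> s * k n * ((\<rho> n)\<^sup>2 / (real n * b n ^ CARD('d)))"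
        using eventually_small[OF b(2)] eventually_ge_at_top[of 1]
      proof eventually_elim
        case (elim n)
        have "expectation (\<lambda>w. (\<rho> n * (nw_num (b n) n w - e n))\<^sup>2) =
           (\<rho> n)\<^sup>2 * expectation (\<lambda>w. (nw_num (b n) n w - e n)\<^sup>2)"
          by (simp add: power_mult_distrib)
        also have "\<dots> \<le> (\<rho> n)\<^sup>2 * ((s * k n / b n ^ CARD('d)) / n)"
        proof (rule mult_left_mono)
          have "expectation (\<lambda>w. (nw_num (b n) n w - e n)\<^sup>2) \<le> expectation (\<lambda>w. (q n (X 0 w, Y 0 w))\<^sup>2) / n"
            unfolding num e_def by (rule iid_average_L2(2)[OF iid q fin(2)[OF elim(1)] elim(2)])
          also have "\<dots> \<le> (s * k n / b n ^ CARD('d)) / n"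
            by (intro divide_right_mono fin(3) elim) auto
          finally show "expectation (\<lambda>w. (nw_num (b n) n w - e n)\<^sup>2) \<le> (s * k n / b n ^ CARD('d)) / n" .
        qed simp
        finally show ?case by (simp add: ac_simps)
      qed
      show "(\<lambda>n. s * k n * ((\<rho> n)\<^sup>2 / (real n * b n ^ CARD('d)))) \<longlonglongrightarrow> 0"
        using tendsto_mult[OF tendsto_mult[OF tendsto_const k, of s] var] by simp
    qed simp
  qed simp
  moreover have "vanishes_in_prob M (\<lambda>n w. \<rho> n * e n)"
  proof (rule vanishes_deterministic, rule Lim_null_comparison)
    show "\<forall>\<^sub>F n in sequentially. norm (\<rho> n * e n) \<le> A * \<bar>\<rho> n * (b n)\<^sup>2\<bar>"
      using eventually_small[OF b(2)]
    proof eventually_elim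
      case (elim n)
      have "\<bar>\<rho> n\<bar> * \<bar>e n\<bar> \<le> \<bar>\<rho> n\<bar> * (A * (b n)\<^sup>2)" by (intro mult_left_mono fin(1) elim) auto
      then show ?case by (simp add: abs_mult ac_simps)
    qed
    show "(\<lambda>n. A * \<bar>\<rho> n * (b n)\<^sup>2\<bar>) \<longlonglongrightarrow> 0"
      using tendsto_mult[OF tendsto_const tendsto_rabs[OF bias], of A] by simp
  qed
  ultimately have "vanishes_in_prob M (\<lambda>n w. \<rho> n * (nw_num (b n) n w - e n) + \<rho> n * e n)"
    by (rule vanishes_add)
  then show ?thesis by (simp add: algebra_simps)
qed

lemma dens_est_bounded_below:
  assumes "vanishes_in_prob M (\<lambda>n w. dens_est (h n) n w - g x)"
  shows "whp M (\<lambda>n w. dens_est (h n) n w \<ge> g x / 2)"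
proof -
  have "whp M (\<lambda>n w. \<bar>dens_est (h n) n w - g x\<bar> \<le> g x / 2)"
    using assms half_gt_zero[OF gx] unfolding vanishes_in_prob_def by blast
  then show ?thesis by (rule whp_mono, intro always_eventually allI ballI impI) linarith
qed

lemma inverse_dens_est_bounded:
  assumes "vanishes_in_prob M (\<lambda>n w. dens_est (h n) n w - g x)"
  shows "whp M (\<lambda>n w. \<bar>1 / dens_est (h n) n w\<bar> \<le> 2 / g x)"
  using dens_est_bounded_below[OF assms]
proof (rule whp_mono, intro always_eventually allI ballI impI)
  fix n w assume "g x / 2 \<le> dens_est (h n) n w"
  then have "1 / dens_est (h n) n w \<le> 1 / (g x / 2)" "dens_est (h n) n w > 0"
    using gx by (auto simp: field_simps)
  then show "\<bar>1 / dens_est (h n) n w\<bar> \<le> 2 / g x" by simp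
qed

lemma nw_estimator_eq:
  assumes "dens_est b n w \<noteq> 0" "b > 0"
  shows "nw_estimator K0 b X Y n x w - m x = nw_num b n w / dens_est b n w"
proof -
  let ?S = "\<Sum>i=1..n. K0 ((X i w - x) /\<^sub>R b)"
  have D: "dens_est b n w = ?S / (b ^ CARD('d) * real n)"
    by (simp add: dens_est_def sum_divide_distrib[symmetric])
  then have S: "?S \<noteq> 0" "real n \<noteq> 0" using assms by auto
  have N: "nw_num b n w = ((\<Sum>i=1..n. Y i w * K0 ((X i w - x) /\<^sub>R b)) - m x * ?S) / (b ^ CARD('d) * real n)"
    by (simp add: nw_num_def sum_divide_distrib[symmetric] left_diff_distrib sum_subtractf sum_distrib_left)
  show ?thesis unfolding D N nw_estimator_def using S assms(2) by (simp add: field_simps)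
qed

lemma nw_estimator_rate:
  assumes b: "\<And>n. b n > 0" "b \<longlonglongrightarrow> 0"
    and nb: "filterlim (\<lambda>n. real n * b n ^ CARD('d)) at_top sequentially"
    and var: "(\<lambda>n. (\<rho> n)\<^sup>2 / (real n * b n ^ CARD('d))) \<longlonglongrightarrow> 0"
    and bias: "(\<lambda>n. \<rho> n * (b n)\<^sup>2) \<longlonglongrightarrow> 0"
  shows "vanishes_in_prob M (\<lambda>n w. \<rho> n * (nw_estimator K0 (b n) X Y n x w - m x))"
proof (rule vanishes_cong_whp)
  note D = dens_est_consistent[OF b nb]
  show "vanishes_in_prob M (\<lambda>n w. \<rho> n * nw_num (b n) n w * (1 / dens_est (b n) n w))"
    by (rule vanishes_mult_bounded[OF nw_num_vanishes[OF b var bias] inverse_dens_est_bounded[OF D]])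
  show "whp M (\<lambda>n w. \<rho> n * (nw_estimator K0 (b n) X Y n x w - m x) = \<rho> n * nw_num (b n) n w * (1 / dens_est (b n) n w))"
    using dens_est_bounded_below[OF D]
  proof (rule whp_mono, intro always_eventually allI ballI impI)
    fix n w assume "g x / 2 \<le> dens_est (b n) n w"
    then have "dens_est (b n) n w \<noteq> 0" using gx by auto
    from nw_estimator_eq[OF this b(1)]
    show "\<rho> n * (nw_estimator K0 (b n) X Y n x w - m x) = \<rho> n * nw_num (b n) n w * (1 / dens_est (b n) n w)"
      by simp
  qed
qed

end

section \<open>The plug-in error\<close>

context regression_at begin

definition num_est :: "real \<Rightarrow> real \<Rightarrow> real \<Rightarrow> nat \<Rightarrow> 'w \<Rightarrow> real" where
  "num_est h h' t n w =
     (\<Sum>i=1..n. K0 ((X i w - x) /\<^sub>R h) * K1 ((Y i w - t - \<epsilon>) / h') / (h ^ CARD('d) * h')) / real n"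

text \<open>The share of observations within the window in which \<open>K1\<close> can react to a change of the centre,
  weighted by \<open>K0\<close>; it dominates the increments of \<open>num_est\<close> in its centre.\<close>

definition window_est :: "real \<Rightarrow> real \<Rightarrow> nat \<Rightarrow> 'w \<Rightarrow> real" where
  "window_est h h' n w = (\<Sum>i=1..n. \<bar>K0 ((X i w - x) /\<^sub>R h)\<bar> *
      indicator {-R..R} ((Y i w - m x - \<epsilon>) / h') / (h ^ CARD('d) * h')) / real n"

lemma cond_pdf_estimator_eq:
  assumes "h > 0" "h' > 0"
  shows "cond_pdf_estimator K0 K1 b h h' X Y n \<epsilon> x w =
    num_est h h' (nw_estimator K0 b X Y n x w) n w / dens_est h n w"
  by (simp add: cond_pdf_estimator_def num_est_def dens_est_def sum_divide_distrib[symmetric])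

text \<open>The shift of the argument of \<open>K1\<close> is at most one, so by the margin in the support of \<open>K1\<close> only
  observations in the window contribute, each by at most the Lipschitz bound.\<close>

lemma num_est_perturb:
  assumes h: "h > 0" "h' > 0" and t: "\<bar>t - m x\<bar> \<le> h'"
  shows "\<bar>num_est h h' t n w - num_est h h' (m x) n w\<bar> \<le> L * (\<bar>t - m x\<bar> / h') * window_est h h' n w"
proof -
  let ?K = "\<lambda>i. K0 ((X i w - x) /\<^sub>R h)"
  let ?a = "\<lambda>i. (Y i w - t - \<epsilon>) / h'" and ?b = "\<lambda>i. (Y i w - m x - \<epsilon>) / h'"
  let ?h = "h ^ CARD('d) * h'"
  have hh: "?h > 0" using h by simp
  have K: "\<bar>K1 (?a i) - K1 (?b i)\<bar> \<le> L * (\<bar>t - m x\<bar> / h') * indicator {-R..R} (?b i)" for i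
  proof -
    have "?a i - ?b i = - (t - m x) / h'" by (simp add: diff_divide_distrib)
    then have ab: "\<bar>?a i - ?b i\<bar> = \<bar>t - m x\<bar> / h'" using h by simp
    show ?thesis
    proof (cases "\<bar>?b i\<bar> \<le> R")
      case True
      then have "?b i \<in> {-R..R}" unfolding atLeastAtMost_iff abs_le_iff by linarith
      then show ?thesis using L(2)[of "?a i" "?b i"] ab by simp
    next
      case False
      moreover have "\<bar>?a i - ?b i\<bar> \<le> 1" unfolding ab using t h by simp
      ultimately have "\<bar>?a i\<bar> > R - 1" "\<bar>?b i\<bar> > R - 1" by linarith+
      then have "K1 (?a i) = 0" "K1 (?b i) = 0" by (auto intro: K1_margin)
      then show ?thesis using L(1) h by simp
    qed
  qed
  have eq: "num_est h h' t n w - num_est h h' (m x) n w = (\<Sum>i=1..n. ?K i * (K1 (?a i) - K1 (?b i)) / ?h) / n"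
    by (simp add: num_est_def sum_subtractf[symmetric] diff_divide_distrib[symmetric] right_diff_distrib)
  have "\<bar>num_est h h' t n w - num_est h h' (m x) n w\<bar> \<le> (\<Sum>i=1..n. \<bar>?K i * (K1 (?a i) - K1 (?b i)) / ?h\<bar>) / n"
    unfolding eq abs_divide[of _ "real n"] abs_of_nat by (intro divide_right_mono sum_abs) simp
  also have "\<dots> \<le> (\<Sum>i=1..n. L * (\<bar>t - m x\<bar> / h') * (\<bar>?K i\<bar> * indicator {-R..R} (?b i) / ?h)) / n"
  proof (intro divide_right_mono sum_mono)
    fix i
    have "\<bar>?K i\<bar> * \<bar>K1 (?a i) - K1 (?b i)\<bar> / ?h \<le> \<bar>?K i\<bar> * (L * (\<bar>t - m x\<bar> / h') * indicator {-R..R} (?b i)) / ?h"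
      using hh by (intro divide_right_mono mult_left_mono K) auto
    then show "\<bar>?K i * (K1 (?a i) - K1 (?b i)) / ?h\<bar> \<le> L * (\<bar>t - m x\<bar> / h') * (\<bar>?K i\<bar> * indicator {-R..R} (?b i) / ?h)"
      unfolding abs_divide abs_mult[of "?K i"] abs_of_pos[OF hh] by (simp add: ac_simps)
  qed simp
  also have "\<dots> = L * (\<bar>t - m x\<bar> / h') * window_est h h' n w"
    by (simp add: window_est_def sum_distrib_left)
  finally show ?thesis .
qed

lemma window_est_L1:
  assumes h: "\<And>n. h n > 0" "h \<longlonglongrightarrow> 0" and h': "\<And>n. h' n > 0" "h' \<longlonglongrightarrow> 0"
  obtains Q where "\<And>n. integrable M (window_est (h n) (h' n) n)"
    "\<forall>\<^sub>F n in sequentially. expectation (\<lambda>w. \<bar>window_est (h n) (h' n) n w\<bar>) \<le> Q"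
proof -
  let ?k = "\<lambda>v. indicator {-R..R} v :: real"
  have k: "ball_kernel R ?k" by (auto simp: ball_kernel_def bounded_iff indicator_def)
  obtain B where B: "B \<ge> 0" "\<And>z. \<bar>K0 z\<bar> \<le> B" using K0_bounded by blast
  define q where "q n z = \<bar>K0 ((fst z - x) /\<^sub>R h n)\<bar> * ?k ((snd z - m x - \<epsilon>) / h' n) / (h n ^ CARD('d) * h' n)"
    for n and z :: "(real^'d) \<times> real"
  have q: "q n \<in> borel_measurable borel" for n
    unfolding q_def by (rule pair_meas[where q = "\<lambda>u y. \<bar>K0 ((u - x) /\<^sub>R h n)\<bar> * ?k ((y - m x - \<epsilon>) / h' n) / (h n ^ CARD('d) * h' n)"]) simp
  have i0: "integrable M (\<lambda>w. q n (X 0 w, Y 0 w))" for n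
  proof (rule integrable_const_bound[where B = "B / (h n ^ CARD('d) * h' n)"])
    show "AE w in M. norm (q n (X 0 w, Y 0 w)) \<le> B / (h n ^ CARD('d) * h' n)"
      using B h(1)[of n] h'(1)[of n]
      by (auto simp: q_def indicator_def abs_of_pos intro!: divide_right_mono)
  qed (simp add: q_def)
  have i: "integrable M (\<lambda>w. q n (X j w, Y j w))" for n j
    using iid_transfer(2)[OF iid q, where i = j] i0 by simp
  have ex: "expectation (\<lambda>w. q n (X j w, Y j w)) = expectation (\<lambda>w. q n (X 0 w, Y 0 w))" for n j
    by (rule iid_transfer(1)[OF iid q])
  have W: "window_est (h n) (h' n) n = (\<lambda>w. (\<Sum>j=1..n. q n (X j w, Y j w)) / n)" for n
    by (simp add: window_est_def q_def fun_eq_iff)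
  have q0: "q n z \<ge> 0" for n z using h(1)[of n] h'(1)[of n] by (simp add: q_def)
  have lim: "(\<lambda>n. expectation (\<lambda>w. q n (X 0 w, Y 0 w))) \<longlonglongrightarrow> g x * f \<epsilon> * (\<integral>z. \<bar>K0 z\<bar> \<partial>lborel) * (\<integral>v. ?k v \<partial>lborel)"
    using joint_limit[OF ball_kernel_abs[OF K0(1)] k h h'] by (simp add: q_def)
  show ?thesis
  proof
    show "integrable M (window_est (h n) (h' n) n)" for n unfolding W using i by simp
    have "\<forall>\<^sub>F n in sequentially. expectation (\<lambda>w. q n (X 0 w, Y 0 w)) < g x * f \<epsilon> * (\<integral>z. \<bar>K0 z\<bar> \<partial>lborel) * (\<integral>v. ?k v \<partial>lborel) + 1"
      using lim by (rule order_tendstoD) simp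
    then show "\<forall>\<^sub>F n in sequentially. expectation (\<lambda>w. \<bar>window_est (h n) (h' n) n w\<bar>)
        \<le> g x * f \<epsilon> * (\<integral>z. \<bar>K0 z\<bar> \<partial>lborel) * (\<integral>v. ?k v \<partial>lborel) + 1"
      using eventually_ge_at_top[of 1]
    proof eventually_elim
      case (elim n)
      have "\<bar>window_est (h n) (h' n) n w\<bar> = (\<Sum>j=1..n. q n (X j w, Y j w)) / n" for w
        unfolding W using q0 by (intro abs_of_nonneg divide_nonneg_nonneg sum_nonneg) auto
      then have "expectation (\<lambda>w. \<bar>window_est (h n) (h' n) n w\<bar>) = (\<Sum>j=1..n. expectation (\<lambda>w. q n (X j w, Y j w))) / n"
        using i by simp
      also have "(\<Sum>j=1..n. expectation (\<lambda>w. q n (X j w, Y j w))) = (\<Sum>j=1..n. expectation (\<lambda>w. q n (X 0 w, Y 0 w)))"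
        by (intro sum.cong refl ex)
      finally show ?case using elim by simp
    qed
  qed
qed

text \<open>The increment is of order \<open>a n / h' n\<close> times the Nadaraya--Watson error, which vanishes. Since
  \<open>a n \<rightarrow> \<infinity>\<close>, the error is then also below \<open>h' n\<close>, as the perturbation bound demands.\<close>

lemma plug_in_negligible:
  assumes b: "\<And>n. b n > 0" "b \<longlonglongrightarrow> 0" and h: "\<And>n. h n > 0" "h \<longlonglongrightarrow> 0" and h': "\<And>n. h' n > 0" "h' \<longlonglongrightarrow> 0"
    and nb: "filterlim (\<lambda>n. real n * b n ^ CARD('d)) at_top sequentially"
    and a: "filterlim a at_top sequentially"
    and var: "(\<lambda>n. (a n / h' n)\<^sup>2 / (real n * b n ^ CARD('d))) \<longlonglongrightarrow> 0"
    and bias: "(\<lambda>n. a n / h' n * (b n)\<^sup>2) \<longlonglongrightarrow> 0"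
  shows "vanishes_in_prob M (\<lambda>n w. a n * (num_est (h n) (h' n) (nw_estimator K0 (b n) X Y n x w) n w
      - num_est (h n) (h' n) (m x) n w))"
proof -
  let ?t = "\<lambda>n w. nw_estimator K0 (b n) X Y n x w"
  obtain Q where Q: "\<And>n. integrable M (window_est (h n) (h' n) n)"
    "\<forall>\<^sub>F n in sequentially. expectation (\<lambda>w. \<bar>window_est (h n) (h' n) n w\<bar>) \<le> Q"
    using window_est_L1[OF h h'] by blast
  have rate: "vanishes_in_prob M (\<lambda>n w. a n / h' n * (?t n w - m x))"
    by (rule nw_estimator_rate[OF b nb var bias])
  have a1: "\<forall>\<^sub>F n in sequentially. a n \<ge> 1" using a by (simp add: filterlim_at_top)
  have close: "whp M (\<lambda>n w. \<bar>?t n w - m x\<bar> \<le> h' n)"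
  proof (rule whp_mono)
    show "whp M (\<lambda>n w. \<bar>a n / h' n * (?t n w - m x)\<bar> \<le> 1)"
      using rate unfolding vanishes_in_prob_def by simp
    show "\<forall>\<^sub>F n in sequentially. \<forall>w\<in>space M. \<bar>a n / h' n * (?t n w - m x)\<bar> \<le> 1 \<longrightarrow> \<bar>?t n w - m x\<bar> \<le> h' n"
      using a1
    proof (eventually_elim, intro ballI impI)
      fix n w assume a: "a n \<ge> 1" and le: "\<bar>a n / h' n * (?t n w - m x)\<bar> \<le> 1"
      have "\<bar>a n / h' n * (?t n w - m x)\<bar> = a n * \<bar>?t n w - m x\<bar> / h' n"
        using a h'(1)[of n] by (simp add: abs_mult)
      with le h'(1)[of n] have "a n * \<bar>?t n w - m x\<bar> \<le> h' n" by (simp add: divide_le_eq)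
      moreover have "1 * \<bar>?t n w - m x\<bar> \<le> a n * \<bar>?t n w - m x\<bar>" using a by (intro mult_right_mono) auto
      ultimately have "1 * \<bar>?t n w - m x\<bar> \<le> h' n" by (rule order_trans[rotated])
      then show "\<bar>?t n w - m x\<bar> \<le> h' n" by simp
    qed
  qed
  have "vanishes_in_prob M (\<lambda>n w. a n / h' n * (?t n w - m x) * L)"
    by (rule vanishes_mult_bounded[OF rate, where C = L]) (use L in \<open>auto intro!: whp_always\<close>)
  then have "vanishes_in_prob M (\<lambda>n w. (a n / h' n * (?t n w - m x) * L) * window_est (h n) (h' n) n w)"
    by (rule vanishes_mult_L1) (use Q in auto)
  then show ?thesis
  proof (rule vanishes_mono)
    show "whp M (\<lambda>n w. \<bar>a n * (num_est (h n) (h' n) (?t n w) n w - num_est (h n) (h' n) (m x) n w)\<bar>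
      \<le> \<bar>(a n / h' n * (?t n w - m x) * L) * window_est (h n) (h' n) n w\<bar>)"
      using close
    proof (rule whp_mono, intro always_eventually allI ballI impI)
      fix n w assume "\<bar>?t n w - m x\<bar> \<le> h' n"
      from num_est_perturb[OF h(1)[of n] h'(1)[of n] this, of n]
      have "\<bar>a n\<bar> * \<bar>num_est (h n) (h' n) (?t n w) n w - num_est (h n) (h' n) (m x) n w\<bar>
        \<le> \<bar>a n\<bar> * (L * (\<bar>?t n w - m x\<bar> / h' n) * window_est (h n) (h' n) n w)"
        by (intro mult_left_mono) auto
      also have "\<dots> \<le> \<bar>\<bar>a n\<bar> * (L * (\<bar>?t n w - m x\<bar> / h' n) * window_est (h n) (h' n) n w)\<bar>" by (rule abs_ge_self)
      also have "\<dots> = \<bar>(a n / h' n * (?t n w - m x) * L) * window_est (h n) (h' n) n w\<bar>"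
        using h'(1)[of n] by (simp add: abs_mult ac_simps)
      finally show "\<bar>a n * (num_est (h n) (h' n) (?t n w) n w - num_est (h n) (h' n) (m x) n w)\<bar>
      \<le> \<bar>(a n / h' n * (?t n w - m x) * L) * window_est (h n) (h' n) n w\<bar>" by (simp add: abs_mult)
    qed
  qed
qed

end

section \<open>Asymptotic normality\<close>

context regression_at begin

definition limit_variance :: real where
  "limit_variance = f \<epsilon> / g x * ((\<integral>z. (K0 z)\<^sup>2 \<partial>lborel) * (\<integral>v. (K1 v)\<^sup>2 \<partial>lborel))"

text \<open>The average of the summands is the numerator minus \<open>\<theta>\<close> times the denominator: centring inside the
  sum avoids treating the random denominator separately.\<close>

definition summand :: "real \<Rightarrow> real \<Rightarrow> real \<Rightarrow> (real^'d) \<times> real \<Rightarrow> real" where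
  "summand h h' \<theta> z = K0 ((fst z - x) /\<^sub>R h) * (K1 ((snd z - m x - \<epsilon>) / h') / h' - \<theta>) / h ^ CARD('d)"

lemma summand_measurable [measurable]: "summand h h' \<theta> \<in> borel_measurable borel"
  unfolding summand_def
  by (rule pair_meas[where q = "\<lambda>u y. K0 ((u - x) /\<^sub>R h) * (K1 ((y - m x - \<epsilon>) / h') / h' - \<theta>) / h ^ CARD('d)"]) simp

lemma num_mean_eq:
  assumes "h > 0" "h' > 0"
  shows "expectation (\<lambda>w. K0 ((X 0 w - x) /\<^sub>R h) * K1 ((Y 0 w - m x - \<epsilon>) / h')) / (h ^ CARD('d) * h') = num_mean h h'"
  using expectation_product_kernel[OF K0(1) K1(1) assms] assms by (simp add: num_mean_def)

lemma kernel_products_integrable: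
  assumes p: "ball_kernel R p" and k: "ball_kernel R k"
  shows "integrable M (\<lambda>w. p ((X 0 w - x) /\<^sub>R h) * k ((Y 0 w - m x - \<epsilon>) / h'))"
    and "integrable M (\<lambda>w. p ((X 0 w - x) /\<^sub>R h))"
proof -
  have [measurable]: "p \<in> borel_measurable borel" "k \<in> borel_measurable borel"
    using p k by (auto simp: ball_kernel_def)
  obtain B where B: "\<And>z. \<bar>p z\<bar> \<le> B" using p by (auto simp: ball_kernel_def bounded_iff)
  obtain B' where B': "\<And>z. \<bar>k z\<bar> \<le> B'" using k by (auto simp: ball_kernel_def bounded_iff)
  show "integrable M (\<lambda>w. p ((X 0 w - x) /\<^sub>R h))"
    using B by (intro integrable_const_bound[where B = B]) auto
  show "integrable M (\<lambda>w. p ((X 0 w - x) /\<^sub>R h) * k ((Y 0 w - m x - \<epsilon>) / h'))"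
  proof (rule integrable_const_bound[where B = "B * B'"], rule AE_I2)
    fix w
    show "norm (p ((X 0 w - x) /\<^sub>R h) * k ((Y 0 w - m x - \<epsilon>) / h')) \<le> B * B'"
      unfolding real_norm_def abs_mult
      using B[of "(X 0 w - x) /\<^sub>R h"] B'[of "(Y 0 w - m x - \<epsilon>) / h'"] by (intro mult_mono) auto
  qed simp
qed

lemma expectation_summand:
  assumes h: "h > 0" "h' > 0"
  shows "expectation (\<lambda>w. summand h h' \<theta> (X 0 w, Y 0 w)) = num_mean h h' - \<theta> * dens_mean h"
proof -
  have eq: "summand h h' \<theta> (X 0 w, Y 0 w) =
     K0 ((X 0 w - x) /\<^sub>R h) * K1 ((Y 0 w - m x - \<epsilon>) / h') / (h ^ CARD('d) * h') - \<theta> * (K0 ((X 0 w - x) /\<^sub>R h) / h ^ CARD('d))" for w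
    using h by (simp add: summand_def field_simps)
  let ?A = "\<lambda>w. K0 ((X 0 w - x) /\<^sub>R h) * K1 ((Y 0 w - m x - \<epsilon>) / h')" and ?B = "\<lambda>w. K0 ((X 0 w - x) /\<^sub>R h)"
  note i = kernel_products_integrable[OF K0(1) K1(1)]
  have "expectation (\<lambda>w. summand h h' \<theta> (X 0 w, Y 0 w)) =
      expectation (\<lambda>w. ?A w / (h ^ CARD('d) * h')) - expectation (\<lambda>w. \<theta> * (?B w / h ^ CARD('d)))"
    unfolding eq by (rule Bochner_Integration.integral_diff) (simp_all add: i)
  also have "expectation (\<lambda>w. ?A w / (h ^ CARD('d) * h')) = num_mean h h'"
    using num_mean_eq[OF h] by simp
  also have "expectation (\<lambda>w. \<theta> * (?B w / h ^ CARD('d))) = \<theta> * dens_mean h"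
    unfolding dens_mean_eq[OF h(1), symmetric] by (rule integral_mult_right_zero)
  finally show ?thesis .
qed

lemma summand_bound:
  obtains Q where "Q \<ge> 0" "\<And>h h' \<theta> z. h > 0 \<Longrightarrow> h' > 0 \<Longrightarrow>
    \<bar>summand h h' \<theta> z\<bar> \<le> Q * (1 + \<bar>\<theta>\<bar> * h') / (h ^ CARD('d) * h')"
proof -
  obtain B where B: "B \<ge> 0" "\<And>z. \<bar>K0 z\<bar> \<le> B" using K0_bounded by blast
  obtain B' where B': "B' \<ge> 0" "\<And>z. \<bar>K1 z\<bar> \<le> B'" using K1_bounded by blast
  show ?thesis
  proof (rule that[of "B * (B' + 1)"])
    show "0 \<le> B * (B' + 1)" using B B' by simp
    fix h h' \<theta> :: real and z :: "(real^'d) \<times> real" assume h: "h > 0" "h' > 0"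
    let ?k = "K1 ((snd z - m x - \<epsilon>) / h')"
    have "\<bar>?k - \<theta> * h'\<bar> \<le> B' + \<bar>\<theta>\<bar> * h'"
      using B'(2)[of "(snd z - m x - \<epsilon>) / h'"] h abs_triangle_ineq4[of ?k "\<theta> * h'"] by (simp add: abs_mult)
    also have "\<dots> \<le> (B' + 1) * (1 + \<bar>\<theta>\<bar> * h')" using B' h by (simp add: algebra_simps)
    finally have k: "\<bar>?k - \<theta> * h'\<bar> \<le> (B' + 1) * (1 + \<bar>\<theta>\<bar> * h')" .
    have hh: "h ^ CARD('d) * h' > 0" using h by simp
    have "summand h h' \<theta> z = K0 ((fst z - x) /\<^sub>R h) * (?k - \<theta> * h') / (h ^ CARD('d) * h')"
      using h by (simp add: summand_def field_simps)
    then have "\<bar>summand h h' \<theta> z\<bar> = \<bar>K0 ((fst z - x) /\<^sub>R h)\<bar> * \<bar>?k - \<theta> * h'\<bar> / (h ^ CARD('d) * h')"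
      using hh by (simp only: abs_divide abs_mult[of "K0 ((fst z - x) /\<^sub>R h)"] abs_of_pos)
    also have "\<dots> \<le> B * ((B' + 1) * (1 + \<bar>\<theta>\<bar> * h')) / (h ^ CARD('d) * h')"
      using k B hh by (intro divide_right_mono mult_mono) auto
    finally show "\<bar>summand h h' \<theta> z\<bar> \<le> B * (B' + 1) * (1 + \<bar>\<theta>\<bar> * h') / (h ^ CARD('d) * h')"
      by (simp add: mult.assoc)
  qed
qed

text \<open>Expanding the square, the terms that contain \<open>\<theta>\<close> carry a factor \<open>h'\<close> and disappear.\<close>

lemma summand_second_moment_tendsto:
  assumes h: "\<And>n. h n > 0" "h \<longlonglongrightarrow> 0" and h': "\<And>n. h' n > 0" "h' \<longlonglongrightarrow> 0" and \<theta>: "\<theta> \<longlonglongrightarrow> \<theta>0"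
  shows "(\<lambda>n. h n ^ CARD('d) * h' n * expectation (\<lambda>w. (summand (h n) (h' n) (\<theta> n) (X 0 w, Y 0 w))\<^sup>2))
    \<longlonglongrightarrow> g x * f \<epsilon> * (\<integral>z. (K0 z)\<^sup>2 \<partial>lborel) * (\<integral>v. (K1 v)\<^sup>2 \<partial>lborel)"
proof -
  let ?K = "\<lambda>n w. K0 ((X 0 w - x) /\<^sub>R h n)" and ?k = "\<lambda>n w. K1 ((Y 0 w - m x - \<epsilon>) / h' n)"
  note p = ball_kernel_power2[OF K0(1)] and k = ball_kernel_power2[OF K1(1)]
  note i = kernel_products_integrable[OF p k] kernel_products_integrable[OF p K1(1)]
  define E1 where "E1 n = expectation (\<lambda>w. (?K n w)\<^sup>2 * (?k n w)\<^sup>2) / (h n ^ CARD('d) * h' n)" for n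
  define E2 where "E2 n = expectation (\<lambda>w. (?K n w)\<^sup>2 * ?k n w) / (h n ^ CARD('d) * h' n)" for n
  define E3 where "E3 n = expectation (\<lambda>w. (?K n w)\<^sup>2) / h n ^ CARD('d)" for n
  have lim: "(\<lambda>n. E1 n - 2 * \<theta> n * h' n * E2 n + (\<theta> n)\<^sup>2 * h' n * E3 n) \<longlonglongrightarrow>
      g x * f \<epsilon> * (\<integral>z. (K0 z)\<^sup>2 \<partial>lborel) * (\<integral>v. (K1 v)\<^sup>2 \<partial>lborel)
      - 2 * \<theta>0 * 0 * (g x * f \<epsilon> * (\<integral>z. (K0 z)\<^sup>2 \<partial>lborel) * (\<integral>v. K1 v \<partial>lborel))
      + \<theta>0\<^sup>2 * 0 * (g x * (\<integral>z. (K0 z)\<^sup>2 \<partial>lborel))"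
    unfolding E1_def E2_def E3_def
    by (intro tendsto_intros \<theta> h' joint_limit[OF p k h h'] joint_limit[OF p K1(1) h h'] marginal_limit[OF p h])
  have eq: "h n ^ CARD('d) * h' n * expectation (\<lambda>w. (summand (h n) (h' n) (\<theta> n) (X 0 w, Y 0 w))\<^sup>2)
      = E1 n - 2 * \<theta> n * h' n * E2 n + (\<theta> n)\<^sup>2 * h' n * E3 n" for n
  proof -
    define D where "D = h n ^ CARD('d)"
    define c where "c = h' n"
    have pos: "D > 0" "c > 0" using h(1)[of n] h'(1)[of n] by (auto simp: D_def c_def)
    have eq: "(summand (h n) (h' n) (\<theta> n) (X 0 w, Y 0 w))\<^sup>2 =
      1 / (D\<^sup>2 * c\<^sup>2) * ((?K n w)\<^sup>2 * (?k n w)\<^sup>2) - 2 * \<theta> n / (D\<^sup>2 * c) * ((?K n w)\<^sup>2 * ?k n w) + (\<theta> n)\<^sup>2 / D\<^sup>2 * (?K n w)\<^sup>2" for w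
    proof -
      have "(\<kappa> * (l / c - t) / D)\<^sup>2 = 1 / (D\<^sup>2 * c\<^sup>2) * (\<kappa>\<^sup>2 * l\<^sup>2) - 2 * t / (D\<^sup>2 * c) * (\<kappa>\<^sup>2 * l) + t\<^sup>2 / D\<^sup>2 * \<kappa>\<^sup>2"
        for \<kappa> l t :: real
        using pos by (simp add: power2_eq_square field_simps)
      then show ?thesis by (simp add: summand_def D_def c_def)
    qed
    have "expectation (\<lambda>w. (summand (h n) (h' n) (\<theta> n) (X 0 w, Y 0 w))\<^sup>2) =
      1 / (D\<^sup>2 * c\<^sup>2) * expectation (\<lambda>w. (?K n w)\<^sup>2 * (?k n w)\<^sup>2) - 2 * \<theta> n / (D\<^sup>2 * c) * expectation (\<lambda>w. (?K n w)\<^sup>2 * ?k n w)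
        + (\<theta> n)\<^sup>2 / D\<^sup>2 * expectation (\<lambda>w. (?K n w)\<^sup>2)"
      unfolding eq using i by simp
    then show ?thesis
      unfolding E1_def E2_def E3_def D_def[symmetric] c_def[symmetric]
      using pos by (simp add: power2_eq_square field_simps)
  qed
  show ?thesis unfolding eq using lim by simp
qed

text \<open>The difference between the normalised estimator and the row sum \<open>S\<close> is the plug-in error, the
  mean of the summands and \<open>S\<close> times the error of the density estimator, all divided by that estimator.\<close>

lemma asymptotic_normality:
  assumes b: "\<And>n. b n > 0" "b \<longlonglongrightarrow> 0" and h: "\<And>n. h n > 0" "h \<longlonglongrightarrow> 0" and h': "\<And>n. h' n > 0" "h' \<longlonglongrightarrow> 0"
    and nb: "filterlim (\<lambda>n. real n * b n ^ CARD('d)) at_top sequentially"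
    and nhh: "filterlim (\<lambda>n. real n * h n ^ CARD('d) * h' n) at_top sequentially"
    and var: "(\<lambda>n. real n * h n ^ CARD('d) / h' n / (real n * b n ^ CARD('d))) \<longlonglongrightarrow> 0"
    and bias: "(\<lambda>n. real n * h n ^ CARD('d) / h' n * b n ^ 4) \<longlonglongrightarrow> 0"
    and \<theta>: "\<theta> \<longlonglongrightarrow> \<theta>0"
    and centre: "(\<lambda>n. sqrt (real n * h n ^ CARD('d) * h' n) * (num_mean (h n) (h' n) - \<theta> n * dens_mean (h n))) \<longlonglongrightarrow> 0"
  shows "weak_conv_m (\<lambda>n. distr M borel (\<lambda>w. sqrt (real n * h n ^ CARD('d) * h' n) *
     (cond_pdf_estimator K0 K1 (b n) (h n) (h' n) X Y n \<epsilon> x w - \<theta> n))) (normal_law 0 limit_variance)"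
proof -
  define a where "a n = sqrt (real n * h n ^ CARD('d) * h' n)" for n
  have a2: "(a n)\<^sup>2 = real n * h n ^ CARD('d) * h' n" for n
    using h(1)[of n] h'(1)[of n] by (simp add: a_def)
  have a_top: "filterlim a at_top sequentially"
    unfolding a_def by (rule filterlim_compose[OF sqrt_at_top nhh])
  have a0: "a n \<ge> 0" for n using h(1)[of n] h'(1)[of n] by (simp add: a_def)
  have nh: "filterlim (\<lambda>n. real n * h n ^ CARD('d)) at_top sequentially"
  proof (rule filterlim_at_top_mono[OF nhh])
    have "\<forall>\<^sub>F n in sequentially. h' n < 1" using h'(2) by (rule order_tendstoD) simp
    then show "\<forall>\<^sub>F n in sequentially. real n * h n ^ CARD('d) * h' n \<le> real n * h n ^ CARD('d)"
    proof eventually_elim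
      case (elim n)
      have "real n * h n ^ CARD('d) \<ge> 0" using h(1)[of n] by simp
      from mult_left_mono[OF less_imp_le[OF elim] this] show ?case by simp
    qed
  qed
  have v0: "limit_variance \<ge> 0"
    unfolding limit_variance_def using f_nonneg gx by (intro mult_nonneg_nonneg divide_nonneg_pos) auto
  define \<psi> where "\<psi> n = summand (h n) (h' n) (\<theta> n)" for n
  define e where "e n = expectation (\<lambda>w. \<psi> n (X 0 w, Y 0 w))" for n
  have e: "e n = num_mean (h n) (h' n) - \<theta> n * dens_mean (h n)" for n
    unfolding e_def \<psi>_def by (rule expectation_summand[OF h(1) h'(1)])
  have [measurable]: "\<psi> n \<in> borel_measurable borel" for n by (simp add: \<psi>_def)
  \<comment> \<open>The row sum carries the factor \<open>1/g x\<close> already, so that its limit variance is the final one.\<close>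
  define \<xi> where "\<xi> n i w = a n / (real n * g x) * (\<psi> n (X i w, Y i w) - e n)" for n i w
  define S where "S n w = (\<Sum>i=1..n. \<xi> n i w)" for n w
  obtain Q where Q: "Q \<ge> 0" "\<And>h h' \<theta> z. h > 0 \<Longrightarrow> h' > 0 \<Longrightarrow>
    \<bar>summand h h' \<theta> z\<bar> \<le> Q * (1 + \<bar>\<theta>\<bar> * h') / (h ^ CARD('d) * h')" using summand_bound by blast
  define B where "B n = Q * (1 + \<bar>\<theta> n\<bar> * h' n) / (h n ^ CARD('d) * h' n)" for n
  have \<psi>B: "\<bar>\<psi> n z\<bar> \<le> B n" for n z
    unfolding \<psi>_def B_def by (rule Q(2)[OF h(1) h'(1)])
  have \<psi>m: "(\<lambda>w. \<psi> n (X i w, Y i w)) \<in> borel_measurable M" for n i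
    by (simp add: \<psi>_def summand_def)
  have \<psi>i: "integrable M (\<lambda>w. \<psi> n (X i w, Y i w))" for n i
    using \<psi>B \<psi>m by (intro integrable_const_bound[where B = "B n"]) auto
  have \<psi>i2: "integrable M (\<lambda>w. (\<psi> n (X i w, Y i w))\<^sup>2)" for n i
  proof (rule integrable_const_bound[where B = "(B n)\<^sup>2"], rule AE_I2)
    fix w
    have "\<bar>\<psi> n (X i w, Y i w)\<bar>\<^sup>2 \<le> (B n)\<^sup>2" by (intro power_mono \<psi>B) auto
    then show "norm ((\<psi> n (X i w, Y i w))\<^sup>2) \<le> (B n)\<^sup>2" by simp
  qed (use \<psi>m in measurable)
  have eB: "\<bar>e n\<bar> \<le> B n" for n
  proof -
    have "\<bar>e n\<bar> \<le> expectation (\<lambda>w. \<bar>\<psi> n (X 0 w, Y 0 w)\<bar>)" unfolding e_def by (rule integral_abs_bound)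
    also have "\<dots> \<le> expectation (\<lambda>w. B n)" using \<psi>B \<psi>i by (intro integral_mono) auto
    finally show ?thesis by (simp add: prob_space)
  qed
  have \<psi>e: "expectation (\<lambda>w. \<psi> n (X i w, Y i w)) = e n" for n i
    unfolding e_def using iid_transfer(1)[OF iid, of "\<psi> n" i] by simp
  have \<xi>meas: "(\<lambda>z. a n / (real n * g x) * (\<psi> n z - e n)) \<in> borel_measurable borel" for n by simp
  have ind: "indep_vars (\<lambda>_. borel) (\<xi> n) {1..n}" for n
    unfolding \<xi>_def[abs_def] using iid_indep_compose[OF iid \<xi>meas[of n], of "{1..n}"] by simp
  have ident: "distr M borel (\<xi> n i) = distr M borel (\<xi> n 0)" for n i
    unfolding \<xi>_def[abs_def] using iid_transfer(3)[OF iid \<xi>meas[of n], of i] by simp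
  have \<xi>m[measurable]: "\<xi> n i \<in> borel_measurable M" for n i
    unfolding \<xi>_def[abs_def] using \<psi>m[of n i] by simp
  have Sm[measurable]: "S n \<in> borel_measurable M" for n
    unfolding S_def[abs_def] by simp
  have mean: "expectation (\<xi> n i) = 0" for n i
    unfolding \<xi>_def[abs_def] using \<psi>i[of n i] \<psi>e[of n i] by (simp add: prob_space)
  have \<xi>i2: "integrable M (\<lambda>w. (\<xi> n i w)\<^sup>2)" for n i
    unfolding \<xi>_def power_mult_distrib power2_diff using \<psi>i[of n i] \<psi>i2[of n i] by simp
  have \<xi>2: "expectation (\<lambda>w. (\<xi> n i w)\<^sup>2) = expectation (\<lambda>w. (\<xi> n 0 w)\<^sup>2)" for n i
    unfolding \<xi>_def using iid_transfer(1)[OF iid, of "\<lambda>z. (a n / (real n * g x) * (\<psi> n z - e n))\<^sup>2" i] by simp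
  have scaled_e: "(\<lambda>n. a n * e n) \<longlonglongrightarrow> 0" using centre by (simp add: a_def e)
  have var_lim: "(\<lambda>n. real n * expectation (\<lambda>w. (\<xi> n 1 w)\<^sup>2)) \<longlonglongrightarrow> limit_variance"
  proof (rule Lim_transform_eventually)
    let ?E = "\<lambda>n. expectation (\<lambda>w. (\<psi> n (X 0 w, Y 0 w))\<^sup>2)"
    have "(\<lambda>n. (h n ^ CARD('d) * h' n * ?E n - (a n * e n)\<^sup>2 * inverse (real n)) / (g x)\<^sup>2) \<longlonglongrightarrow>
       (g x * f \<epsilon> * (\<integral>z. (K0 z)\<^sup>2 \<partial>lborel) * (\<integral>v. (K1 v)\<^sup>2 \<partial>lborel) - 0\<^sup>2 * 0) / (g x)\<^sup>2"
      unfolding \<psi>_def using gx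
      by (intro tendsto_intros summand_second_moment_tendsto[OF h h' \<theta>] scaled_e
          tendsto_inverse_0_at_top filterlim_real_sequentially) auto
    then show "(\<lambda>n. (h n ^ CARD('d) * h' n * ?E n - (a n * e n)\<^sup>2 * inverse (real n)) / (g x)\<^sup>2) \<longlonglongrightarrow> limit_variance"
      using gx by (simp add: limit_variance_def power2_eq_square)
    show "\<forall>\<^sub>F n in sequentially. (h n ^ CARD('d) * h' n * ?E n - (a n * e n)\<^sup>2 * inverse (real n)) / (g x)\<^sup>2 =
        real n * expectation (\<lambda>w. (\<xi> n 1 w)\<^sup>2)"
      using eventually_ge_at_top[of 1]
    proof eventually_elim
      case (elim n)
      have V: "expectation (\<lambda>w. (\<psi> n (X 0 w, Y 0 w) - e n)\<^sup>2) = ?E n - (e n)\<^sup>2"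
        using variance_eq[OF \<psi>i \<psi>i2, of n 0] by (simp add: e_def)
      have "expectation (\<lambda>w. (\<xi> n 1 w)\<^sup>2) = (a n / (real n * g x))\<^sup>2 * (?E n - (e n)\<^sup>2)"
        unfolding \<xi>2[of n 1] unfolding \<xi>_def power_mult_distrib[of "a n / (real n * g x)"] using V by simp
      moreover have "real n * ((a n / (real n * g x))\<^sup>2 * (?E n - (e n)\<^sup>2)) =
         ((a n)\<^sup>2 / real n * ?E n - (a n * e n)\<^sup>2 * inverse (real n)) / (g x)\<^sup>2"
        using elim gx by (simp add: power2_eq_square field_simps)
      moreover have "(a n)\<^sup>2 / real n = h n ^ CARD('d) * h' n" using a2[of n] elim by simp
      ultimately show ?case by simp
    qed
  qed
  have charS: "(\<lambda>n. char (distr M borel (S n)) t) \<longlonglongrightarrow> complex_of_real (exp (- (t\<^sup>2 * limit_variance / 2)))" for t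
    unfolding S_def[abs_def]
  proof (rule char_row_sum_tendsto_normal[OF ind _ _ mean _ var_lim v0])
    show "distr M borel (\<xi> n i) = distr M borel (\<xi> n 1)" for n i by (metis ident)
    show "\<bar>\<xi> n 1 w\<bar> \<le> a n / (real n * g x) * (2 * B n)" for n w
    proof -
      have "\<bar>\<psi> n (X 1 w, Y 1 w) - e n\<bar> \<le> 2 * B n"
        using \<psi>B[of n "(X 1 w, Y 1 w)"] eB[of n] by linarith
      then show ?thesis unfolding \<xi>_def abs_mult using a0[of n] gx by (intro mult_mono) auto
    qed
    show "(\<lambda>n. a n / (real n * g x) * (2 * B n)) \<longlonglongrightarrow> 0"
    proof (rule Lim_transform_eventually)
      have "(\<lambda>n. 2 * Q / g x * (1 + \<bar>\<theta> n\<bar> * h' n) * inverse (a n)) \<longlonglongrightarrow> 2 * Q / g x * (1 + \<bar>\<theta>0\<bar> * 0) * 0"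
        by (intro tendsto_intros \<theta> h' tendsto_inverse_0_at_top a_top)
      then show "(\<lambda>n. 2 * Q / g x * (1 + \<bar>\<theta> n\<bar> * h' n) * inverse (a n)) \<longlonglongrightarrow> 0" by simp
      show "\<forall>\<^sub>F n in sequentially. 2 * Q / g x * (1 + \<bar>\<theta> n\<bar> * h' n) * inverse (a n) = a n / (real n * g x) * (2 * B n)"
        using eventually_ge_at_top[of 1]
      proof eventually_elim
        case (elim n)
        have an: "a n > 0" using elim h(1)[of n] h'(1)[of n] by (simp add: a_def)
        have "a n / (real n * g x) * (2 * B n) = 2 * Q / g x * (1 + \<bar>\<theta> n\<bar> * h' n) * (a n / (a n)\<^sup>2)"
          unfolding a2 B_def by (simp add: ac_simps)
        also have "a n / (a n)\<^sup>2 = inverse (a n)" using an by (simp add: power2_eq_square field_simps)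
        finally show ?case by simp
      qed
    qed
  qed
  have SL1: "\<forall>\<^sub>F n in sequentially. expectation (\<lambda>w. \<bar>S n w\<bar>) \<le> limit_variance + 2" and Sint: "integrable M (S n)" for n
  proof -
    have sm: "integrable M (\<lambda>w. (S n w)\<^sup>2) \<and> expectation (\<lambda>w. (S n w)\<^sup>2) = (\<Sum>i=1..n. expectation (\<lambda>w. (\<xi> n i w)\<^sup>2))" for n
      unfolding S_def by (rule second_moment_indep_sum[OF _ ind \<xi>i2 mean]) simp
    have S2: "expectation (\<lambda>w. (S n w)\<^sup>2) = real n * expectation (\<lambda>w. (\<xi> n 1 w)\<^sup>2)" for n
    proof -
      have "(\<Sum>i=1..n. expectation (\<lambda>w. (\<xi> n i w)\<^sup>2)) = (\<Sum>i=1..n. expectation (\<lambda>w. (\<xi> n 1 w)\<^sup>2))"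
        by (intro sum.cong refl) (metis \<xi>2)
      with sm show ?thesis by simp
    qed
    show Si: "integrable M (S n)" for n
      by (rule square_integrable_imp_integrable) (use sm in auto)
    have "\<forall>\<^sub>F n in sequentially. real n * expectation (\<lambda>w. (\<xi> n 1 w)\<^sup>2) < limit_variance + 1"
      using var_lim by (rule order_tendstoD) simp
    then show "\<forall>\<^sub>F n in sequentially. expectation (\<lambda>w. \<bar>S n w\<bar>) \<le> limit_variance + 2"
    proof eventually_elim
      case (elim n)
      have le: "\<bar>s\<bar> \<le> 1 + s\<^sup>2" for s :: real
        using zero_le_power2[of "\<bar>s\<bar> - 1"] unfolding power2_diff by simp
      have "expectation (\<lambda>w. \<bar>S n w\<bar>) \<le> expectation (\<lambda>w. 1 + (S n w)\<^sup>2)"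
        using Si sm le by (intro integral_mono) auto
      also have "\<dots> = 1 + real n * expectation (\<lambda>w. (\<xi> n 1 w)\<^sup>2)"
        using sm S2[of n] by (simp add: prob_space)
      finally show ?case using elim by simp
    qed
  qed
  let ?t = "\<lambda>n w. nw_estimator K0 (b n) X Y n x w"
  let ?D = "\<lambda>n w. dens_est (h n) n w"
  let ?N = "\<lambda>n t w. num_est (h n) (h' n) t n w"
  let ?T = "\<lambda>n w. a n * (cond_pdf_estimator K0 K1 (b n) (h n) (h' n) X Y n \<epsilon> x w - \<theta> n)"
  have S_eq: "g x * S n w = a n * (?N n (m x) w - \<theta> n * ?D n w - e n)" if "n \<ge> 1" for n w
  proof -
    have "?N n (m x) w - \<theta> n * ?D n w = (\<Sum>i=1..n. \<psi> n (X i w, Y i w)) / real n"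
    proof -
      have "\<psi> n (X i w, Y i w) = K0 ((X i w - x) /\<^sub>R h n) * K1 ((Y i w - m x - \<epsilon>) / h' n) / (h n ^ CARD('d) * h' n)
          - \<theta> n * (K0 ((X i w - x) /\<^sub>R h n) / h n ^ CARD('d))" for i
        using h(1)[of n] h'(1)[of n] by (simp add: \<psi>_def summand_def field_simps)
      then show ?thesis
        by (simp add: num_est_def dens_est_def sum_subtractf sum_distrib_left diff_divide_distrib)
    qed
    moreover have "S n w = a n / (real n * g x) * ((\<Sum>i=1..n. \<psi> n (X i w, Y i w)) - real n * e n)"
      unfolding S_def \<xi>_def sum_distrib_left[symmetric] by (simp add: sum_subtractf)
    then have "g x * S n w = a n * ((\<Sum>i=1..n. \<psi> n (X i w, Y i w)) / real n - e n)"
      using that gx by (simp add: field_simps)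
    ultimately show ?thesis by simp
  qed
  note dens = dens_est_consistent[OF h nh]
  note invD = inverse_dens_est_bounded[OF dens]
  have ah: "(a n / h' n)\<^sup>2 = real n * h n ^ CARD('d) / h' n" for n
    unfolding power_divide a2 using h'(1)[of n] by (simp add: power2_eq_square)
  have bias': "(\<lambda>n. a n / h' n * (b n)\<^sup>2) \<longlonglongrightarrow> 0"
  proof -
    have "(a n / h' n * (b n)\<^sup>2)\<^sup>2 = real n * h n ^ CARD('d) / h' n * b n ^ 4" for n
      unfolding power_mult_distrib ah by simp
    then have "(\<lambda>n. sqrt ((a n / h' n * (b n)\<^sup>2)\<^sup>2)) \<longlonglongrightarrow> sqrt 0"
      using bias by (intro tendsto_real_sqrt) simp
    then have "(\<lambda>n. \<bar>a n / h' n * (b n)\<^sup>2\<bar>) \<longlonglongrightarrow> 0" by (simp only: real_sqrt_abs real_sqrt_zero)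
    then show ?thesis by (rule tendsto_rabs_zero_cancel)
  qed
  have plug: "vanishes_in_prob M (\<lambda>n w. a n * (?N n (?t n w) w - ?N n (m x) w))"
    by (rule plug_in_negligible[OF b h h' nb a_top _ bias']) (use var ah in simp)
  have neg: "vanishes_in_prob M (\<lambda>n w. (?D n w - g x) * S n w)"
    by (rule vanishes_mult_L1[OF dens Sint SL1])
  have "vanishes_in_prob M (\<lambda>n w. - ((?D n w - g x) * S n w))"
    by (rule vanishes_mono[OF neg]) (auto intro!: whp_always)
  from vanishes_mult_bounded[OF vanishes_add[OF vanishes_add[OF plug vanishes_deterministic[OF scaled_e]] this] invD]
  \<comment> \<open>The three contributions to the remainder, over a density estimator that is bounded away from zero.\<close>
  have rem: "vanishes_in_prob M (\<lambda>n w. (a n * (?N n (?t n w) w - ?N n (m x) w) + a n * e n + - ((?D n w - g x) * S n w)) * (1 / ?D n w))" .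
  have close: "vanishes_in_prob M (\<lambda>n w. ?T n w - S n w)"
  proof (rule vanishes_cong_whp[OF rem])
    have "whp M (\<lambda>n w. g x / 2 \<le> ?D n w \<and> n \<ge> 1)"
      by (intro whp_conj dens_est_bounded_below[OF dens] whp_always)
        (use eventually_ge_at_top[of 1] in \<open>auto elim: eventually_mono\<close>)
    then show "whp M (\<lambda>n w. ?T n w - S n w =
       (a n * (?N n (?t n w) w - ?N n (m x) w) + a n * e n + - ((?D n w - g x) * S n w)) * (1 / ?D n w))"
    proof (rule whp_mono, intro always_eventually allI ballI impI)
      fix n w assume "g x / 2 \<le> ?D n w \<and> n \<ge> 1"
      then have D: "?D n w \<noteq> 0" and n: "n \<ge> 1" using gx by auto
      show "?T n w - S n w =
       (a n * (?N n (?t n w) w - ?N n (m x) w) + a n * e n + - ((?D n w - g x) * S n w)) * (1 / ?D n w)"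
        unfolding cond_pdf_estimator_eq[OF h(1)[of n] h'(1)[of n]]
        using S_eq[OF n, of w] D by (simp add: field_simps)
    qed
  qed
  have Tm: "?T n \<in> borel_measurable M" for n
    unfolding cond_pdf_estimator_def nw_estimator_def by measurable
  have "weak_conv_m (\<lambda>n. distr M borel (?T n)) (normal_law 0 limit_variance)"
  proof (rule levy_continuity)
    show "real_distribution (distr M borel (?T n))" for n by (rule real_distribution_distr[OF Tm])
    show "real_distribution (normal_law 0 limit_variance)" by (rule real_distribution_normal_law[OF v0])
    show "(\<lambda>n. char (distr M borel (?T n)) t) \<longlonglongrightarrow> char (normal_law 0 limit_variance) t" for t
      unfolding char_normal_law[OF v0] by (rule char_tendsto_perturb[OF Tm Sm close charS])
  qed
  then show ?thesis unfolding a_def .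
qed

end

text \<open>The relative bias \<open>q\<close> is at most \<open>c h\<^sup>2 + o(h'\<^sup>2)\<close>. Truncating it at \<open>c h\<^sup>2\<close> splits it into a part of
  order \<open>h\<^sup>2\<close>, negligible after multiplication by \<open>a\<close>, and a part \<open>o(h'\<^sup>2)\<close> that the centring
  absorbs. Hence any coefficient \<open>\<beta>\<close> of \<open>h\<^sup>2\<close> is admissible.\<close>

lemma (in regression_at) centering_exists:
  assumes h: "\<And>n. h n > 0" "h \<longlonglongrightarrow> 0" and h': "\<And>n. h' n > 0" "h' \<longlonglongrightarrow> 0"
    and a: "(\<lambda>n. a n * (h n)\<^sup>2) \<longlonglongrightarrow> 0"
  obtains \<delta> where "\<delta> \<in> o(\<lambda>n. (h n)\<^sup>2 + (h' n)\<^sup>2)" "\<delta> \<longlonglongrightarrow> 0"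
    "(\<lambda>n. a n * (num_mean (h n) (h' n) - (f \<epsilon> + (h n)\<^sup>2 * \<beta> + (h' n)\<^sup>2 * f_bias + \<delta> n) * dens_mean (h n))) \<longlonglongrightarrow> 0"
proof -
  obtain A where A: "A \<ge> 0" "\<And>e. e > 0 \<Longrightarrow> \<forall>\<^sub>F n in sequentially.
    \<bar>num_mean (h n) (h' n) - dens_mean (h n) * (f \<epsilon> + (h' n)\<^sup>2 * f_bias)\<bar> \<le> A * (h n)\<^sup>2 + e * (h' n)\<^sup>2"
    using second_order_bias[OF h h'] by blast
  define c where "c = 2 * A / g x"
  have c0: "c \<ge> 0" using A gx by (simp add: c_def)
  have dlim: "(\<lambda>n. dens_mean (h n)) \<longlonglongrightarrow> g x" by (rule dens_mean_tendsto[OF h])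
  have dpos: "\<forall>\<^sub>F n in sequentially. dens_mean (h n) > g x / 2"
    using dlim by (rule order_tendstoD) (use gx in simp)
  define q where "q n = num_mean (h n) (h' n) / dens_mean (h n) - (f \<epsilon> + (h' n)\<^sup>2 * f_bias)" for n
  have q: "\<forall>\<^sub>F n in sequentially. \<bar>q n\<bar> \<le> c * (h n)\<^sup>2 + e * (h' n)\<^sup>2" if e: "e > 0" for e
  proof -
    have "e * g x / 2 > 0" using e gx by simp
    from A(2)[OF this] dpos show ?thesis
    proof eventually_elim
      case (elim n)
      let ?D = "dens_mean (h n)"
      let ?U = "num_mean (h n) (h' n) - ?D * (f \<epsilon> + (h' n)\<^sup>2 * f_bias)"
      have D: "?D > 0" using elim(2) gx by linarith
      have "q n = ?U / ?D" using D by (simp add: q_def field_simps)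
      then have "\<bar>q n\<bar> = \<bar>?U\<bar> / ?D" using D by simp
      also have "\<dots> \<le> \<bar>?U\<bar> / (g x / 2)"
        using elim(2) gx D by (intro divide_left_mono) auto
      also have "\<dots> \<le> (A * (h n)\<^sup>2 + e * g x / 2 * (h' n)\<^sup>2) / (g x / 2)"
        using elim(1) gx by (intro divide_right_mono) auto
      also have "\<dots> = c * (h n)\<^sup>2 + e * (h' n)\<^sup>2" using gx by (simp add: c_def field_simps)
      finally show ?case .
    qed
  qed
  define t where "t n = max (- (c * (h n)\<^sup>2)) (min (c * (h n)\<^sup>2) (q n))" for n
  define \<delta> where "\<delta> n = q n - t n" for n
  have t: "\<bar>t n\<bar> \<le> c * (h n)\<^sup>2" for n
  proof -
    have "c * (h n)\<^sup>2 \<ge> 0" using c0 by simp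
    then show ?thesis by (auto simp: t_def)
  qed
  have \<delta>: "\<forall>\<^sub>F n in sequentially. \<bar>\<delta> n\<bar> \<le> e * (h' n)\<^sup>2" if e: "e > 0" for e
    using q[OF e]
  proof eventually_elim
    case (elim n)
    have "c * (h n)\<^sup>2 \<ge> 0" "e * (h' n)\<^sup>2 \<ge> 0" using c0 e by auto
    then show ?case using elim by (auto simp: \<delta>_def t_def max_def min_def abs_if split: if_splits)
  qed
  show ?thesis
  proof (rule that[of \<delta>])
    show "\<delta> \<in> o(\<lambda>n. (h n)\<^sup>2 + (h' n)\<^sup>2)"
    proof (rule landau_o.smallI)
      fix e :: real assume e: "e > 0"
      show "\<forall>\<^sub>F n in sequentially. norm (\<delta> n) \<le> e * norm ((h n)\<^sup>2 + (h' n)\<^sup>2)"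
        using \<delta>[OF e]
      proof eventually_elim
        case (elim n)
        have "e * (h' n)\<^sup>2 \<le> e * ((h n)\<^sup>2 + (h' n)\<^sup>2)" using e by (intro mult_left_mono) auto
        then show ?case using elim by simp
      qed
    qed
    show "\<delta> \<longlonglongrightarrow> 0"
    proof (rule Lim_null_comparison)
      show "\<forall>\<^sub>F n in sequentially. norm (\<delta> n) \<le> 1 * (h' n)\<^sup>2" using \<delta>[of 1] by simp
      show "(\<lambda>n. 1 * (h' n)\<^sup>2) \<longlonglongrightarrow> 0" using tendsto_power[OF h'(2), of 2] by simp
    qed
    show "(\<lambda>n. a n * (num_mean (h n) (h' n) - (f \<epsilon> + (h n)\<^sup>2 * \<beta> + (h' n)\<^sup>2 * f_bias + \<delta> n) * dens_mean (h n))) \<longlonglongrightarrow> 0"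
    proof (rule Lim_null_comparison)
      show "\<forall>\<^sub>F n in sequentially. norm (a n * (num_mean (h n) (h' n) - (f \<epsilon> + (h n)\<^sup>2 * \<beta> + (h' n)\<^sup>2 * f_bias + \<delta> n) * dens_mean (h n)))
        \<le> \<bar>a n * (h n)\<^sup>2\<bar> * \<bar>dens_mean (h n)\<bar> * (c + \<bar>\<beta>\<bar>)"
        using dpos
      proof eventually_elim
        case (elim n)
        have D: "dens_mean (h n) > 0" using elim gx by linarith
        have "num_mean (h n) (h' n) = dens_mean (h n) * (q n + (f \<epsilon> + (h' n)\<^sup>2 * f_bias))"
          using D by (simp add: q_def)
        then have "num_mean (h n) (h' n) - (f \<epsilon> + (h n)\<^sup>2 * \<beta> + (h' n)\<^sup>2 * f_bias + \<delta> n) * dens_mean (h n)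
           = dens_mean (h n) * (t n - (h n)\<^sup>2 * \<beta>)" by (simp add: \<delta>_def algebra_simps)
        moreover have "\<bar>t n - (h n)\<^sup>2 * \<beta>\<bar> \<le> (h n)\<^sup>2 * (c + \<bar>\<beta>\<bar>)"
          using t[of n] abs_triangle_ineq4[of "t n" "(h n)\<^sup>2 * \<beta>"] by (simp add: abs_mult algebra_simps)
        then have "\<bar>a n\<bar> * (\<bar>dens_mean (h n)\<bar> * \<bar>t n - (h n)\<^sup>2 * \<beta>\<bar>) \<le> \<bar>a n\<bar> * (\<bar>dens_mean (h n)\<bar> * ((h n)\<^sup>2 * (c + \<bar>\<beta>\<bar>)))"
          by (intro mult_left_mono) auto
        ultimately show ?case by (simp add: abs_mult ac_simps)
      qed
      have "(\<lambda>n. \<bar>a n * (h n)\<^sup>2\<bar> * \<bar>dens_mean (h n)\<bar> * (c + \<bar>\<beta>\<bar>)) \<longlonglongrightarrow> \<bar>0\<bar> * \<bar>g x\<bar> * (c + \<bar>\<beta>\<bar>)"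
        by (intro tendsto_intros a dlim)
      then show "(\<lambda>n. \<bar>a n * (h n)\<^sup>2\<bar> * \<bar>dens_mean (h n)\<bar> * (c + \<bar>\<beta>\<bar>)) \<longlonglongrightarrow> 0" by simp
    qed
  qed
qed

section \<open>Independence, joint density and kernels\<close>

lemma indep_rvs_coordinates:
  assumes "prob_space M"
    and ind: "indep_rvs M (Pi\<^sub>M UNIV (\<lambda>_. borel)) (\<lambda>w i. U i w) (Pi\<^sub>M UNIV (\<lambda>_. borel)) (\<lambda>w i. V i w)"
  shows "distr M borel (V i) \<Otimes>\<^sub>M distr M borel (U j) = distr M (borel \<Otimes>\<^sub>M borel) (\<lambda>w. (V i w, U j w))"
proof -
  interpret prob_space M by fact
  have mU: "(\<lambda>w i. U i w) \<in> measurable M (Pi\<^sub>M UNIV (\<lambda>_. borel))"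
    and mV: "(\<lambda>w i. V i w) \<in> measurable M (Pi\<^sub>M UNIV (\<lambda>_. borel))"
    and I: "indep_set (sets (vimage_algebra (space M) (\<lambda>w i. U i w) (Pi\<^sub>M UNIV (\<lambda>_. borel))))
       (sets (vimage_algebra (space M) (\<lambda>w i. V i w) (Pi\<^sub>M UNIV (\<lambda>_. borel))))"
    using ind unfolding indep_rvs_def by auto
  have U[measurable]: "U k \<in> borel_measurable M" for k
    using measurable_compose[OF mU measurable_component_singleton[of k UNIV]] by simp
  have V[measurable]: "V k \<in> borel_measurable M" for k
    using measurable_compose[OF mV measurable_component_singleton[of k UNIV]] by simp
  show ?thesis
  proof (rule pair_measure_eqI)
    show "sigma_finite_measure (distr M borel (V i))" "sigma_finite_measure (distr M borel (U j))"
      by (intro prob_space_imp_sigma_finite prob_space_distr; simp)+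
    show "sets (distr M borel (V i) \<Otimes>\<^sub>M distr M borel (U j)) = sets (distr M (borel \<Otimes>\<^sub>M borel) (\<lambda>w. (V i w, U j w)))"
      by (simp cong: sets_pair_measure_cong)
    fix A B assume "A \<in> sets (distr M borel (V i))" "B \<in> sets (distr M borel (U j))"
    then have A[measurable]: "A \<in> sets borel" and B[measurable]: "B \<in> sets borel" by auto
    have sU: "U j -` B \<inter> space M \<in> sets (vimage_algebra (space M) (\<lambda>w i. U i w) (Pi\<^sub>M UNIV (\<lambda>_. borel)))"
    proof -
      have "(\<lambda>s. s j) -` B \<inter> space (Pi\<^sub>M UNIV (\<lambda>_. borel)) \<in> sets (Pi\<^sub>M UNIV (\<lambda>_. borel))"
      proof (rule measurable_sets[OF _ B])
        show "(\<lambda>s. s j) \<in> measurable (Pi\<^sub>M UNIV (\<lambda>_. borel)) borel" by simp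
      qed
      from in_vimage_algebra[OF this, of "\<lambda>w i. U i w" "space M"] show ?thesis
        by (simp add: space_PiM vimage_def)
    qed
    have sV: "V i -` A \<inter> space M \<in> sets (vimage_algebra (space M) (\<lambda>w i. V i w) (Pi\<^sub>M UNIV (\<lambda>_. borel)))"
    proof -
      have "(\<lambda>s. s i) -` A \<inter> space (Pi\<^sub>M UNIV (\<lambda>_. borel)) \<in> sets (Pi\<^sub>M UNIV (\<lambda>_. borel))"
      proof (rule measurable_sets[OF _ A])
        show "(\<lambda>s. s i) \<in> measurable (Pi\<^sub>M UNIV (\<lambda>_. borel)) borel" by simp
      qed
      from in_vimage_algebra[OF this, of "\<lambda>w i. V i w" "space M"] show ?thesis
        by (simp add: space_PiM vimage_def)
    qed
    have "prob ((U j -` B \<inter> space M) \<inter> (V i -` A \<inter> space M)) = prob (U j -` B \<inter> space M) * prob (V i -` A \<inter> space M)"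
      by (rule indep_setD[OF I sU sV])
    moreover have "(U j -` B \<inter> space M) \<inter> (V i -` A \<inter> space M) = (\<lambda>w. (V i w, U j w)) -` (A \<times> B) \<inter> space M" by auto
    ultimately show "emeasure (distr M borel (V i)) A * emeasure (distr M borel (U j)) B =
        emeasure (distr M (borel \<Otimes>\<^sub>M borel) (\<lambda>w. (V i w, U j w))) (A \<times> B)"
      by (simp add: emeasure_distr emeasure_eq_measure ennreal_mult[symmetric] mult.commute)
  qed
qed

lemma continuous_AE_eq_imp_eq:
  fixes F G :: "'a::euclidean_space \<Rightarrow> real"
  assumes ae: "AE z in lborel. F z = G z" and T: "open T" and F: "continuous_on T F" and G: "continuous_on T G"
    and z: "z \<in> T"
  shows "F z = G z"
proof (rule ccontr)
  assume ne: "F z \<noteq> G z"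
  define N where "N = T \<inter> (\<lambda>z. F z - G z) -` (- {0})"
  have "open N" unfolding N_def using T F G
    by (intro continuous_open_preimage continuous_intros) auto
  have zN: "z \<in> N" using z ne by (simp add: N_def)
  have "AE z in lborel. z \<notin> N" using ae by eventually_elim (simp add: N_def)
  moreover have "N \<in> sets lborel" using \<open>open N\<close> by auto
  ultimately have "emeasure lborel N = 0" by (subst (asm) AE_iff_null_sets[symmetric]) auto
  moreover obtain e where "e > 0" "ball z e \<subseteq> N" using \<open>open N\<close> zN openE by blast
  moreover have "emeasure lborel (ball z e) \<le> emeasure lborel N"
    using \<open>N \<in> sets lborel\<close> calculation by (intro emeasure_mono) auto
  ultimately have "emeasure lborel (ball z e) = 0" "e > 0" by auto
  then show False using content_ball_pos[of e z] by (simp add: measure_def)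
qed

text \<open>For fixed \<open>u\<close> the map \<open>e \<mapsto> m u + e\<close> is a translation, so the product density of \<open>(X, E)\<close>
  is transported without a Jacobian.\<close>

lemma joint_density_eq:
  fixes X :: "'w \<Rightarrow> 'b::euclidean_space" and E :: "'w \<Rightarrow> real"
  assumes "prob_space M" and [measurable]: "m \<in> borel_measurable borel"
    and X[measurable]: "X \<in> borel_measurable M" and E[measurable]: "E \<in> borel_measurable M"
    and ind: "distr M borel X \<Otimes>\<^sub>M distr M borel E = distr M (borel \<Otimes>\<^sub>M borel) (\<lambda>w. (X w, E w))"
    and g: "has_pdf M X g" and f: "has_pdf M E f" and \<phi>: "has_pdf M (\<lambda>w. (X w, m (X w) + E w)) \<phi>"
  shows "AE z in lborel. \<phi> z = g (fst z) * f (snd z - m (fst z))"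
proof -
  interpret prob_space M by fact
  have nn: "\<And>u. g u \<ge> 0" "\<And>e. f e \<ge> 0" "\<And>z. \<phi> z \<ge> 0" using g f \<phi> by (auto simp: has_pdf_def)
  have dX: "distributed M lborel X (\<lambda>u. ennreal (g u))" and dE: "distributed M lborel E (\<lambda>e. ennreal (f e))"
    and d\<phi>: "distributed M lborel (\<lambda>w. (X w, m (X w) + E w)) (\<lambda>z. ennreal (\<phi> z))"
    using g f \<phi> by (auto simp: has_pdf_def)
  have [measurable]: "g \<in> borel_measurable borel" "f \<in> borel_measurable borel" "\<phi> \<in> borel_measurable borel"
    using dX dE d\<phi> nn by (auto dest!: distributed_real_measurable[rotated])
  have lb: "distr M lborel X = distr M borel X" "distr M lborel E = distr M borel E"
     "distr M (lborel \<Otimes>\<^sub>M lborel) (\<lambda>w. (X w, E w)) = distr M (borel \<Otimes>\<^sub>M borel) (\<lambda>w. (X w, E w))"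
    by (intro distr_cong refl; simp cong: sets_pair_measure_cong)+
  have dXE: "distributed M (lborel \<Otimes>\<^sub>M lborel) (\<lambda>w. (X w, E w)) (\<lambda>(u, e). ennreal (g u) * ennreal (f e))"
    by (rule distributed_joint_indep'[OF _ _ dX dE]) (simp_all add: lb ind sigma_finite_lborel)
  have "distributed M lborel (\<lambda>w. (X w, m (X w) + E w)) (\<lambda>z. ennreal (g (fst z) * f (snd z - m (fst z))))"
    unfolding distributed_def
  proof (intro conjI)
    show mz: "(\<lambda>z. ennreal (g (fst z) * f (snd z - m (fst z)))) \<in> borel_measurable lborel"
      unfolding borel_prod[symmetric] lborel_prod[symmetric] by measurable
    show mT: "(\<lambda>w. (X w, m (X w) + E w)) \<in> measurable M lborel"
      unfolding measurable_lborel1 borel_prod[symmetric] by measurable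
    show "distr M lborel (\<lambda>w. (X w, m (X w) + E w)) = density lborel (\<lambda>z. ennreal (g (fst z) * f (snd z - m (fst z))))"
    proof (rule measure_eqI)
      fix A assume "A \<in> sets (distr M lborel (\<lambda>w. (X w, m (X w) + E w)))"
      then have A: "A \<in> sets (borel :: ('b \<times> real) measure)" by simp
      then have A'[measurable]: "A \<in> sets (borel \<Otimes>\<^sub>M borel)" unfolding borel_prod .
      define I where "I u y = (indicator A (u, y) :: ennreal)" for u y
      have [measurable]: "(\<lambda>z. I (fst z) (snd z)) \<in> borel_measurable (borel \<Otimes>\<^sub>M borel)"
        unfolding I_def by simp
      have "emeasure (distr M lborel (\<lambda>w. (X w, m (X w) + E w))) A = (\<integral>\<^sup>+w. indicator A (X w, m (X w) + E w) \<partial>M)"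
      proof -
        have "(\<integral>\<^sup>+w. indicator A (X w, m (X w) + E w) \<partial>M) = (\<integral>\<^sup>+z. indicator A z \<partial>distr M lborel (\<lambda>w. (X w, m (X w) + E w)))"
          by (rule nn_integral_distr[symmetric, OF mT]) (use A in simp)
        then show ?thesis using A by simp
      qed
      also have "\<dots> = (\<integral>\<^sup>+w. (\<lambda>z. I (fst z) (m (fst z) + snd z)) (X w, E w) \<partial>M)" by (simp add: I_def)
      also have "\<dots> = (\<integral>\<^sup>+z. (case z of (u, e) \<Rightarrow> ennreal (g u) * ennreal (f e)) * I (fst z) (m (fst z) + snd z) \<partial>(lborel \<Otimes>\<^sub>M lborel))"
        by (rule distributed_nn_integral[OF dXE, symmetric]) (unfold I_def, measurable)
      also have "\<dots> = (\<integral>\<^sup>+u. \<integral>\<^sup>+e. ennreal (g u) * ennreal (f e) * I u (m u + e) \<partial>lborel \<partial>lborel)"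
        by (subst lborel.nn_integral_fst[symmetric]) (auto simp: I_def case_prod_beta')
      also have "\<dots> = (\<integral>\<^sup>+u. \<integral>\<^sup>+y. ennreal (g u) * ennreal (f (y - m u)) * I u y \<partial>lborel \<partial>lborel)"
      proof (rule nn_integral_cong)
        fix u
        have "(\<integral>\<^sup>+y. ennreal (g u) * ennreal (f (y - m u)) * I u y \<partial>lborel) =
            ennreal \<bar>1\<bar> * (\<integral>\<^sup>+e. ennreal (g u) * ennreal (f ((m u + 1 * e) - m u)) * I u (m u + 1 * e) \<partial>lborel)"
          by (rule nn_integral_real_affine) (auto simp: I_def)
        then show "(\<integral>\<^sup>+e. ennreal (g u) * ennreal (f e) * I u (m u + e) \<partial>lborel) = (\<integral>\<^sup>+y. ennreal (g u) * ennreal (f (y - m u)) * I u y \<partial>lborel)"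
          by simp
      qed
      also have "\<dots> = (\<integral>\<^sup>+z. ennreal (g (fst z) * f (snd z - m (fst z))) * indicator A z \<partial>(lborel \<Otimes>\<^sub>M lborel))"
        by (subst lborel.nn_integral_fst[symmetric]) (auto simp: I_def ennreal_mult nn)
      also have "\<dots> = emeasure (density lborel (\<lambda>z. ennreal (g (fst z) * f (snd z - m (fst z))))) A"
        using A mz unfolding lborel_prod by (subst emeasure_density) auto
      finally show "emeasure (distr M lborel (\<lambda>w. (X w, m (X w) + E w))) A =
         emeasure (density lborel (\<lambda>z. ennreal (g (fst z) * f (snd z - m (fst z))))) A" .
    qed simp
  qed
  from distributed_unique[OF d\<phi> this] show ?thesis
    by eventually_elim (use nn in \<open>auto simp: ennreal_inj\<close>)
qed

lemma support_on_ball_kernel: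
  fixes K :: "'a::euclidean_space \<Rightarrow> real"
  assumes K: "continuous_on UNIV K" and b: "bounded (closure (support_on UNIV K))"
  obtains R0 where "\<And>R. R \<ge> R0 \<Longrightarrow> ball_kernel R K"
proof -
  obtain R0 where R0: "\<And>z. z \<in> closure (support_on UNIV K) \<Longrightarrow> norm z \<le> R0"
    using b unfolding bounded_iff by blast
  have zero: "K z = 0" if "norm z > R0" for z
    using R0[of z] that closure_subset[of "support_on UNIV K"] by (force simp: support_on_def)
  have "compact (K ` cball 0 R0)"
    by (intro compact_continuous_image continuous_on_subset[OF K]) auto
  then obtain B where B: "\<forall>z\<in>cball 0 R0. \<bar>K z\<bar> \<le> B"
    by (auto dest!: compact_imp_bounded simp: bounded_iff)
  have "\<bar>K z\<bar> \<le> max B 0" for z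
    using zero[of z] B by (cases "norm z \<le> R0") (auto simp: le_max_iff_disj)
  then have "bounded (range K)" by (auto simp: bounded_iff)
  then show ?thesis
    using zero borel_measurable_continuous_onI[OF K] by (intro that[of R0]) (auto simp: ball_kernel_def)
qed

text \<open>The derivative is bounded on the ball of radius \<open>R\<close> by compactness, and zero outside.\<close>

lemma compactly_supported_C1_lipschitz:
  fixes K :: "real \<Rightarrow> real"
  assumes d: "\<And>v. (K has_real_derivative deriv K v) (at v)" and c: "continuous_on UNIV (deriv K)"
    and z: "\<And>v. \<bar>v\<bar> > R \<Longrightarrow> K v = 0"
  obtains L where "L \<ge> 0" "\<And>u v. \<bar>K u - K v\<bar> \<le> L * \<bar>u - v\<bar>"
proof -
  have z': "deriv K v = 0" if "\<bar>v\<bar> > R" for v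
  proof -
    have "open {v::real. \<bar>v\<bar> > R}" by (intro open_Collect_less continuous_intros)
    then have "\<forall>\<^sub>F u in nhds v. K u = 0" using that z unfolding eventually_nhds by blast
    then have "deriv K v = deriv (\<lambda>_. 0) v" by (intro deriv_cong_ev) auto
    then show ?thesis by simp
  qed
  have "compact (deriv K ` cball 0 R)"
    by (intro compact_continuous_image continuous_on_subset[OF c]) auto
  then obtain B where B: "\<forall>v\<in>cball 0 R. \<bar>deriv K v\<bar> \<le> B"
    by (auto dest!: compact_imp_bounded simp: bounded_iff)
  have B': "\<bar>deriv K v\<bar> \<le> max B 0" for v
    using z'[of v] B by (cases "\<bar>v\<bar> \<le> R") (auto simp: le_max_iff_disj)
  show ?thesis
  proof (rule that[of "max B 0"])
    show "\<bar>K u - K v\<bar> \<le> max B 0 * \<bar>u - v\<bar>" for u v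
      using field_differentiable_bound[of UNIV K "deriv K" "max B 0" u v] d B' by auto
  qed simp
qed

section \<open>The conditional density estimator\<close>

theorem proposition3p1:
  fixes M :: "'w measure"
    and X :: "nat \<Rightarrow> 'w \<Rightarrow> real^'d::finite"
    and Y err :: "nat \<Rightarrow> 'w \<Rightarrow> real"
    and m g :: "real^'d \<Rightarrow> real"
    and f :: "real \<Rightarrow> real"
    and \<phi> :: "(real^'d) \<times> real \<Rightarrow> real"
    and K0 :: "real^'d \<Rightarrow> real"
    and K1 :: "real \<Rightarrow> real"
    and b0 b1 h0 h1 :: "nat \<Rightarrow> real"
    and \<X> \<X>\<^sub>0 :: "(real^'d) set"
    and x :: "real^'d"
    and \<epsilon> :: real
    and d dstar :: nat
  assumes d: "d = CARD('d)"
    and prob: "prob_space M"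
    \<comment> \<open>index 0 is the generic copy \<open>(X, Y)\<close>, the sample consists of the indices from 1 on\<close>
    and sample: "iid M borel (\<lambda>i w. (X i w, Y i w))"
    and regression: "regression_fun M (X 0) (Y 0) m"
    and model: "\<And>i w. Y i w = m (X i w) + err i w"
    and x: "x \<in> \<X>\<^sub>0"
    and supp: "\<X> = rv_support M (X 0)" "compact \<X>"
    and inner: "closed \<X>\<^sub>0" "\<X>\<^sub>0 \<subseteq> interior \<X>" "interior \<X>\<^sub>0 \<noteq> {}"
    and g: "has_pdf M (X 0) g" "\<forall>u\<in>\<X>\<^sub>0. g u > 0" "C2_on \<X> g"
    and m: "C2_on \<X> m"
    and err_iid: "iid M borel err"
    and err_moments: "\<And>i. prob_space.expectation M (err i) = 0"
      "\<And>i. integrable M (\<lambda>w. \<bar>err i w\<bar> ^ 6)"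
    and err_indep: "indep_rvs M
      (Pi\<^sub>M UNIV (\<lambda>_. borel)) (\<lambda>w i. err i w) (Pi\<^sub>M UNIV (\<lambda>_. borel)) (\<lambda>w i. X i w)"
    and f: "has_pdf M (err 0) f" "Ck 2 f" "bounded (range ((deriv ^^ 2) f))"
      "\<And>p k. p \<le> 2 \<Longrightarrow> k \<le> 2 \<Longrightarrow> bounded (range ((deriv ^^ k) (\<lambda>e. e ^ p * f e)))"
    and phi: "has_pdf M (\<lambda>w. (X 0 w, Y 0 w)) \<phi>" "C2_on_bounded UNIV \<phi>"
    and K0: "\<And>z. K0 (- z) = K0 z" "continuous_on UNIV K0"
      "closure (support_on UNIV K0) \<subseteq> cbox (\<chi> i. - 1/2) (\<chi> i. 1/2)"
      "(\<integral>z. K0 z \<partial>lborel) = 1"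
    and K1: "compact (closure (support_on UNIV K1))" "Ck 3 K1"
      "(\<integral>v. K1 v \<partial>lborel) = 1" "(\<integral>v. v * K1 v \<partial>lborel) = 0"
    and dstar: "dstar = max (d + 2) (2 * d)"
    and b0: "bandwidth b0"
      "filterlim (\<lambda>n. real n * b0 n ^ dstar / ln (real n)) at_top sequentially"
      "filterlim (\<lambda>n. ln (1 / b0 n) / ln (ln (real n))) at_top sequentially"
    and b1: "bandwidth b1"
      "filterlim (\<lambda>n. real n ^ (d + 8) * b1 n ^ (7 * (d + 4))) at_top sequentially"
    and h: "bandwidth h0" "bandwidth h1"
      "filterlim (\<lambda>n. real n * h0 n ^ (2 * d) / ln (real n)) at_top sequentially"
      "filterlim (\<lambda>n. ln (1 / h0 n) / ln (ln (real n))) at_top sequentially"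
      "filterlim (\<lambda>n. real n * h0 n ^ d * h1 n) at_top sequentially"
      "(\<lambda>n. real n * h0 n ^ d / h1 n * (b0 n ^ 4 + ln (real n) / (real n * b0 n ^ d)))
         \<in> o(\<lambda>_. 1)"
  shows "\<exists>fbar :: nat \<Rightarrow> real.
    (\<lambda>n. fbar n - (f \<epsilon> + (h0 n)\<^sup>2 * bias1 K0 \<phi> m x \<epsilon> / (2 * g x)
                       + (h1 n)\<^sup>2 * bias2 K1 \<phi> m x \<epsilon> / (2 * g x)))
      \<in> o(\<lambda>n. (h0 n)\<^sup>2 + (h1 n)\<^sup>2) \<and>
    weak_conv_m
      (\<lambda>n. distr M borel (\<lambda>w. sqrt (real n * h0 n ^ d * h1 n) *
         (cond_pdf_estimator K0 K1 (b0 n) (h0 n) (h1 n) X Y n \<epsilon> x w - fbar n)))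
      (normal_law 0 (f \<epsilon> / g x *
         (\<integral>z. (\<integral>v. (K0 z)\<^sup>2 * (K1 v)\<^sup>2 \<partial>lborel) \<partial>lborel)))"
proof -
  interpret prob_space M by (rule prob)
  have xI: "x \<in> interior \<X>" using x inner by blast
  obtain r1 C1 where m1: "r1 > 0" "C1 > 0" "ball x r1 \<subseteq> \<X>"
    "\<And>h. norm h < r1 \<Longrightarrow> \<bar>m (x + h) - m x\<bar> \<le> C1 * norm h"
    "\<And>h. norm h < r1 \<Longrightarrow> \<bar>m (x + h) + m (x - h) - 2 * m x\<bar> \<le> C1 * (norm h)\<^sup>2"
    using C2_on_interior_bounds[OF m xI] by blast
  obtain r2 C2 where g2: "r2 > 0" "C2 > 0" "ball x r2 \<subseteq> \<X>"
    "\<And>h. norm h < r2 \<Longrightarrow> \<bar>g (x + h) - g x\<bar> \<le> C2 * norm h"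
    "\<And>h. norm h < r2 \<Longrightarrow> \<bar>g (x + h) + g (x - h) - 2 * g x\<bar> \<le> C2 * (norm h)\<^sup>2"
    using C2_on_interior_bounds[OF g(3) xI] by blast
  define r where "r = min r1 r2"
  define C where "C = max C1 C2"
  have Bnd: "\<exists>B. \<forall>u. \<bar>(deriv ^^ k) f u\<bar> \<le> B" if "k \<le> 2" for k
  proof -
    have "bounded (range ((deriv ^^ k) (\<lambda>e. e ^ 0 * f e)))" by (rule f(4)) (use that in simp_all)
    then show ?thesis unfolding bounded_iff power_0 mult_1_left real_norm_def by blast
  qed
  obtain F1 where F1: "\<And>u. \<bar>deriv f u\<bar> \<le> F1" using Bnd[of 1] by auto
  obtain F2 where F2: "\<And>u. \<bar>(deriv ^^ 2) f u\<bar> \<le> F2" using Bnd[of 2] by auto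
  have K1d: "(K1 has_real_derivative deriv K1 v) (at v)" for v
    using K1(2) unfolding Ck_def by (auto simp: DERIV_deriv_iff_field_differentiable dest: spec[of _ 0])
  have K1dd: "(deriv K1 has_real_derivative (deriv ^^ 2) K1 v) (at v)" for v
    using K1(2) unfolding Ck_def by (auto simp: DERIV_deriv_iff_field_differentiable numeral_2_eq_2 dest: spec[of _ 1])
  have K1c: "continuous_on UNIV K1" "continuous_on UNIV (deriv K1)"
    using K1d K1dd by (auto intro!: continuous_at_imp_continuous_on dest: DERIV_isCont)
  obtain R0 where R0: "\<And>R. R \<ge> R0 \<Longrightarrow> ball_kernel R K0"
    using support_on_ball_kernel[OF K0(2) bounded_subset[OF bounded_cbox K0(3)]] by blast
  obtain R1 where R1: "\<And>R. R \<ge> R1 \<Longrightarrow> ball_kernel R K1"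
    using support_on_ball_kernel[OF K1c(1) compact_imp_bounded[OF K1(1)]] by blast
  define R where "R = \<bar>R0\<bar> + \<bar>R1\<bar> + 1"
  have tK0: "ball_kernel R K0" and tK1: "ball_kernel R K1" and tK1': "ball_kernel (R - 1) K1"
    using R0[of R] R1[of R] R1[of "R - 1"] by (auto simp: R_def)
  have K1z: "K1 v = 0" if "\<bar>v\<bar> > R - 1" for v using tK1' that by (auto simp: ball_kernel_def)
  obtain L where L: "L \<ge> 0" "\<And>u v. \<bar>K1 u - K1 v\<bar> \<le> L * \<bar>u - v\<bar>"
    using compactly_supported_C1_lipschitz[OF K1d K1c(2) K1z] by blast
  have m_meas: "m \<in> borel_measurable borel" using regression unfolding regression_fun_def by blast
  have emeas: "err i \<in> borel_measurable M" for i
    using err_iid unfolding iid_def indep_vars_def2 by auto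
  have err_sq: "integrable M (\<lambda>w. (err 0 w)\<^sup>2)"
  proof (rule Bochner_Integration.integrable_bound)
    show "integrable M (\<lambda>w. 1 + \<bar>err 0 w\<bar> ^ 6)" using err_moments(2)[of 0] by simp
    show "(\<lambda>w. (err 0 w)\<^sup>2) \<in> borel_measurable M" using emeas[of 0] by simp
    have "s\<^sup>2 \<le> 1 + s ^ 6" if "s \<ge> 0" for s :: real
    proof (cases "s \<le> 1")
      case True
      then have "s\<^sup>2 \<le> 1" using that by (simp add: power_le_one)
      then show ?thesis using that by (simp add: add_increasing2)
    next
      case False
      then have "s\<^sup>2 \<le> s ^ 6" by (intro power_increasing) auto
      then show ?thesis by simp
    qed
    \<comment> \<open>Sixth moments dominate second moments.\<close>
    from this[of "\<bar>err 0 w\<bar>" for w] show "AE w in M. norm ((err 0 w)\<^sup>2) \<le> norm (1 + \<bar>err 0 w\<bar> ^ 6)"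
      by simp
  qed
  have indep: "distr M borel (X 0) \<Otimes>\<^sub>M distr M borel (err 0) = distr M (borel \<Otimes>\<^sub>M borel) (\<lambda>w. (X 0 w, err 0 w))"
    by (rule indep_rvs_coordinates[OF prob err_indep])
  interpret regression_at M X Y err m g f x \<epsilon> K0 K1 R r C F1 F2 L
  proof unfold_locales
    show "iid M borel (\<lambda>i w. (X i w, Y i w))" by (rule sample)
    show "g x > 0" using g(2) x by blast
    fix w :: "real^'d" assume "norm w < r"
    then have w: "norm w < r1" "norm w < r2" by (auto simp: r_def)
    have le: "C1 * norm w \<le> C * norm w" "C2 * norm w \<le> C * norm w" "C1 * (norm w)\<^sup>2 \<le> C * (norm w)\<^sup>2"
      by (auto simp: C_def intro!: mult_right_mono)
    show "\<bar>m (x + w) - m x\<bar> \<le> C * norm w" using m1(4)[OF w(1)] le by linarith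
    show "\<bar>m (x + w) + m (x - w) - 2 * m x\<bar> \<le> C * (norm w)\<^sup>2" using m1(5)[OF w(1)] le by linarith
    show "\<bar>g (x + w) - g x\<bar> \<le> C * norm w" using g2(4)[OF w(2)] le by linarith
  next
    show "0 < R" by (simp add: R_def)
    show "0 < r" "0 < C" using m1 g2 by (auto simp: r_def C_def)
  qed (use m_meas model indep g f err_moments err_sq F1 F2 tK0 tK1 K0 K1 K1z L in auto)

  have gx0: "g x > 0" by (rule gx)
  have fy: "((\<lambda>y. f (y - c)) has_real_derivative deriv f (y - c)) (at y)" for c y
    using f_deriv[of "y - c"] DERIV_shift[of f _ y "- c"] by simp
  have phi_eq: "\<phi> (x, y) = g x * f (y - m x)" for y
  proof -
    have cont: "continuous_on (ball x r1) m" "continuous_on (ball x r1) g"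
      using m g(3) m1(3) unfolding C2_on_def has_C2_partials_def by (blast intro: continuous_on_subset)+
    have "(\<lambda>w. (X 0 w, Y 0 w)) = (\<lambda>w. (X 0 w, m (X 0 w) + err 0 w))" using model by auto
    then have "AE z in lborel. \<phi> z = g (fst z) * f (snd z - m (fst z))"
      using joint_density_eq[OF prob m_meas XY_measurable(1) emeas indep g(1) f(1)] phi(1) by simp
    moreover have "open (ball x r1 \<times> (UNIV :: real set))" by (intro open_Times) auto
    moreover have "continuous_on (ball x r1 \<times> UNIV) \<phi>"
      using phi(2) unfolding C2_on_bounded_def has_C2_partials_def by (blast intro: continuous_on_subset)
    moreover have "continuous_on (ball x r1 \<times> UNIV) (\<lambda>z. g (fst z) * f (snd z - m (fst z)))"
    proof (intro continuous_intros continuous_on_compose2[OF f_cont])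
      show "continuous_on (ball x r1 \<times> UNIV) (\<lambda>z :: (real^'d) \<times> real. g (fst z))"
        by (rule continuous_on_compose2[OF cont(2)]) (auto intro!: continuous_intros)
      show "continuous_on (ball x r1 \<times> UNIV) (\<lambda>z :: (real^'d) \<times> real. m (fst z))"
        by (rule continuous_on_compose2[OF cont(1)]) (auto intro!: continuous_intros)
    qed auto
    ultimately have "\<phi> (x, y) = g (fst (x, y)) * f (snd (x, y) - m (fst (x, y)))"
      by (rule continuous_AE_eq_imp_eq[where T = "ball x r1 \<times> UNIV"]) (use m1(1) in auto)
    then show ?thesis by simp
  qed
  have bias2: "bias2 K1 \<phi> m x \<epsilon> / (2 * g x) = f_bias"
  proof -
    have d1: "deriv (\<lambda>y. g x * f (y - m x)) = (\<lambda>y. g x * deriv f (y - m x))"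
      by (intro ext DERIV_imp_deriv DERIV_cmult fy)
    have f2: "(deriv f has_real_derivative (deriv ^^ 2) f u) (at u)" for u
      using f_C2 unfolding Ck_def by (auto simp: DERIV_deriv_iff_field_differentiable numeral_2_eq_2 dest: spec[of _ 1])
    have "((\<lambda>y. deriv f (y - m x)) has_real_derivative (deriv ^^ 2) f \<epsilon>) (at (m x + \<epsilon>))"
      using f2[of \<epsilon>] DERIV_shift[of "deriv f" _ "m x + \<epsilon>" "- m x"] by simp
    then have d2: "deriv (\<lambda>y. g x * deriv f (y - m x)) (m x + \<epsilon>) = g x * (deriv ^^ 2) f \<epsilon>"
      by (intro DERIV_imp_deriv DERIV_cmult)
    have "(deriv ^^ 2) (\<lambda>y. \<phi> (x, y)) (m x + \<epsilon>) = g x * (deriv ^^ 2) f \<epsilon>"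
      unfolding phi_eq using d1 d2 by (simp add: numeral_2_eq_2)
    then show ?thesis using gx0 by (simp add: bias2_def f_bias_def)
  qed

  have pos: "b0 n > 0" "h0 n > 0" "h1 n > 0" for n using b0(1) h(1,2) by (auto simp: bandwidth_def)
  have lim: "b0 \<longlonglongrightarrow> 0" "h0 \<longlonglongrightarrow> 0" "h1 \<longlonglongrightarrow> 0" using b0(1) h(1,2) by (auto simp: bandwidth_def)
  define \<rho> where "\<rho> n = real n * h0 n ^ d / h1 n" for n
  have \<rho>0: "\<rho> n \<ge> 0" for n using pos[of n] by (simp add: \<rho>_def)
  have main: "(\<lambda>n. \<rho> n * (b0 n ^ 4 + ln (real n) / (real n * b0 n ^ d))) \<longlonglongrightarrow> 0"
    using smalloD_tendsto[OF h(6)] by (simp add: \<rho>_def)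
  have large: "\<forall>\<^sub>F n in sequentially. n \<ge> 3" by (rule eventually_ge_at_top)
  have ln1: "ln (real n) \<ge> 1" if "n \<ge> 3" for n
    using that exp_le ln_mono[of "exp 1" "real n"] by simp
  have bias_lim: "(\<lambda>n. \<rho> n * b0 n ^ 4) \<longlonglongrightarrow> 0"
  proof (rule tendsto_sandwich[OF _ _ tendsto_const main])
    show "\<forall>\<^sub>F n in sequentially. \<rho> n * b0 n ^ 4 \<le> \<rho> n * (b0 n ^ 4 + ln (real n) / (real n * b0 n ^ d))"
      using large by eventually_elim
        (use \<rho>0 pos in \<open>auto intro!: mult_left_mono divide_nonneg_nonneg simp: less_imp_le\<close>)
  qed (use \<rho>0 pos in auto)
  have ln_lim: "(\<lambda>n. \<rho> n * (ln (real n) / (real n * b0 n ^ d))) \<longlonglongrightarrow> 0"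
    using tendsto_diff[OF main bias_lim] by (simp add: algebra_simps)
  have var_lim: "(\<lambda>n. \<rho> n / (real n * b0 n ^ d)) \<longlonglongrightarrow> 0"
  proof (rule tendsto_sandwich[OF _ _ tendsto_const ln_lim])
    show "\<forall>\<^sub>F n in sequentially. \<rho> n / (real n * b0 n ^ d) \<le> \<rho> n * (ln (real n) / (real n * b0 n ^ d))"
      using large
    proof eventually_elim
      case (elim n)
      have "\<rho> n * (1 / (real n * b0 n ^ d)) \<le> \<rho> n * (ln (real n) / (real n * b0 n ^ d))"
        using \<rho>0 pos[of n] ln1[OF elim] by (intro mult_left_mono divide_right_mono) auto
      then show ?case by simp
    qed
  qed (use \<rho>0 pos in \<open>auto intro!: always_eventually divide_nonneg_nonneg simp: less_imp_le\<close>)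
  have h1_le: "\<forall>\<^sub>F n in sequentially. h1 n \<le> 1"
    using order_tendstoD(2)[OF lim(3), of 1] by (auto elim: eventually_mono)
  have \<rho>_ge: "\<forall>\<^sub>F n in sequentially. 1 \<le> \<rho> n"
  proof -
    have "\<forall>\<^sub>F n in sequentially. 1 \<le> real n * h0 n ^ d * h1 n" using h(5) by (simp add: filterlim_at_top)
    with h1_le show ?thesis
    proof eventually_elim
      case (elim n)
      have "real n * h0 n ^ d * h1 n \<le> real n * h0 n ^ d / h1 n"
      proof -
        have "h1 n \<le> 1 / h1 n" using elim(1) pos(3)[of n] by (simp add: le_divide_eq mult_le_one)
        then have "real n * h0 n ^ d * h1 n \<le> real n * h0 n ^ d * (1 / h1 n)"
          using pos(2)[of n] by (intro mult_left_mono) auto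
        then show ?thesis by simp
      qed
      then show ?case using elim(2) by (simp add: \<rho>_def)
    qed
  qed
  have nb: "filterlim (\<lambda>n. real n * b0 n ^ d) at_top sequentially"
  proof -
    have "(\<lambda>n. inverse (real n * b0 n ^ d)) \<longlonglongrightarrow> 0"
    proof (rule tendsto_sandwich[OF _ _ tendsto_const var_lim])
      show "\<forall>\<^sub>F n in sequentially. inverse (real n * b0 n ^ d) \<le> \<rho> n / (real n * b0 n ^ d)"
        using \<rho>_ge
      proof eventually_elim
        case (elim n)
        have "1 * inverse (real n * b0 n ^ d) \<le> \<rho> n * inverse (real n * b0 n ^ d)"
          using elim pos[of n] by (intro mult_right_mono) auto
        then show ?case by (simp add: divide_inverse)
      qed
    qed (use pos in \<open>auto intro!: always_eventually simp: less_imp_le\<close>)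
    moreover have "\<forall>\<^sub>F n in sequentially. inverse (real n * b0 n ^ d) > 0"
      using large by eventually_elim (use pos in auto)
    ultimately have "filterlim (\<lambda>n. inverse (inverse (real n * b0 n ^ d))) at_top sequentially"
      by (rule filterlim_inverse_at_top)
    then show ?thesis by simp
  qed
  \<comment> \<open>The logarithmic part of the last bandwidth condition reads \<open>h0^d ln n / (h1 b0^d) \<rightarrow> 0\<close>.\<close>
  have h_le_b: "\<forall>\<^sub>F n in sequentially. h0 n \<le> b0 n"
  proof -
    have "\<forall>\<^sub>F n in sequentially. \<rho> n * (ln (real n) / (real n * b0 n ^ d)) < 1"
      using ln_lim by (rule order_tendstoD) simp
    with large h1_le show ?thesis
    proof eventually_elim
      case (elim n)
      have n0: "real n > 0" using elim by simp
      have "h0 n ^ d / (h1 n * b0 n ^ d) \<le> h0 n ^ d / (h1 n * b0 n ^ d) * ln (real n)"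
        using mult_left_mono[OF ln1[OF elim(1)], of "h0 n ^ d / (h1 n * b0 n ^ d)"] pos[of n] by simp
      also have "\<dots> = \<rho> n * (ln (real n) / (real n * b0 n ^ d))"
        using n0 by (simp add: \<rho>_def)
      finally have "h0 n ^ d / (h1 n * b0 n ^ d) < 1" using elim by linarith
      then have "h0 n ^ d \<le> h1 n * b0 n ^ d" using pos[of n] by (simp add: divide_less_eq)
      also have "\<dots> \<le> 1 * b0 n ^ d" using elim pos[of n] by (intro mult_right_mono) auto
      finally have "h0 n ^ d \<le> b0 n ^ d" by simp
      then show ?case using pos[of n] d by (simp add: power_mono_iff)
    qed
  qed
  \<comment> \<open>Here \<open>(a\<^sub>n h0\<^sup>2)\<^sup>2 = \<rho> n h1\<^sup>2 h0^4\<close> is compared with \<open>\<rho> n b0^4\<close>.\<close>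
  have undersmooth: "(\<lambda>n. sqrt (real n * h0 n ^ d * h1 n) * (h0 n)\<^sup>2) \<longlonglongrightarrow> 0"
  proof (rule tendsto_sandwich[OF _ _ tendsto_const])
    show "(\<lambda>n. sqrt (\<rho> n * b0 n ^ 4)) \<longlonglongrightarrow> 0" using tendsto_real_sqrt[OF bias_lim] by simp
    show "\<forall>\<^sub>F n in sequentially. sqrt (real n * h0 n ^ d * h1 n) * (h0 n)\<^sup>2 \<le> sqrt (\<rho> n * b0 n ^ 4)"
      using h1_le h_le_b
    proof eventually_elim
      case (elim n)
      have "real n * h0 n ^ d * h1 n = \<rho> n * (h1 n)\<^sup>2" using pos(3)[of n] by (simp add: \<rho>_def power2_eq_square)
      also have "\<dots> \<le> \<rho> n * 1" using elim pos(3)[of n] \<rho>0 by (intro mult_left_mono) (auto simp: power_le_one)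
      finally have "real n * h0 n ^ d * h1 n * h0 n ^ 4 \<le> \<rho> n * b0 n ^ 4"
        using elim pos(2)[of n] \<rho>0 by (intro mult_mono power_mono) auto
      moreover have "sqrt (real n * h0 n ^ d * h1 n) * (h0 n)\<^sup>2 = sqrt (real n * h0 n ^ d * h1 n * h0 n ^ 4)"
      proof -
        have "h0 n ^ 4 = ((h0 n)\<^sup>2)\<^sup>2" by simp
        then show ?thesis by (simp only: real_sqrt_mult real_sqrt_abs) simp
      qed
      ultimately show ?case by simp
    qed
  qed (use pos in \<open>auto intro!: always_eventually simp: less_imp_le\<close>)

  define \<beta> where "\<beta> = bias1 K0 \<phi> m x \<epsilon> / (2 * g x)"
  obtain \<delta> where \<delta>: "\<delta> \<in> o(\<lambda>n. (h0 n)\<^sup>2 + (h1 n)\<^sup>2)" "\<delta> \<longlonglongrightarrow> 0"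
    "(\<lambda>n. sqrt (real n * h0 n ^ d * h1 n) * (num_mean (h0 n) (h1 n)
        - (f \<epsilon> + (h0 n)\<^sup>2 * \<beta> + (h1 n)\<^sup>2 * f_bias + \<delta> n) * dens_mean (h0 n))) \<longlonglongrightarrow> 0"
    using centering_exists[OF pos(2) lim(2) pos(3) lim(3) undersmooth, of \<beta>] by blast
  define fbar where "fbar n = f \<epsilon> + (h0 n)\<^sup>2 * \<beta> + (h1 n)\<^sup>2 * f_bias + \<delta> n" for n
  have fbar_lim: "fbar \<longlonglongrightarrow> f \<epsilon>"
    unfolding fbar_def by (rule tendsto_eq_intros lim \<delta> refl | simp)+
  have "fbar n - (f \<epsilon> + (h0 n)\<^sup>2 * bias1 K0 \<phi> m x \<epsilon> / (2 * g x) + (h1 n)\<^sup>2 * bias2 K1 \<phi> m x \<epsilon> / (2 * g x)) = \<delta> n" for n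
    unfolding fbar_def \<beta>_def bias2[symmetric] by simp
  then have exp: "(\<lambda>n. fbar n - (f \<epsilon> + (h0 n)\<^sup>2 * bias1 K0 \<phi> m x \<epsilon> / (2 * g x)
       + (h1 n)\<^sup>2 * bias2 K1 \<phi> m x \<epsilon> / (2 * g x))) \<in> o(\<lambda>n. (h0 n)\<^sup>2 + (h1 n)\<^sup>2)"
    using \<delta>(1) by simp
  have variance: "f \<epsilon> / g x * (\<integral>z. (\<integral>v. (K0 z)\<^sup>2 * (K1 v)\<^sup>2 \<partial>lborel) \<partial>lborel) = limit_variance"
    by (simp add: limit_variance_def)
  show ?thesis
    unfolding variance
    using exp asymptotic_normality[OF pos(1) lim(1) pos(2) lim(2) pos(3) lim(3) nb[unfolded d] h(5)[unfolded d]
        var_lim[unfolded \<rho>_def d] bias_lim[unfolded \<rho>_def d] fbar_lim \<delta>(3)[folded fbar_def, unfolded d]]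
    unfolding d by blast
qed

end
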